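(* Let $f\in\mathcal{L}$ and suppose $f=p_1\circ p_2\circ\dots\circ p_r=q_1\circ q_2\circ\dots\circ q_s$, where all $p_i,q_j\in\mathbb{C}(x)$ are indecomposable. Then the sequences $(\deg(p_1),\dots,\deg(p_r))$ and $(\deg(q_1),\dots,\deg(q_s))$ are permutations of one another (so $r=s$). Moreover, there is a finite sequence of complete decompositions of $f$ which begins with $p_1\circ\dots\circ p_r$ and ends with $q_1\circ\dots\circ q_s$, where consecutive decompositions in the sequence differ only in that two adjacent indecomposables in the first decomposition are replaced in the second decomposition by two others having the same composition.
   Context: $\mathcal{L}$ denotes the set of complex Laurent polynomials, i.e. rational functions of the form $F(x)/x^n$ with $F\in\mathbb{C}[x]$ and $n\in\mathbb{Z}_{\ge 0}$. Composition is $(g\circ h)(x)=g(h(x))$. The degree of a rational function is the maximum of the degrees of numerator and denominator in lowest terms. A rational function of degree $>1$ is indecomposable if it cannot be written as the composition of rational functions of strictly lower degrees. A complete decomposition of a rational function is an expression of it as a composition of indecomposable rational functions. *)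

theory Defs
  imports
    "HOL-Computational_Algebra.Computational_Algebra"
    "HOL-Computational_Algebra.Field_as_Ring"
    "HOL-Library.Multiset"
begin

type_synonym ratfun = "complex poly fract"

definition laurent_polys :: "ratfun set" where
  "laurent_polys = {Fract F (monom 1 n) | F n. True}"

text \<open>\<^const>\<open>quot_of_fract\<close> returns numerator and denominator in lowest terms.\<close>

definition rat_degree :: "ratfun \<Rightarrow> nat" where
  "rat_degree f = max (degree (fst (quot_of_fract f))) (degree (snd (quot_of_fract f)))"

definition poly_at :: "complex poly \<Rightarrow> ratfun \<Rightarrow> ratfun" where
  "poly_at p h = poly (map_poly (\<lambda>c. to_fract [:c:]) p) h"

text \<open>
  If the denominator of \<open>g\<close> vanishes at \<open>h\<close>, then \<open>h\<close> is a constant that is a pole of \<open>g\<close>,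
  and the quotient below is \<open>0\<close> by the convention for division by zero. So the composition
  is a constant whenever \<open>h\<close> is, and the convention plays no role for compositions of
  nonconstant functions.
\<close>

definition rat_comp :: "ratfun \<Rightarrow> ratfun \<Rightarrow> ratfun"  (infixr \<open>\<circ>\<^sub>R\<close> 55) where
  "g \<circ>\<^sub>R h = poly_at (fst (quot_of_fract g)) h / poly_at (snd (quot_of_fract g)) h"

definition indecomposable :: "ratfun \<Rightarrow> bool" where
  "indecomposable f \<longleftrightarrow> rat_degree f > 1 \<and>
     \<not> (\<exists>g h. f = g \<circ>\<^sub>R h \<and> rat_degree g < rat_degree f \<and> rat_degree h < rat_degree f)"

text \<open>The innermost function of the fold is the identity function \<open>x\<close>.\<close>

definition rat_comp_list :: "ratfun list \<Rightarrow> ratfun" where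
  "rat_comp_list ps = foldr (\<circ>\<^sub>R) ps (to_fract [:0, 1:])"

definition complete_decomposition :: "ratfun list \<Rightarrow> ratfun \<Rightarrow> bool" where
  "complete_decomposition ps f \<longleftrightarrow>
     ps \<noteq> [] \<and> (\<forall>p \<in> set ps. indecomposable p) \<and> f = rat_comp_list ps"

definition ritt_step :: "ratfun list \<Rightarrow> ratfun list \<Rightarrow> bool" where
  "ritt_step D E \<longleftrightarrow>
     (\<exists>us a b c d vs. D = us @ [a, b] @ vs \<and> E = us @ [c, d] @ vs \<and>
        (a, b) \<noteq> (c, d) \<and> a \<circ>\<^sub>R b = c \<circ>\<^sub>R d)"

end

theory Submission
  imports Defs
begin

text \<open>
  By Lueroth's theorem, decompositions of \<open>f\<close> correspond to chains of fields between \<open>\<complex>(f)\<close> and \<open>\<complex>(x)\<close>.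
  Induct on \<open>deg f\<close> and let \<open>p\<close>, \<open>q\<close> be the rightmost functions of two complete decompositions of \<open>f\<close>.
  If \<open>\<complex>(p) = \<complex>(q)\<close>, cancel them. Otherwise it suffices to find \<open>u = a \<circ> p = b \<circ> q\<close> with \<open>f \<in> \<complex>(u)\<close>, where
  \<open>a\<close> and \<open>b\<close> are indecomposable with \<open>deg a = deg q\<close> and \<open>deg b = deg p\<close>: then \<open>f\<close> has decompositions ending
  in \<open>a \<circ> p\<close> and \<open>b \<circ> q\<close>, and the induction hypothesis connects them to the given ones. For \<open>u\<close> of minimal
  degree in \<open>\<complex>(p) \<inter> \<complex>(q)\<close> with \<open>f \<in> \<complex>(u)\<close>, this holds as soon as \<open>deg b = deg p\<close>.

  Since \<open>f\<close> has at most two poles, linear changes of variable bring \<open>p\<close> into one of two forms: a power \<open>x^k\<close>, or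
  a Laurent polynomial with \<open>f = F \<circ> p\<close> for a polynomial \<open>F\<close>. If \<open>p = x^k\<close>, replacing \<open>x\<close> by \<open>\<zeta> x\<close> for a
  \<open>k\<close>-th root of unity \<open>\<zeta>\<close> gives a symmetry of \<open>f\<close> which determines \<open>q\<close>. If both are of the second form, then
  \<open>a\<close> and \<open>b\<close> may be taken to be polynomials. The coefficients of the minimal polynomial of \<open>q\<close> over \<open>\<complex>(p)\<close>
  generate a field between \<open>\<complex>(u)\<close> and \<open>\<complex>(p)\<close>; Puiseux expansions at infinity show that either
  \<open>deg b = deg p\<close> or \<open>deg a\<close> divides \<open>deg b\<close>. By symmetry there remains the case \<open>deg a = deg b\<close>, where
  comparing \<open>a(p) = b(q)\<close> at both poles forces \<open>p\<close> and \<open>q\<close> to be of the form \<open>s x + t + r / x\<close>. Then \<open>f\<close> is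
  invariant under a dihedral group, so \<open>f \<in> \<complex>(x^k)\<close> for a prime \<open>k\<close>, and one passes from \<open>p\<close> to \<open>q\<close> via \<open>x^k\<close>.
\<close>

section \<open>Evaluating rational functions in a field extension\<close>

text \<open>Some restriction on the poles is unavoidable. For the alternating group on four letters
  acting on \<complex>(x) by Moebius maps, the subgroup chains through the Klein group and through a
  group of order 3 give complete decompositions of one function with different lengths. The
  exceptional case of equal degrees is genuine. If \<open>c / c'\<close> is a root of unity of order
  \<open>N\<close>, then \<open>x + c / x\<close> and \<open>x + c' / x\<close> have a least common
  composite of degree \<open>2 N\<close>, so a direct exchange has the right degrees only for
  \<open>N = 2\<close>. This is why the chain has to pass through some \<open>x^k\<close>. Rational
  functions are evaluated in two extensions of the complex numbers: in \<complex>(x), where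
  evaluation is composition, and in Laurent series in \<open>1 / z\<close>, which describe the
  branches at infinity. The locale treats both at once.\<close>

locale complex_embedding =
  fixes \<kappa> :: "complex \<Rightarrow> 'e::field"
  assumes \<kappa>_add: "\<kappa> (a + b) = \<kappa> a + \<kappa> b"
    and \<kappa>_mult: "\<kappa> (a * b) = \<kappa> a * \<kappa> b"
    and \<kappa>_1 [simp]: "\<kappa> 1 = 1"
begin

lemma \<kappa>_0 [simp]: "\<kappa> 0 = 0"
  using \<kappa>_add[of 0 0] by (metis add_cancel_right_right add_0)

lemma \<kappa>_minus: "\<kappa> (- a) = - \<kappa> a"
  using \<kappa>_add[of a "-a"] by (simp add: eq_neg_iff_add_eq_0 add.commute)

lemma \<kappa>_diff: "\<kappa> (a - b) = \<kappa> a - \<kappa> b"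
  using \<kappa>_add[of a "-b"] \<kappa>_minus[of b] by simp

lemma \<kappa>_eq_0 [simp]: "\<kappa> a = 0 \<longleftrightarrow> a = 0"
proof
  assume "\<kappa> a = 0"
  show "a = 0"
  proof (rule ccontr)
    assume "a \<noteq> 0"
    then have "\<kappa> (a * inverse a) = 1" by simp
    then show False using \<open>\<kappa> a = 0\<close> by (simp only: \<kappa>_mult) simp
  qed
qed simp

lemma \<kappa>_eq [simp]: "\<kappa> a = \<kappa> b \<longleftrightarrow> a = b"
  using \<kappa>_eq_0[of "a - b"] by (simp add: \<kappa>_diff del: \<kappa>_eq_0)

lemma \<kappa>_inverse: "\<kappa> (inverse a) = inverse (\<kappa> a)"
  by (cases "a = 0") (auto intro!: inverse_unique[symmetric] simp flip: \<kappa>_mult)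

lemma \<kappa>_divide: "\<kappa> (a / b) = \<kappa> a / \<kappa> b"
  by (simp add: divide_inverse \<kappa>_mult \<kappa>_inverse)

lemma \<kappa>_power: "\<kappa> (a ^ n) = \<kappa> a ^ n"
  by (induction n) (simp_all add: \<kappa>_mult)

definition peval :: "complex poly \<Rightarrow> 'e \<Rightarrow> 'e" where
  "peval p s = poly (map_poly \<kappa> p) s"

lemma peval_0 [simp]: "peval 0 s = 0"
  by (simp add: peval_def)

lemma peval_pCons: "peval (pCons a p) s = \<kappa> a + s * peval p s"
  by (simp add: peval_def map_poly_pCons)

lemma peval_const [simp]: "peval [:a:] s = \<kappa> a"
  by (simp add: peval_pCons)

lemma peval_1 [simp]: "peval 1 s = 1"
  by (simp add: one_pCons)

lemma peval_X [simp]: "peval [:0, 1:] s = s"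
  by (simp add: peval_pCons)

lemma peval_add: "peval (p + q) s = peval p s + peval q s"
  by (induction p q rule: poly_induct2) (simp_all add: peval_pCons \<kappa>_add algebra_simps)

lemma peval_smult: "peval (smult c p) s = \<kappa> c * peval p s"
  by (induction p) (simp_all add: peval_pCons \<kappa>_mult algebra_simps)

lemma peval_minus: "peval (- p) s = - peval p s"
  using peval_smult[of "-1" p s] by (simp add: \<kappa>_minus)

lemma peval_diff: "peval (p - q) s = peval p s - peval q s"
  using peval_add[of p "-q" s] by (simp add: peval_minus)

lemma peval_mult: "peval (p * q) s = peval p s * peval q s"
  by (induction p) (simp_all add: peval_pCons peval_add peval_smult algebra_simps)

lemma peval_power: "peval (p ^ n) s = peval p s ^ n"
  by (induction n) (simp_all add: peval_mult)

lemma peval_monom: "peval (monom c n) s = \<kappa> c * s ^ n"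
  by (simp add: peval_def map_poly_monom poly_monom)

lemma peval_sum: "peval (sum f A) s = (\<Sum>x\<in>A. peval (f x) s)"
  by (induction A rule: infinite_finite_induct) (simp_all add: peval_add)

lemma peval_altdef: "peval p s = (\<Sum>i\<le>degree p. \<kappa> (coeff p i) * s ^ i)"
proof -
  have "peval p s = peval (\<Sum>i\<le>degree p. monom (coeff p i) i) s"
    by (simp add: poly_as_sum_of_monoms)
  then show ?thesis by (simp add: peval_sum peval_monom)
qed

lemma peval_at_const: "peval p (\<kappa> c) = \<kappa> (poly p c)"
  by (induction p) (simp_all add: peval_pCons \<kappa>_add \<kappa>_mult)

lemma peval_eq_0_imp_const:
  assumes "p \<noteq> 0" "peval p s = 0"
  shows "\<exists>c. poly p c = 0 \<and> s = \<kappa> c"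
  using assms
proof (induction "degree p" arbitrary: p rule: less_induct)
  case less
  show ?case
  proof (cases "degree p = 0")
    case True
    then obtain a where "p = [:a:]" by (metis degree_eq_zeroE)
    then show ?thesis using less.prems by simp
  next
    case False
    then obtain z where "poly p z = 0"
      using fundamental_theorem_of_algebra[of p] by (auto simp: constant_degree)
    then obtain r where r: "p = [:-z, 1:] * r" by (auto simp: poly_eq_0_iff_dvd)
    then have "r \<noteq> 0" using less.prems by auto
    then have deg: "degree r < degree p" unfolding r by (subst degree_mult_eq) auto
    have "(s - \<kappa> z) * peval r s = 0"
      using less.prems(2) unfolding r by (simp only: peval_mult) (simp add: peval_pCons \<kappa>_minus)
    then consider "s = \<kappa> z" | "peval r s = 0" by auto
    then show ?thesis
    proof cases
      case 1 then show ?thesis using \<open>poly p z = 0\<close> by blast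
    next
      case 2
      from less.hyps[OF deg \<open>r \<noteq> 0\<close> 2] show ?thesis by (auto simp: r)
    qed
  qed
qed

text \<open>The complex numbers are algebraically closed, so every element outside their image is
  transcendental over it (\<open>peval_eq_0_imp_const\<close>), and non-membership can serve as the
  definition.\<close>

definition transc :: "'e \<Rightarrow> bool" where
  "transc s \<longleftrightarrow> s \<notin> range \<kappa>"

lemma peval_eq_0_iff: "transc s \<Longrightarrow> peval p s = 0 \<longleftrightarrow> p = 0"
  using peval_eq_0_imp_const[of p s] by (auto simp: transc_def)

definition reval :: "'e \<Rightarrow> ratfun \<Rightarrow> 'e" where
  "reval s g = peval (fst (quot_of_fract g)) s / peval (snd (quot_of_fract g)) s"

text \<open>No denominator vanishes at a transcendental \<open>s\<close>, so any representative may
  replace the one in lowest terms. This makes \<open>reval s\<close> a field homomorphism.\<close>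

lemma reval_Fract:
  assumes "transc s" "Q \<noteq> 0"
  shows "reval s (Fract P Q) = peval P s / peval Q s"
proof -
  define N D where "N = fst (quot_of_fract (Fract P Q))" and "D = snd (quot_of_fract (Fract P Q))"
  have D: "D \<noteq> 0" by (simp add: D_def)
  have "Fract N D = Fract P Q" by (simp add: N_def D_def)
  then have "N * Q = P * D" using assms D by (simp add: eq_fract)
  then have "peval N s * peval Q s = peval P s * peval D s" by (metis peval_mult)
  then show ?thesis
    using assms D unfolding reval_def N_def[symmetric] D_def[symmetric]
    by (simp add: frac_eq_eq peval_eq_0_iff)
qed

lemma reval_to_fract [simp]: "reval s (to_fract p) = peval p s"
  by (simp add: reval_def)

lemma reval_add:
  assumes "transc s" shows "reval s (g + h) = reval s g + reval s h"
  by (cases g, cases h) (simp add: reval_Fract assms peval_add peval_mult peval_eq_0_iff field_simps)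

lemma reval_mult:
  assumes "transc s" shows "reval s (g * h) = reval s g * reval s h"
  by (cases g, cases h) (simp add: reval_Fract assms peval_add peval_mult peval_eq_0_iff field_simps)

lemma reval_0 [simp]: "reval s 0 = 0"
  by (simp add: reval_def)

lemma reval_1 [simp]: "reval s 1 = 1"
  by (simp add: reval_def)

lemma reval_minus: "transc s \<Longrightarrow> reval s (- g) = - reval s g"
  using reval_add[of s g "-g"] by (simp add: eq_neg_iff_add_eq_0 add.commute)

lemma reval_diff: "transc s \<Longrightarrow> reval s (g - h) = reval s g - reval s h"
  using reval_add[of s g "-h"] by (simp add: reval_minus)

lemma reval_eq_0_iff: "transc s \<Longrightarrow> reval s g = 0 \<longleftrightarrow> g = 0"
  by (simp add: reval_def peval_eq_0_iff)

lemma reval_inj: "transc s \<Longrightarrow> reval s g = reval s h \<Longrightarrow> g = h"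
  using reval_eq_0_iff[of s "g - h"] by (simp add: reval_diff)

lemma reval_inverse: "transc s \<Longrightarrow> reval s (inverse g) = inverse (reval s g)"
  by (cases "g = 0") (auto intro!: inverse_unique[symmetric] simp flip: reval_mult)

lemma reval_divide: "transc s \<Longrightarrow> reval s (g / h) = reval s g / reval s h"
  by (simp add: divide_inverse reval_mult reval_inverse)

lemma reval_power: "transc s \<Longrightarrow> reval s (g ^ n) = reval s g ^ n"
  by (induction n) (simp_all add: reval_mult)

lemma reval_sum: "transc s \<Longrightarrow> reval s (sum f A) = (\<Sum>x\<in>A. reval s (f x))"
  by (induction A rule: infinite_finite_induct) (simp_all add: reval_add)

end

section \<open>Composition of rational functions as evaluation in \<complex>(x)\<close>

abbreviation cst :: "complex \<Rightarrow> ratfun" where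
  "cst c \<equiv> to_fract [:c:]"

abbreviation ratX :: ratfun where
  "ratX \<equiv> to_fract [:0, 1:]"

interpretation rc: complex_embedding cst
  by unfold_locales (simp_all add: mult.commute one_pCons flip: to_fract_add to_fract_mult to_fract_1)

abbreviation nonconst :: "ratfun \<Rightarrow> bool" where
  "nonconst h \<equiv> rc.transc h"

lemma rat_comp_eq_reval: "g \<circ>\<^sub>R h = rc.reval h g"
  by (simp add: rat_comp_def poly_at_def rc.reval_def rc.peval_def)

lemma to_fract_comp [simp]: "to_fract p \<circ>\<^sub>R h = rc.peval p h"
  by (simp add: rat_comp_eq_reval)

lemma cst_comp: "cst c \<circ>\<^sub>R h = cst c"
  by simp

lemma X_comp: "ratX \<circ>\<^sub>R h = h"
  by simp

lemma zero_comp [simp]: "0 \<circ>\<^sub>R h = 0"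
  and one_comp [simp]: "1 \<circ>\<^sub>R h = 1"
  by (simp_all add: rat_comp_eq_reval)

lemmas rat_comp_add = rc.reval_add[folded rat_comp_eq_reval]
  and rat_comp_mult = rc.reval_mult[folded rat_comp_eq_reval]
  and rat_comp_minus = rc.reval_minus[folded rat_comp_eq_reval]
  and rat_comp_diff = rc.reval_diff[folded rat_comp_eq_reval]
  and rat_comp_inverse = rc.reval_inverse[folded rat_comp_eq_reval]
  and rat_comp_divide = rc.reval_divide[folded rat_comp_eq_reval]
  and rat_comp_power = rc.reval_power[folded rat_comp_eq_reval]
  and rat_comp_sum = rc.reval_sum[folded rat_comp_eq_reval]
  and rat_comp_eq_0_iff = rc.reval_eq_0_iff[folded rat_comp_eq_reval]
  and rat_comp_inj = rc.reval_inj[folded rat_comp_eq_reval]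
  and rat_comp_Fract = rc.reval_Fract[folded rat_comp_eq_reval]

lemmas rat_comp_hom = rat_comp_add rat_comp_mult rat_comp_minus rat_comp_diff rat_comp_inverse
  rat_comp_divide rat_comp_power rat_comp_sum

lemma peval_to_fract: "rc.peval p (to_fract q) = to_fract (pcompose p q)"
  by (induction p) (simp_all add: rc.peval_pCons pcompose_pCons)

lemma peval_ratX [simp]: "rc.peval p ratX = to_fract p"
  by (simp add: peval_to_fract pcompose_idR)

lemma rat_comp_X [simp]: "g \<circ>\<^sub>R ratX = g"
  by (simp add: rat_comp_eq_reval rc.reval_def to_fract_quot_of_fract flip: Fract_conv_to_fract)

lemma rat_comp_peval:
  assumes "nonconst h" shows "rc.peval p g \<circ>\<^sub>R h = rc.peval p (g \<circ>\<^sub>R h)"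
  by (induction p) (simp_all add: rc.peval_pCons rat_comp_hom assms)

text \<open>Right composition with a nonconstant \<open>h\<close> is a field endomorphism of
  \<complex>(x), so it commutes with evaluating numerator and denominator of \<open>f\<close> at
  \<open>g\<close>. If \<open>g\<close> is a constant pole of \<open>f\<close>, both sides are the
  default value 0.\<close>

lemma rat_comp_assoc:
  assumes "nonconst h" shows "(f \<circ>\<^sub>R g) \<circ>\<^sub>R h = f \<circ>\<^sub>R (g \<circ>\<^sub>R h)"
proof -
  have "(f \<circ>\<^sub>R g) \<circ>\<^sub>R h =
     (rc.peval (fst (quot_of_fract f)) g / rc.peval (snd (quot_of_fract f)) g) \<circ>\<^sub>R h"
    by (simp add: rat_comp_eq_reval[of f g] rc.reval_def)
  also have "\<dots> = f \<circ>\<^sub>R (g \<circ>\<^sub>R h)"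
    by (simp add: rat_comp_divide rat_comp_peval assms rat_comp_eq_reval[of f "g \<circ>\<^sub>R h"] rc.reval_def)
  finally show ?thesis .
qed

lemma nonconst_X [simp]: "nonconst ratX"
  by (auto simp: rc.transc_def)

lemma not_nonconst_comp_right: "\<not> nonconst h \<Longrightarrow> \<not> nonconst (g \<circ>\<^sub>R h)"
  by (auto simp: rat_comp_eq_reval rc.reval_def rc.transc_def rc.peval_at_const simp flip: rc.\<kappa>_divide)

lemma not_nonconst_comp_left: "\<not> nonconst g \<Longrightarrow> \<not> nonconst (g \<circ>\<^sub>R h)"
  by (auto simp: rc.transc_def)

lemma nonconst_comp_iff: "nonconst (g \<circ>\<^sub>R h) \<longleftrightarrow> nonconst g \<and> nonconst h"
proof -
  have "nonconst (g \<circ>\<^sub>R h)" if "nonconst g" "nonconst h"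
  proof (rule ccontr)
    assume "\<not> ?thesis"
    then obtain c where "g \<circ>\<^sub>R h = cst c \<circ>\<^sub>R h" by (auto simp: rc.transc_def)
    then have "g = cst c" using rat_comp_inj that by blast
    then show False using that by (auto simp: rc.transc_def)
  qed
  then show ?thesis using not_nonconst_comp_left not_nonconst_comp_right by blast
qed

section \<open>Degrees\<close>

lemma coprime_iff_no_common_root:
  fixes P Q :: "complex poly"
  assumes "P \<noteq> 0 \<or> Q \<noteq> 0"
  shows "coprime P Q \<longleftrightarrow> (\<forall>z. poly P z \<noteq> 0 \<or> poly Q z \<noteq> 0)"
proof
  assume "coprime P Q" then show "\<forall>z. poly P z \<noteq> 0 \<or> poly Q z \<noteq> 0"
    using coprime_poly_0 by blast
next
  assume *: "\<forall>z. poly P z \<noteq> 0 \<or> poly Q z \<noteq> 0"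
  show "coprime P Q"
  proof (rule ccontr)
    assume "\<not> coprime P Q"
    then have nu: "\<not> is_unit (gcd P Q)" by (simp add: coprime_iff_gcd_eq_1)
    moreover have "gcd P Q \<noteq> 0" using assms by simp
    ultimately have "degree (gcd P Q) \<noteq> 0" by (metis is_unit_iff_degree)
    then obtain z where "poly (gcd P Q) z = 0"
      using fundamental_theorem_of_algebra[of "gcd P Q"] by (auto simp: constant_degree)
    then have "[:-z, 1:] dvd gcd P Q" by (simp add: poly_eq_0_iff_dvd)
    then have "[:-z, 1:] dvd P" "[:-z, 1:] dvd Q" by auto
    then show False using * by (metis poly_eq_0_iff_dvd)
  qed
qed

lemma ratfun_cases:
  fixes h :: ratfun
  obtains P Q where "h = Fract P Q" "Q \<noteq> 0" "coprime P Q"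
    "P = fst (quot_of_fract h)" "Q = snd (quot_of_fract h)"
  using that[of "fst (quot_of_fract h)" "snd (quot_of_fract h)"] by (simp add: coprime_quot_of_fract)

lemma rat_degree_Fract:
  assumes "coprime P Q" "Q \<noteq> 0"
  shows "rat_degree (Fract P Q) = max (degree P) (degree Q)"
proof -
  obtain N D where ND: "Fract P Q = Fract N D" "D \<noteq> 0" "coprime N D"
    and nd: "N = fst (quot_of_fract (Fract P Q))" "D = snd (quot_of_fract (Fract P Q))"
    by (rule ratfun_cases)
  have eq: "P * D = N * Q" using ND assms by (simp add: eq_fract)
  have "P dvd N" using eq assms(1) by (metis coprime_dvd_mult_left_iff dvd_triv_left)
  moreover have "N dvd P" using eq ND(3) by (metis coprime_dvd_mult_left_iff dvd_triv_left)
  ultimately have 1: "degree N = degree P" by (metis dvd_0_left_iff dvd_imp_degree_le le_antisym)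
  have "Q dvd D" using eq assms(1) by (metis coprime_commute coprime_dvd_mult_right_iff dvd_triv_right)
  moreover have "D dvd Q" using eq ND(3) by (metis coprime_commute coprime_dvd_mult_right_iff dvd_triv_right)
  ultimately have 2: "degree D = degree Q" by (metis dvd_0_left_iff dvd_imp_degree_le le_antisym)
  show ?thesis by (simp add: rat_degree_def flip: nd 1 2)
qed

lemma rat_degree_to_fract [simp]: "rat_degree (to_fract p) = degree p"
  by (simp add: rat_degree_def)

lemma rat_degree_eq_0_iff: "rat_degree h = 0 \<longleftrightarrow> \<not> nonconst h"
proof
  assume 0: "rat_degree h = 0"
  obtain P Q where PQ: "h = Fract P Q" "Q \<noteq> 0" "coprime P Q" by (rule ratfun_cases)
  then have "degree P = 0" "degree Q = 0" using 0 by (simp_all add: rat_degree_Fract)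
  then obtain a b where ab: "P = [:a:]" "Q = [:b:]" by (metis degree_eq_zeroE)
  then have "h = cst (a / b)" using PQ
    by (simp add: Fract_conv_to_fract rc.\<kappa>_divide)
  then show "\<not> nonconst h" by (auto simp: rc.transc_def)
qed (auto simp: rc.transc_def)

lemma nonconst_iff_degree: "nonconst h \<longleftrightarrow> rat_degree h > 0"
  using rat_degree_eq_0_iff[of h] by auto

text \<open>The form of degree \<open>d\<close> that homogenises \<open>N\<close>, taken at
  \<open>(P, Q)\<close>: for \<open>degree N \<le> d\<close> it is \<open>Q^d * N(P / Q)\<close>.
  One common \<open>d\<close> serves numerator and denominator of a fraction.\<close>

definition homog :: "nat \<Rightarrow> complex poly \<Rightarrow> complex poly \<Rightarrow> complex poly \<Rightarrow> complex poly" where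
  "homog d N P Q = (\<Sum>i\<le>d. smult (coeff N i) (P ^ i * Q ^ (d - i)))"

lemma to_fract_power: "to_fract (p ^ n) = to_fract p ^ n"
  by (induction n) simp_all

lemma to_fract_smult: "to_fract (smult c p) = cst c * to_fract p"
  by (simp flip: to_fract_mult)

lemma to_fract_homog:
  assumes "Q \<noteq> 0" "degree N \<le> d"
  shows "to_fract (homog d N P Q) = to_fract Q ^ d * rc.peval N (Fract P Q)"
proof -
  have "rc.peval N (Fract P Q) = (\<Sum>i\<le>d. cst (coeff N i) * Fract P Q ^ i)"
    unfolding rc.peval_altdef
    by (rule sum.mono_neutral_left) (use assms in \<open>auto simp: coeff_eq_0\<close>)
  also have "to_fract Q ^ d * \<dots> = (\<Sum>i\<le>d. cst (coeff N i) * (to_fract P ^ i * to_fract Q ^ (d - i)))"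
    unfolding sum_distrib_left
  proof (rule sum.cong[OF refl])
    fix i assume "i \<in> {..d}"
    then have "to_fract Q ^ d = to_fract Q ^ i * to_fract Q ^ (d - i)"
      by (simp flip: power_add)
    then show "to_fract Q ^ d * (cst (coeff N i) * Fract P Q ^ i) =
       cst (coeff N i) * (to_fract P ^ i * to_fract Q ^ (d - i))"
      using assms(1) by (simp add: Fract_conv_to_fract power_divide field_simps)
  qed
  finally show ?thesis by (simp add: homog_def to_fract_smult to_fract_power)
qed

text \<open>The same form at the point \<open>(\<alpha> : \<beta>)\<close> of the projective line;
  \<open>\<beta> = 0\<close> is the point at infinity.\<close>

definition homogv :: "nat \<Rightarrow> complex poly \<Rightarrow> complex \<Rightarrow> complex \<Rightarrow> complex" where
  "homogv d N \<alpha> \<beta> = (\<Sum>i\<le>d. coeff N i * (\<alpha> ^ i * \<beta> ^ (d - i)))"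

lemma poly_homog: "poly (homog d N P Q) z = homogv d N (poly P z) (poly Q z)"
  by (simp add: homog_def homogv_def poly_sum)

lemma homogv_zero_right: "homogv d N \<alpha> 0 = coeff N d * \<alpha> ^ d"
proof -
  have "homogv d N \<alpha> 0 = (\<Sum>i\<in>{d}. coeff N i * (\<alpha> ^ i * 0 ^ (d - i)))"
    unfolding homogv_def by (rule sum.mono_neutral_right) auto
  then show ?thesis by simp
qed

lemma homogv_nonzero_right:
  assumes "\<beta> \<noteq> 0" "degree N \<le> d"
  shows "homogv d N \<alpha> \<beta> = \<beta> ^ d * poly N (\<alpha> / \<beta>)"
proof -
  have "poly N (\<alpha> / \<beta>) = (\<Sum>i\<le>d. coeff N i * (\<alpha> / \<beta>) ^ i)"
    unfolding poly_altdef
    by (rule sum.mono_neutral_left) (use assms in \<open>auto simp: coeff_eq_0\<close>)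
  then show ?thesis
    unfolding homogv_def sum_distrib_left
    by (auto intro!: sum.cong simp: sum_distrib_left power_divide assms power_diff field_simps)
qed

text \<open>A fraction in lowest terms is a map of the projective line. At a finite point a common
  zero contradicts coprimality; at infinity the forms show the coefficients of index
  \<open>d\<close>, one of which is a leading coefficient.\<close>

lemma homogv_coprime:
  assumes "coprime N D" "\<alpha> \<noteq> 0 \<or> \<beta> \<noteq> 0" "N \<noteq> 0 \<or> D \<noteq> 0" "d = max (degree N) (degree D)"
  shows "homogv d N \<alpha> \<beta> \<noteq> 0 \<or> homogv d D \<alpha> \<beta> \<noteq> 0"
proof (cases "\<beta> = 0")
  case True
  have "coeff N d \<noteq> 0 \<or> coeff D d \<noteq> 0"
  proof (cases "degree N \<le> degree D")
    case True
    then have "coeff D d \<noteq> 0 \<or> D = 0" using assms(4) by auto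
    moreover have "coeff N d \<noteq> 0" if "D = 0" using assms(3,4) that by auto
    ultimately show ?thesis by blast
  next
    case False
    then have "N \<noteq> 0" by auto
    then show ?thesis using assms(4) False by auto
  qed
  then show ?thesis using True assms(2) by (auto simp: homogv_zero_right)
next
  case False
  then show ?thesis
    using coprime_poly_0[OF assms(1), of "\<alpha> / \<beta>"] assms(4) by (auto simp: homogv_nonzero_right)
qed

lemma coprime_homog:
  assumes "coprime N D" "D \<noteq> 0" "d = max (degree N) (degree D)" "coprime P Q"
    and nz: "homog d D P Q \<noteq> 0"
  shows "coprime (homog d N P Q) (homog d D P Q)"
proof -
  have "homogv d N (poly P z) (poly Q z) \<noteq> 0 \<or> homogv d D (poly P z) (poly Q z) \<noteq> 0" for z
    using homogv_coprime[OF assms(1) _ _ assms(3)] coprime_poly_0[OF assms(4)] assms(2) by blast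
  then show ?thesis using nz by (subst coprime_iff_no_common_root) (auto simp: poly_homog)
qed

lemma coeff_mult_bound:
  fixes A B :: "'a::comm_ring_1 poly"
  assumes "degree A \<le> m" "degree B \<le> n"
  shows "coeff (A * B) (m + n) = coeff A m * coeff B n"
proof -
  have "coeff (A * B) (m + n) = (\<Sum>i\<in>{m}. coeff A i * coeff B (m + n - i))"
    unfolding coeff_mult
  proof (rule sum.mono_neutral_right)
    show "\<forall>i\<in>{..m + n} - {m}. coeff A i * coeff B (m + n - i) = 0"
    proof
      fix i assume "i \<in> {..m + n} - {m}"
      then consider "i > m" | "m + n - i > n" by force
      then show "coeff A i * coeff B (m + n - i) = 0"
        using assms by cases (auto simp: coeff_eq_0)
    qed
  qed auto
  then show ?thesis by simp
qed

lemma coeff_power_bound: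
  fixes A :: "'a::comm_ring_1 poly"
  assumes "degree A \<le> m"
  shows "coeff (A ^ k) (k * m) = coeff A m ^ k \<and> degree (A ^ k) \<le> k * m"
proof (induction k)
  case (Suc k)
  then show ?case using coeff_mult_bound[OF assms, of "A ^ k" "k * m"]
    degree_mult_le[of A "A ^ k"] assms by auto
qed simp

text \<open>With \<open>D\<close> the larger of the two degrees,
  \<open>(coeff P D : coeff Q D)\<close> is the value of \<open>P / Q\<close> at infinity.\<close>

lemma coeff_homog_top:
  assumes "degree P \<le> D" "degree Q \<le> D"
  shows "coeff (homog d N P Q) (d * D) = homogv d N (coeff P D) (coeff Q D)"
    and "degree (homog d N P Q) \<le> d * D"
proof -
  have *: "coeff (P ^ i * Q ^ (d - i)) (d * D) = coeff P D ^ i * coeff Q D ^ (d - i) \<and>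
      degree (P ^ i * Q ^ (d - i)) \<le> d * D" if "i \<le> d" for i
  proof -
    have e: "d * D = i * D + (d - i) * D" using that by (simp flip: add_mult_distrib)
    have "degree (P ^ i) \<le> i * D" "degree (Q ^ (d - i)) \<le> (d - i) * D"
      using coeff_power_bound[OF assms(1), of i] coeff_power_bound[OF assms(2), of "d - i"] by auto
    then show ?thesis unfolding e
      using coeff_power_bound[OF assms(1), of i] coeff_power_bound[OF assms(2), of "d - i"]
        coeff_mult_bound[of "P ^ i" "i * D" "Q ^ (d - i)" "(d - i) * D"]
        degree_mult_le[of "P ^ i" "Q ^ (d - i)"] by auto
  qed
  then show "coeff (homog d N P Q) (d * D) = homogv d N (coeff P D) (coeff Q D)"
    by (auto simp: homog_def homogv_def coeff_sum intro!: sum.cong)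
  show "degree (homog d N P Q) \<le> d * D"
    unfolding homog_def
    by (rule degree_sum_le) (use * in \<open>auto intro: order.trans[OF degree_smult_le]\<close>)
qed

lemma comp_Fract_homog:
  assumes "nonconst (Fract P Q)" "Q \<noteq> 0" "D \<noteq> 0" "d = max (degree N) (degree D)"
  shows "Fract N D \<circ>\<^sub>R Fract P Q = Fract (homog d N P Q) (homog d D P Q)"
    and "homog d D P Q \<noteq> 0"
proof -
  have N: "to_fract (homog d N P Q) = to_fract Q ^ d * rc.peval N (Fract P Q)"
    and D: "to_fract (homog d D P Q) = to_fract Q ^ d * rc.peval D (Fract P Q)"
    using assms by (simp_all add: to_fract_homog)
  have "rc.peval D (Fract P Q) \<noteq> 0" using assms by (simp add: rc.peval_eq_0_iff)
  then show "homog d D P Q \<noteq> 0" using D assms(2) by (metis mult_eq_0_iff power_eq_0_iff to_fract_eq_0_iff)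
  show "Fract N D \<circ>\<^sub>R Fract P Q = Fract (homog d N P Q) (homog d D P Q)"
    unfolding rat_comp_Fract[OF assms(1,3)] Fract_conv_to_fract[of "homog d N P Q"] N D
    using assms(2) by simp
qed

text \<open>Homogenising the outer fraction at the inner one again gives lowest terms. No degree is
  lost, because the value of \<open>h\<close> at infinity is not a common zero of the two forms. For
  constant \<open>h\<close> both sides are 0.\<close>

lemma rat_degree_comp: "rat_degree (g \<circ>\<^sub>R h) = rat_degree g * rat_degree h"
proof (cases "nonconst h")
  case False
  then have "rat_degree h = 0" "rat_degree (g \<circ>\<^sub>R h) = 0"
    using not_nonconst_comp_right[OF False, of g] rat_degree_eq_0_iff by blast+
  then show ?thesis by simp
next
  case True
  obtain N D where ND: "g = Fract N D" "D \<noteq> 0" "coprime N D" by (rule ratfun_cases)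
  obtain P Q where PQ: "h = Fract P Q" "Q \<noteq> 0" "coprime P Q" by (rule ratfun_cases)
  define d where "d = max (degree N) (degree D)"
  define E where "E = max (degree P) (degree Q)"
  have gh: "g \<circ>\<^sub>R h = Fract (homog d N P Q) (homog d D P Q)" and nz: "homog d D P Q \<noteq> 0"
    using comp_Fract_homog[of P Q D d N] True ND PQ d_def by auto
  have "coprime (homog d N P Q) (homog d D P Q)"
    by (rule coprime_homog) (use ND PQ d_def nz in auto)
  then have deg: "rat_degree (g \<circ>\<^sub>R h) = max (degree (homog d N P Q)) (degree (homog d D P Q))"
    using gh nz by (simp add: rat_degree_Fract)
  have "coeff P E \<noteq> 0 \<or> coeff Q E \<noteq> 0"
  proof (cases "degree P > degree Q")
    case True
    then have "P \<noteq> 0" by auto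
    then show ?thesis using True by (simp add: E_def)
  next
    case False
    then show ?thesis using PQ(2) by (simp add: E_def max_absorb2)
  qed
  then have "homogv d N (coeff P E) (coeff Q E) \<noteq> 0 \<or> homogv d D (coeff P E) (coeff Q E) \<noteq> 0"
    using homogv_coprime[OF ND(3) _ _ d_def] ND by blast
  then have "coeff (homog d N P Q) (d * E) \<noteq> 0 \<or> coeff (homog d D P Q) (d * E) \<noteq> 0"
    by (simp add: coeff_homog_top E_def)
  then have "d * E \<le> max (degree (homog d N P Q)) (degree (homog d D P Q))"
    using le_degree by (metis max.coboundedI1 max.coboundedI2)
  moreover have "degree (homog d N P Q) \<le> d * E" "degree (homog d D P Q) \<le> d * E"
    by (simp_all add: coeff_homog_top E_def)
  ultimately have "rat_degree (g \<circ>\<^sub>R h) = d * E" using deg by simp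
  then show ?thesis using ND PQ by (simp add: rat_degree_Fract d_def E_def)
qed

section \<open>Linear algebra over the field of rational functions in h\<close>

definition is_subfield :: "'e::field set \<Rightarrow> bool" where
  "is_subfield F \<longleftrightarrow> 0 \<in> F \<and> 1 \<in> F \<and> (\<forall>x\<in>F. \<forall>y\<in>F. x + y \<in> F \<and> x * y \<in> F) \<and>
     (\<forall>x\<in>F. - x \<in> F \<and> inverse x \<in> F)"

lemma is_subfieldD:
  assumes "is_subfield F"
  shows "0 \<in> F" "1 \<in> F" "x \<in> F \<Longrightarrow> y \<in> F \<Longrightarrow> x + y \<in> F" "x \<in> F \<Longrightarrow> y \<in> F \<Longrightarrow> x * y \<in> F"
    "x \<in> F \<Longrightarrow> - x \<in> F" "x \<in> F \<Longrightarrow> inverse x \<in> F"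
    "x \<in> F \<Longrightarrow> y \<in> F \<Longrightarrow> x - y \<in> F" "x \<in> F \<Longrightarrow> y \<in> F \<Longrightarrow> x / y \<in> F"
    "x \<in> F \<Longrightarrow> x ^ n \<in> F"
proof -
  show *: "0 \<in> F" "1 \<in> F" "x \<in> F \<Longrightarrow> y \<in> F \<Longrightarrow> x + y \<in> F"
    "x \<in> F \<Longrightarrow> - x \<in> F" "x \<in> F \<Longrightarrow> inverse x \<in> F"
    and m: "\<And>x y. x \<in> F \<Longrightarrow> y \<in> F \<Longrightarrow> x * y \<in> F"
    using assms by (auto simp: is_subfield_def)
  show "x \<in> F \<Longrightarrow> y \<in> F \<Longrightarrow> x - y \<in> F"
    using assms unfolding is_subfield_def by (metis diff_conv_add_uminus)
  show "x \<in> F \<Longrightarrow> y \<in> F \<Longrightarrow> x / y \<in> F"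
    using assms unfolding is_subfield_def by (metis divide_inverse)
  show "x \<in> F \<Longrightarrow> x ^ n \<in> F" by (induction n) (auto simp: * m)
qed

context complex_embedding
begin

lemma peval_in_subfield:
  assumes "is_subfield F" "range \<kappa> \<subseteq> F" "s \<in> F"
  shows "peval p s \<in> F"
proof (induction p)
  case (pCons a p)
  then show ?case
    using assms(2,3) is_subfieldD(3,4)[OF assms(1)] by (simp add: peval_pCons image_subset_iff)
qed (use is_subfieldD(1)[OF assms(1)] in simp)

lemma reval_in_subfield:
  assumes "is_subfield F" "range \<kappa> \<subseteq> F" "s \<in> F"
  shows "reval s g \<in> F"
  unfolding reval_def using peval_in_subfield[OF assms] is_subfieldD(8)[OF assms(1)] by blast

lemma subfield_vimage_reval:
  assumes "is_subfield F" "transc s"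
  shows "is_subfield {g. reval s g \<in> F}"
  using is_subfieldD[OF assms(1)] assms(2)
  by (auto simp: is_subfield_def reval_add reval_mult reval_minus reval_inverse)

end

lemmas rat_comp_in_subfield = rc.reval_in_subfield[folded rat_comp_eq_reval]

section \<open>Generated fields and the fields \<complex>(h)\<close>

definition gen_field :: "ratfun set \<Rightarrow> ratfun set" where
  "gen_field S = \<Inter>{F. is_subfield F \<and> range cst \<subseteq> F \<and> S \<subseteq> F}"

lemma subfield_gen_field: "is_subfield (gen_field S)"
  unfolding gen_field_def is_subfield_def by blast

lemma gen_field_superset: "S \<subseteq> gen_field S" and cst_in_gen_field: "range cst \<subseteq> gen_field S"
  unfolding gen_field_def by blast+

lemma gen_field_least: "is_subfield F \<Longrightarrow> range cst \<subseteq> F \<Longrightarrow> S \<subseteq> F \<Longrightarrow> gen_field S \<subseteq> F"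
  unfolding gen_field_def by blast

text \<open>For nonconstant \<open>h\<close> this is \<complex>(h), given by its elements so that
  membership directly yields a left factor.\<close>

definition comp_field :: "ratfun \<Rightarrow> ratfun set" where
  "comp_field h = range (\<lambda>r. r \<circ>\<^sub>R h)"

lemma comp_fieldI: "r \<circ>\<^sub>R h \<in> comp_field h"
  by (simp add: comp_field_def)

lemma self_in_comp_field: "h \<in> comp_field h"
  using comp_fieldI[of ratX h] by simp

lemma comp_fieldE:
  assumes "g \<in> comp_field h" obtains r where "g = r \<circ>\<^sub>R h"
  using assms by (auto simp: comp_field_def)

lemma subfield_comp_field:
  assumes "nonconst h" shows "is_subfield (comp_field h)"
  unfolding is_subfield_def
proof (intro conjI ballI)
  show "0 \<in> comp_field h" "1 \<in> comp_field h"
    using comp_fieldI[of 0 h] comp_fieldI[of 1 h] by simp_all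
  fix x assume "x \<in> comp_field h"
  then obtain r where r: "x = r \<circ>\<^sub>R h" by (rule comp_fieldE)
  show "- x \<in> comp_field h" "inverse x \<in> comp_field h"
    unfolding r rat_comp_hom(3,5)[OF assms, symmetric] by (rule comp_fieldI)+
  fix y assume "y \<in> comp_field h"
  then obtain t where t: "y = t \<circ>\<^sub>R h" by (rule comp_fieldE)
  show "x + y \<in> comp_field h" "x * y \<in> comp_field h"
    unfolding r t rat_comp_hom(1,2)[OF assms, symmetric] by (rule comp_fieldI)+
qed

lemma cst_in_comp_field: "range cst \<subseteq> comp_field h"
  using comp_fieldI[of "cst _" h] by auto

lemma comp_field_trans:
  assumes "nonconst h" "g \<in> comp_field h" shows "comp_field g \<subseteq> comp_field h"
proof
  fix f assume "f \<in> comp_field g"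
  then show "f \<in> comp_field h"
    using rat_comp_in_subfield[OF subfield_comp_field[OF assms(1)] cst_in_comp_field assms(2)]
    by (auto simp: comp_field_def[of g])
qed

lemma ratX_in_subfield:
  assumes "is_subfield F" "range cst \<subseteq> F" "ratX \<in> F"
  shows "F = UNIV"
  using rat_comp_in_subfield[OF assms] by auto

text \<open>The scalar \<open>r\<close> acts as multiplication by \<open>r \<circ>\<^sub>R h\<close>, so that this is linear algebra over \<open>\<complex>(h)\<close>.\<close>

lemma comp_vector_space:
  assumes "nonconst h"
  shows "vector_space (\<lambda>r v. (r \<circ>\<^sub>R h) * v)"
  by unfold_locales (simp_all add: rat_comp_hom assms algebra_simps)

text \<open>Linear dependence concerns sets, the statement a sequence. A repeated entry gives a
  relation with coefficients 1 and -1; an injective sequence has too many elements for the span of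
  \<open>k\<close> vectors.\<close>

lemma dependent_sequence:
  fixes w :: "nat \<Rightarrow> ratfun" and b :: "nat \<Rightarrow> ratfun"
  assumes h: "nonconst h" and w: "\<And>i. i \<le> k \<Longrightarrow> \<exists>s. w i = (\<Sum>j<k. (s j \<circ>\<^sub>R h) * b j)"
  shows "\<exists>c. (\<exists>i\<le>k. c i \<noteq> 0) \<and> (\<Sum>i\<le>k. (c i \<circ>\<^sub>R h) * w i) = 0"
proof (cases "inj_on w {..k}")
  case False
  then obtain i j where ij: "i \<le> k" "j \<le> k" "i \<noteq> j" "w i = w j" by (auto simp: inj_on_def)
  define c :: "nat \<Rightarrow> ratfun" where "c l = (if l = i then 1 else if l = j then -1 else 0)" for l
  have "(\<Sum>l\<le>k. (c l \<circ>\<^sub>R h) * w l) = (\<Sum>l\<in>{i,j}. (c l \<circ>\<^sub>R h) * w l)"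
    by (rule sum.mono_neutral_right) (use ij in \<open>auto simp: c_def\<close>)
  also have "\<dots> = 0" using ij by (simp add: c_def rat_comp_hom h)
  finally show ?thesis using ij(1) by (intro exI[of _ c]) (auto simp: c_def)
next
  case True
  interpret V: vector_space "\<lambda>r v. (r \<circ>\<^sub>R h) * v" by (rule comp_vector_space[OF h])
  have sub: "w ` {..k} \<subseteq> V.span (b ` {..<k})"
  proof
    fix v assume "v \<in> w ` {..k}"
    then obtain s where "v = (\<Sum>j<k. (s j \<circ>\<^sub>R h) * b j)" using w by fastforce
    then show "v \<in> V.span (b ` {..<k})"
      by (simp only:) (intro V.span_sum V.span_scale V.span_base imageI, simp)
  qed
  have "V.dependent (w ` {..k})"
  proof (rule ccontr)
    assume "\<not> ?thesis"
    then have "card (w ` {..k}) \<le> card (b ` {..<k})"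
      using V.independent_span_bound[of "b ` {..<k}" "w ` {..k}"] sub by auto
    moreover have "card (b ` {..<k}) \<le> k" using card_image_le[of "{..<k}" b] by simp
    ultimately show False using True by (simp add: card_image)
  qed
  then obtain u where u: "\<exists>v\<in>w ` {..k}. u v \<noteq> 0" "(\<Sum>v\<in>w ` {..k}. (u v \<circ>\<^sub>R h) * v) = 0"
    by (auto simp: V.dependent_finite)
  have "(\<Sum>i\<le>k. (u (w i) \<circ>\<^sub>R h) * w i) = 0"
    using u(2) by (simp add: sum.reindex[OF True])
  then show ?thesis using u(1) by (intro exI[of _ "\<lambda>i. u (w i)"]) auto
qed

text \<open>The relation expresses \<open>q^k\<close> by lower powers, so the span \<open>S\<close>
  of \<open>1, ..., q^(k-1)\<close> over \<complex>(h) is a ring. Having finite dimension it is a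
  field, and it contains \<open>h\<close> and \<open>q\<close>, hence all of \<complex>(x).\<close>

lemma powers_span:
  assumes h: "nonconst h" and X: "ratX \<in> gen_field {h, q}"
    and rel: "(\<Sum>i\<le>k. (r i \<circ>\<^sub>R h) * q ^ i) = 0" and rk: "r k \<noteq> 0"
  shows "\<exists>s. v = (\<Sum>i<k. (s i \<circ>\<^sub>R h) * q ^ i)"
proof -
  define S where "S = {\<Sum>i<k. (s i \<circ>\<^sub>R h) * q ^ i | s. True}"
  note hom = rat_comp_hom[OF h]
  have SI: "(\<Sum>i<k. (s i \<circ>\<^sub>R h) * q ^ i) \<in> S" for s unfolding S_def by blast
  have add: "u + v \<in> S" if uv: "u \<in> S" "v \<in> S" for u v
  proof -
    obtain s t where "u = (\<Sum>i<k. (s i \<circ>\<^sub>R h) * q ^ i)" "v = (\<Sum>i<k. (t i \<circ>\<^sub>R h) * q ^ i)"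
      using uv unfolding S_def by blast
    then have "u + v = (\<Sum>i<k. ((\<lambda>i. s i + t i) i \<circ>\<^sub>R h) * q ^ i)"
      by (simp add: hom algebra_simps sum.distrib)
    then show ?thesis using SI by metis
  qed
  have scale: "(c \<circ>\<^sub>R h) * u \<in> S" if u: "u \<in> S" for c u
  proof -
    obtain s where "u = (\<Sum>i<k. (s i \<circ>\<^sub>R h) * q ^ i)"
      using u unfolding S_def by blast
    then have "(c \<circ>\<^sub>R h) * u = (\<Sum>i<k. ((\<lambda>i. c * s i) i \<circ>\<^sub>R h) * q ^ i)"
      by (simp add: hom algebra_simps sum_distrib_left)
    then show ?thesis using SI by metis
  qed
  have zero: "0 \<in> S" using SI[of "\<lambda>_. 0"] by simp
  have sums: "(\<Sum>i\<in>A. f i) \<in> S" if "\<And>i. i \<in> A \<Longrightarrow> f i \<in> S" for f :: "nat \<Rightarrow> ratfun" and A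
    using that by (induction A rule: infinite_finite_induct) (auto simp: zero add)
  have k0: "k > 0"
  proof (rule ccontr)
    assume "\<not> k > 0"
    then show False using rel rk by (simp add: rat_comp_eq_0_iff h)
  qed
  have base: "q ^ i \<in> S" if "i < k" for i
  proof -
    have "(\<Sum>j<k. ((\<lambda>j. if j = i then 1 else 0) j \<circ>\<^sub>R h) * q ^ j) = (\<Sum>j\<in>{i}. q ^ j)"
      by (rule sum.mono_neutral_cong_right) (use that in auto)
    then show ?thesis using SI[of "\<lambda>j. if j = i then 1 else 0"] by simp
  qed
  have "(r k \<circ>\<^sub>R h) * q ^ k = - (\<Sum>i<k. (r i \<circ>\<^sub>R h) * q ^ i)"
    using rel by (simp add: lessThan_Suc_atMost[symmetric] eq_neg_iff_add_eq_0 add.commute)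
  moreover have "r k \<circ>\<^sub>R h \<noteq> 0" using rk by (simp add: rat_comp_eq_0_iff h)
  moreover have "a = inverse y * (-1) * T" if "y * a = - T" "y \<noteq> 0" for a T y :: ratfun
    using that by (metis (no_types, opaque_lifting) minus_minus mult.assoc mult.left_neutral mult_minus1 left_inverse)
  ultimately have "q ^ k = inverse (r k \<circ>\<^sub>R h) * (-1) * (\<Sum>i<k. (r i \<circ>\<^sub>R h) * q ^ i)"
    by blast
  also have "inverse (r k \<circ>\<^sub>R h) * (-1) = (inverse (r k) * (-1) \<circ>\<^sub>R h)"
    by (simp add: hom)
  finally have "q ^ k = (inverse (r k) * (-1) \<circ>\<^sub>R h) * (\<Sum>i<k. (r i \<circ>\<^sub>R h) * q ^ i)" .
  then have qk: "q ^ k \<in> S" using scale[OF SI] by metis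
  have mulq: "q * u \<in> S" if "u \<in> S" for u
  proof -
    obtain s where u: "u = (\<Sum>i<k. (s i \<circ>\<^sub>R h) * q ^ i)"
      using \<open>u \<in> S\<close> unfolding S_def by blast
    have "q ^ Suc i \<in> S" if "i < k" for i
      using base[of "Suc i"] qk that by (cases "Suc i = k") auto
    then have "(\<Sum>i<k. (s i \<circ>\<^sub>R h) * q ^ Suc i) \<in> S" by (intro sums scale) auto
    then show ?thesis unfolding u by (simp add: sum_distrib_left mult_ac)
  qed
  have mulqn: "q ^ n * u \<in> S" if "u \<in> S" for n u
    by (induction n) (use that mulq in \<open>auto simp: mult.assoc\<close>)
  have mult: "u * v \<in> S" if uv: "u \<in> S" "v \<in> S" for u v
  proof -
    obtain s where u: "u = (\<Sum>i<k. (s i \<circ>\<^sub>R h) * q ^ i)"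
      using \<open>u \<in> S\<close> unfolding S_def by blast
    have "(\<Sum>i<k. (s i \<circ>\<^sub>R h) * (q ^ i * v)) \<in> S" using uv by (intro sums scale mulqn) auto
    then show ?thesis unfolding u by (simp add: sum_distrib_right mult.assoc)
  qed
  have one: "1 \<in> S" using base[of 0] k0 by simp
  have power: "u ^ n \<in> S" if "u \<in> S" for u n
    by (induction n) (use that one mult in auto)
  have inv: "inverse u \<in> S" if u: "u \<in> S" for u
  proof (cases "u = 0")
    case False
    have "\<exists>c. (\<exists>i\<le>k. c i \<noteq> 0) \<and> (\<Sum>i\<le>k. (c i \<circ>\<^sub>R h) * u ^ i) = 0"
      by (rule dependent_sequence[OF h, of k "\<lambda>i. u ^ i" "\<lambda>i. q ^ i"])
        (use power[OF u] in \<open>auto simp: S_def\<close>)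
    then obtain c where c: "\<exists>i\<le>k. c i \<noteq> 0" "(\<Sum>i\<le>k. (c i \<circ>\<^sub>R h) * u ^ i) = 0" by blast
    \<comment> \<open>Dividing a relation between powers of \<open>u\<close> by its lowest power
      leaves a nonzero constant term, from which the inverse of \<open>u\<close> is
      obtained.\<close>
    define m where "m = (LEAST i. c i \<noteq> 0)"
    obtain i0 where i0: "i0 \<le> k" "c i0 \<noteq> 0" using c(1) by blast
    have cm: "c m \<noteq> 0" unfolding m_def by (rule LeastI[of _ i0]) (rule i0(2))
    have "m \<le> i0" unfolding m_def by (rule Least_le) (rule i0(2))
    then have mk: "m \<le> k" using i0(1) by simp
    have lt: "c i = 0" if "i < m" for i using that not_less_Least unfolding m_def by blast
    have "(\<Sum>i\<le>k. (c i \<circ>\<^sub>R h) * u ^ i) = (\<Sum>i\<in>{m..k}. (c i \<circ>\<^sub>R h) * u ^ i)"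
      by (rule sum.mono_neutral_right) (auto simp: lt)
    also have "\<dots> = (c m \<circ>\<^sub>R h) * u ^ m + (\<Sum>i\<in>{Suc m..k}. (c i \<circ>\<^sub>R h) * u ^ i)"
      using mk by (simp add: sum.atLeast_Suc_atMost)
    also have "(\<Sum>i\<in>{Suc m..k}. (c i \<circ>\<^sub>R h) * u ^ i) =
        u ^ m * (u * (\<Sum>i\<in>{Suc m..k}. (c i \<circ>\<^sub>R h) * u ^ (i - Suc m)))"
      unfolding sum_distrib_left
    proof (rule sum.cong[OF refl])
      fix i assume "i \<in> {Suc m..k}"
      then have "u ^ i = u ^ m * (u * u ^ (i - Suc m))"
        by (simp flip: power_add power_Suc)
      then show "(c i \<circ>\<^sub>R h) * u ^ i = u ^ m * (u * ((c i \<circ>\<^sub>R h) * u ^ (i - Suc m)))" by simp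
    qed
    finally have "u ^ m * ((c m \<circ>\<^sub>R h) + u * (\<Sum>i\<in>{Suc m..k}. (c i \<circ>\<^sub>R h) * u ^ (i - Suc m))) = 0"
      using c(2) by (simp add: algebra_simps)
    then have "(c m \<circ>\<^sub>R h) + u * (\<Sum>i\<in>{Suc m..k}. (c i \<circ>\<^sub>R h) * u ^ (i - Suc m)) = 0"
      using False by simp
    then have "u * (\<Sum>i\<in>{Suc m..k}. (c i \<circ>\<^sub>R h) * u ^ (i - Suc m)) = - (c m \<circ>\<^sub>R h)"
      by (simp add: eq_neg_iff_add_eq_0 add.commute)
    moreover have "c m \<circ>\<^sub>R h \<noteq> 0" using cm by (simp add: rat_comp_eq_0_iff h)
    moreover have inv_eq: "inverse u = inverse y * (-1) * T" if "u * T = - y" "y \<noteq> 0" for T y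
    proof (rule inverse_unique)
      have "u * (inverse y * (-1) * T) = - (u * T) * inverse y" by (simp add: mult_ac)
      then show "u * (inverse y * (-1) * T) = 1" using that by simp
    qed
    ultimately have "inverse u = inverse (c m \<circ>\<^sub>R h) * (-1) *
        (\<Sum>i\<in>{Suc m..k}. (c i \<circ>\<^sub>R h) * u ^ (i - Suc m))" by blast
    also have "inverse (c m \<circ>\<^sub>R h) * (-1) = (inverse (c m) * (-1) \<circ>\<^sub>R h)"
      by (simp add: hom)
    finally have "inverse u = (inverse (c m) * (-1) \<circ>\<^sub>R h) *
        (\<Sum>i\<in>{Suc m..k}. (c i \<circ>\<^sub>R h) * u ^ (i - Suc m))" .
    then show ?thesis by (simp only:) (intro sums scale power u)
  qed (use zero in auto)
  have const_mem: "range cst \<subseteq> S"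
  proof
    fix x assume "x \<in> range cst"
    then obtain c where "x = (cst c \<circ>\<^sub>R h) * 1" by auto
    then show "x \<in> S" using scale[OF one] by metis
  qed
  have "- u \<in> S" if "u \<in> S" for u
    using scale[OF that, of "-1"] by (simp add: hom)
  then have "is_subfield S" unfolding is_subfield_def using zero one add mult inv by auto
  moreover have "h \<in> S" using scale[OF one, of ratX] by simp
  moreover have "q \<in> S" using mulq[OF one] by simp
  ultimately have "ratX \<in> S" using gen_field_least[of S "{h,q}"] const_mem X by blast
  then have "S = UNIV" using ratX_in_subfield[OF \<open>is_subfield S\<close> const_mem] by simp
  then show ?thesis unfolding S_def by blast
qed

text \<open>After clearing denominators, reduction modulo \<open>P\<close> leaves only the constant terms of the \<open>R i\<close>,
  and these vanish because \<open>i < d = degree P\<close>.\<close>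

lemma powers_X_independent_aux:
  assumes PQ: "h = Fract P Q" "Q \<noteq> 0" "coprime P Q" and h: "nonconst h" and d: "degree P = d"
    and rel: "(\<Sum>i<d. rc.peval (R i) h * ratX ^ i) = 0"
    and i: "i < d"
  shows "R i = 0"
proof -
  \<comment> \<open>\<open>K\<close> bounds the degrees of all \<open>R i\<close>. Once their
    constant terms vanish, a factor \<open>h\<close> cancels and the bound drops by one.\<close>
  have "\<forall>i<d. R i = 0" if "\<And>i. i < d \<Longrightarrow> degree (R i) < K \<or> R i = 0"
    "(\<Sum>i<d. rc.peval (R i) h * ratX ^ i) = 0" for K R
    using that
  proof (induction K arbitrary: R)
    case (Suc K)
    define s where "s = (\<Sum>i<d. monom (coeff (R i) 0) i)"
    have "to_fract (\<Sum>i<d. homog K (R i) P Q * monom 1 i) =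
        to_fract Q ^ K * (\<Sum>i<d. rc.peval (R i) h * ratX ^ i)"
      unfolding to_fract_sum sum_distrib_left to_fract_mult
    proof (rule sum.cong[OF refl])
      fix i assume "i \<in> {..<d}"
      then have "degree (R i) \<le> K" using Suc.prems(1)[of i] by auto
      then show "to_fract (homog K (R i) P Q) * to_fract (monom 1 i) =
         to_fract Q ^ K * (rc.peval (R i) h * ratX ^ i)"
        using PQ(2) by (simp add: to_fract_homog PQ(1) monom_altdef to_fract_power)
    qed
    also have "\<dots> = 0" using Suc.prems by simp
    finally have 0: "(\<Sum>i<d. homog K (R i) P Q * monom 1 i) = 0"
      by (simp only: to_fract_eq_0_iff)
    have "P dvd homog K (R i) P Q - smult (coeff (R i) 0) (Q ^ K)" for i
    proof -
      have "homog K (R i) P Q = smult (coeff (R i) 0) (Q ^ K) +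
          (\<Sum>j\<in>{Suc 0..K}. smult (coeff (R i) j) (P ^ j * Q ^ (K - j)))"
        unfolding homog_def by (simp add: atMost_atLeast0 sum.atLeast_Suc_atMost)
      moreover have "P dvd (\<Sum>j\<in>{Suc 0..K}. smult (coeff (R i) j) (P ^ j * Q ^ (K - j)))"
        by (intro dvd_sum dvd_smult dvd_mult2 dvd_power) auto
      ultimately show ?thesis by simp
    qed
    then have "P dvd (\<Sum>i<d. (homog K (R i) P Q - smult (coeff (R i) 0) (Q ^ K)) * monom 1 i)"
      by (intro dvd_sum dvd_mult2) auto
    also have "\<dots> = (\<Sum>i<d. homog K (R i) P Q * monom 1 i) - s * Q ^ K"
    proof -
      have "s * Q ^ K = (\<Sum>i<d. smult (coeff (R i) 0) (Q ^ K) * monom 1 i)"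
        unfolding s_def sum_distrib_right
      proof (rule sum.cong[OF refl])
        fix i
        have "monom (coeff (R i) 0) i = smult (coeff (R i) 0) (monom 1 i)"
          by (simp add: smult_monom)
        then show "monom (coeff (R i) 0) i * Q ^ K = smult (coeff (R i) 0) (Q ^ K) * monom 1 i"
          by (simp add: mult.commute)
      qed
      then show ?thesis by (simp add: left_diff_distrib sum_subtractf)
    qed
    finally have "P dvd s * Q ^ K" using 0 by simp
    then have "P dvd s" using PQ(3) by (simp add: coprime_dvd_mult_left_iff)
    moreover have "s = 0 \<or> degree s < d"
    proof (cases "d = 0")
      case False
      then have "degree s \<le> d - 1" unfolding s_def
        by (intro degree_sum_le) (auto intro!: order.trans[OF degree_monom_le])
      then show ?thesis using False by linarith
    qed (simp add: s_def)
    ultimately have "s = 0" using d by (meson dvd_imp_degree_le leD)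
    have c0: "coeff (R i) 0 = 0" if "i < d" for i
    proof -
      have "coeff s i = (\<Sum>j<d. if j = i then coeff (R j) 0 else 0)"
        unfolding s_def coeff_sum by (intro sum.cong) auto
      then show ?thesis using \<open>s = 0\<close> that by simp
    qed
    define R' where "R' i = (THE p. R i = pCons 0 p)" for i
    have R': "R i = pCons 0 (R' i)" if "i < d" for i
    proof -
      obtain a p where ap: "R i = pCons a p" by (cases "R i") auto
      then have "R i = pCons 0 p" using c0[OF that] by simp
      then show ?thesis unfolding R'_def by simp
    qed
    have "h \<noteq> 0" using h by (auto simp: rc.transc_def)
    have "h * (\<Sum>i<d. rc.peval (R' i) h * ratX ^ i) = (\<Sum>i<d. rc.peval (R i) h * ratX ^ i)"
      unfolding sum_distrib_left by (rule sum.cong) (auto simp: R' rc.peval_pCons)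
    then have "(\<Sum>i<d. rc.peval (R' i) h * ratX ^ i) = 0"
      using Suc.prems(2) \<open>h \<noteq> 0\<close> by simp
    moreover have "degree (R' i) < K \<or> R' i = 0" if "i < d" for i
      using Suc.prems(1)[OF that] R'[OF that] by (auto split: if_splits)
    ultimately have "\<forall>i<d. R' i = 0" using Suc.IH[of R'] by blast
    then show ?case using R' by simp
  qed auto
  moreover have "degree (R i) < Suc (\<Sum>i<d. degree (R i))" if "i < d" for i
    using member_le_sum[of i "{..<d}" "\<lambda>i. degree (R i)"] that by simp
  ultimately show ?thesis using rel i by blast
qed

lemma powers_X_independent:
  assumes h: "nonconst h" and rel: "(\<Sum>i<k. (r i \<circ>\<^sub>R h) * ratX ^ i) = 0"
    and k: "k \<le> rat_degree h" and i: "i < k"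
  shows "r i = 0"
proof -
  define d where "d = rat_degree h"
  define r' where "r' i = (if i < k then r i else 0)" for i
  have rel': "(\<Sum>i<d. (r' i \<circ>\<^sub>R h) * ratX ^ i) = 0"
  proof -
    have "(\<Sum>i<d. (r' i \<circ>\<^sub>R h) * ratX ^ i) = (\<Sum>i<k. (r i \<circ>\<^sub>R h) * ratX ^ i)"
      by (rule sum.mono_neutral_cong_right) (use k in \<open>auto simp: d_def r'_def\<close>)
    then show ?thesis using rel by simp
  qed
  have *: "s i = 0"
    if PQ: "g = Fract P Q" "Q \<noteq> 0" "coprime P Q" "degree P = d" "nonconst g"
      and rel: "(\<Sum>i<d. (s i \<circ>\<^sub>R g) * ratX ^ i) = 0" and i: "i < d" for g P Q s i
  proof -
    define D where "D = (\<Prod>i<d. snd (quot_of_fract (s i)))"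
    have D0: "D \<noteq> 0" by (simp add: D_def)
    have "\<exists>R. s i * to_fract D = to_fract R" if "i < d" for i
    proof -
      have "D = snd (quot_of_fract (s i)) * (\<Prod>j\<in>{..<d} - {i}. snd (quot_of_fract (s j)))"
        unfolding D_def by (rule prod.remove) (use that in auto)
      moreover have "s i = to_fract (fst (quot_of_fract (s i))) / to_fract (snd (quot_of_fract (s i)))"
        by (simp flip: Fract_conv_to_fract)
      ultimately have "s i * to_fract D = to_fract (fst (quot_of_fract (s i)) *
          (\<Prod>j\<in>{..<d} - {i}. snd (quot_of_fract (s j))))"
        by (simp add: field_simps)
      then show ?thesis by blast
    qed
    then obtain R where R: "\<And>i. i < d \<Longrightarrow> s i * to_fract D = to_fract (R i)" by metis
    have "(\<Sum>i<d. rc.peval (R i) g * ratX ^ i) =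
        (to_fract D \<circ>\<^sub>R g) * (\<Sum>i<d. (s i \<circ>\<^sub>R g) * ratX ^ i)"
      unfolding sum_distrib_left
    proof (rule sum.cong[OF refl])
      fix i assume "i \<in> {..<d}"
      then have "rc.peval (R i) g = (s i \<circ>\<^sub>R g) * (to_fract D \<circ>\<^sub>R g)"
        using R[of i] by (metis lessThan_iff rat_comp_mult[OF PQ(5)] to_fract_comp)
      then show "rc.peval (R i) g * ratX ^ i = (to_fract D \<circ>\<^sub>R g) * ((s i \<circ>\<^sub>R g) * ratX ^ i)" by simp
    qed
    then have "(\<Sum>i<d. rc.peval (R i) g * ratX ^ i) = 0" using rel by simp
    then have "R i = 0" using powers_X_independent_aux[OF PQ(1,2,3,5,4)] i by blast
    then show ?thesis using R[OF i] D0 by simp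
  qed
  obtain P Q where PQ: "h = Fract P Q" "Q \<noteq> 0" "coprime P Q" by (rule ratfun_cases)
  have "r' i = 0"
  proof (cases "degree P = d")
    case True
    show ?thesis by (rule *[OF PQ True h rel']) (use i k d_def in auto)
  next
    case False
    then have dQ: "degree Q = d" using PQ by (auto simp: d_def rat_degree_Fract max_def split: if_splits)
    have "P \<noteq> 0"
    proof
      assume "P = 0"
      then have "h = cst 0" using PQ(1) by (simp add: Fract_conv_to_fract)
      then show False using h by (auto simp: rc.transc_def)
    qed
    \<comment> \<open>Here the denominator attains the degree, so \<open>inverse h\<close> replaces
      \<open>h\<close>; composing the coefficients with \<iota> rewrites them as functions of
      \<open>inverse h\<close>.\<close>
    define \<iota> where "\<iota> = inverse ratX"
    have \<iota>: "\<iota> \<circ>\<^sub>R inverse h = h" if "nonconst (inverse h)"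
      using that by (simp add: \<iota>_def rat_comp_hom)
    have nc: "nonconst (inverse h)"
      using h unfolding rc.transc_def by (metis (mono_tags, lifting) inverse_inverse_eq rangeE rangeI rc.\<kappa>_inverse)
    have nci: "nonconst \<iota>" using \<iota>[OF nc] h by (metis nonconst_comp_iff)
    have rel'': "(\<Sum>i<d. ((r' i \<circ>\<^sub>R \<iota>) \<circ>\<^sub>R inverse h) * ratX ^ i) = 0"
      using rel' by (simp add: rat_comp_assoc nc \<iota>)
    have inv: "inverse h = Fract Q P" using PQ \<open>P \<noteq> 0\<close> by simp
    have "r' i \<circ>\<^sub>R \<iota> = 0"
      by (rule *[OF inv \<open>P \<noteq> 0\<close> _ dQ nc rel'']) (use PQ i k d_def in \<open>auto simp: coprime_commute\<close>)
    then show ?thesis using rat_comp_eq_0_iff[OF nci] by simp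
  qed
  then show ?thesis using i by (simp add: r'_def)
qed

text \<open>Together with \<open>powers_X_span\<close> below, this is \<open>[\<complex>(x) : \<complex>(h)] = deg h\<close>.\<close>

lemma rat_degree_le_of_relation:
  assumes h: "nonconst h" and X: "ratX \<in> gen_field {h, q}"
    and rel: "(\<Sum>i\<le>k. (r i \<circ>\<^sub>R h) * q ^ i) = 0" and rk: "\<exists>i\<le>k. r i \<noteq> 0"
  shows "rat_degree h \<le> k"
proof (rule ccontr)
  assume less: "\<not> rat_degree h \<le> k"
  define m where "m = (GREATEST i. i \<le> k \<and> r i \<noteq> 0)"
  have m: "m \<le> k \<and> r m \<noteq> 0" unfolding m_def
    by (rule GreatestI_ex_nat[of _ k]) (use rk in auto)
  have gt: "r i = 0" if "i \<le> k" "m < i" for i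
    using that Greatest_le_nat[of "\<lambda>i. i \<le> k \<and> r i \<noteq> 0" i k] unfolding m_def by auto
  have rel': "(\<Sum>i\<le>m. (r i \<circ>\<^sub>R h) * q ^ i) = 0"
  proof -
    have "(\<Sum>i\<le>k. (r i \<circ>\<^sub>R h) * q ^ i) = (\<Sum>i\<le>m. (r i \<circ>\<^sub>R h) * q ^ i)"
      by (rule sum.mono_neutral_right) (use m gt in auto)
    then show ?thesis using rel by simp
  qed
  \<comment> \<open>The first \<open>m\<close> powers of \<open>q\<close> span \<complex>(x) over
    \<complex>(h), so \<open>m + 1\<close> powers of \<open>x\<close> are dependent, although
    \<open>m + 1\<close> is at most \<open>deg h\<close>.\<close>
  have "\<exists>c. (\<exists>i\<le>m. c i \<noteq> 0) \<and> (\<Sum>i\<le>m. (c i \<circ>\<^sub>R h) * ratX ^ i) = 0"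
    by (rule dependent_sequence[OF h]) (rule powers_span[OF h X rel'], use m in blast)
  then obtain c where c: "\<exists>i\<le>m. c i \<noteq> 0" "(\<Sum>i<Suc m. (c i \<circ>\<^sub>R h) * ratX ^ i) = 0"
    by (auto simp: lessThan_Suc_atMost)
  then show False using powers_X_independent[OF h c(2)] less m by (auto simp: less_Suc_eq_le)
qed

text \<open>\<open>x\<close> is a root of \<open>P(T) - h Q(T)\<close>, which has degree
  \<open>deg h\<close> in \<open>T\<close> and coefficients \<open>r i\<close> evaluated at
  \<open>h\<close>.\<close>

lemma powers_X_span:
  assumes h: "nonconst h"
  shows "\<exists>s. v = (\<Sum>i<rat_degree h. (s i \<circ>\<^sub>R h) * ratX ^ i)"
proof -
  obtain P Q where PQ: "h = Fract P Q" "Q \<noteq> 0" "coprime P Q" by (rule ratfun_cases)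
  define d where "d = rat_degree h"
  define r where "r i = cst (coeff P i) - ratX * cst (coeff Q i)" for i
  have d: "degree P \<le> d" "degree Q \<le> d" using PQ by (simp_all add: d_def rat_degree_Fract)
  have sm: "to_fract N = (\<Sum>i\<le>d. cst (coeff N i) * ratX ^ i)" if "degree N \<le> d" for N
  proof -
    have "to_fract N = (\<Sum>i\<le>degree N. cst (coeff N i) * ratX ^ i)"
      using rc.peval_altdef[of N ratX] by simp
    also have "\<dots> = (\<Sum>i\<le>d. cst (coeff N i) * ratX ^ i)"
      by (rule sum.mono_neutral_left) (use that in \<open>auto simp: coeff_eq_0\<close>)
    finally show ?thesis .
  qed
  have "(\<Sum>i\<le>d. (r i \<circ>\<^sub>R h) * ratX ^ i) = to_fract P - h * to_fract Q"
    unfolding sm[OF d(1)] sm[OF d(2)] sum_distrib_left sum_subtractf[symmetric]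
    by (rule sum.cong) (auto simp: r_def rat_comp_hom h algebra_simps)
  also have "\<dots> = 0" using PQ by (simp add: Fract_conv_to_fract)
  finally have rel: "(\<Sum>i\<le>d. (r i \<circ>\<^sub>R h) * ratX ^ i) = 0" .
  have "r d \<noteq> 0"
  proof
    assume "r d = 0"
    then have "to_fract [:coeff P d:] = to_fract ([:0, 1:] * [:coeff Q d:])"
      unfolding r_def by (simp only: to_fract_mult right_minus_eq)
    then have "coeff P d = 0" "coeff Q d = 0" by (simp_all only: to_fract_eq_iff) auto
    moreover have "coeff P d \<noteq> 0 \<or> coeff Q d \<noteq> 0"
      using PQ(2) rat_degree_Fract[OF PQ(3,2)] PQ(1) d_def h nonconst_iff_degree
      by (metis leading_coeff_0_iff max_def degree_0 less_nat_zero_code)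
    ultimately show False by blast
  qed
  moreover have "ratX \<in> gen_field {h, ratX}" using gen_field_superset by blast
  ultimately show ?thesis using powers_span[OF h _ rel] unfolding d_def by blast
qed

lemma relation_exists:
  assumes h: "nonconst h"
  shows "\<exists>c. (\<exists>i\<le>rat_degree h. c i \<noteq> 0) \<and> (\<Sum>i\<le>rat_degree h. (c i \<circ>\<^sub>R h) * q ^ i) = 0"
  by (rule dependent_sequence[OF h]) (rule powers_X_span[OF h])

text \<open>Degrees multiply, so the left factor \<mu> has degree 1. Over \<complex>(\<mu>) the
  single power \<open>x^0\<close> then spans \<complex>(x), which inverts \<mu>.\<close>

lemma comp_field_eqI:
  assumes "nonconst g" "g \<in> comp_field h" "rat_degree g \<le> rat_degree h"
  shows "h \<in> comp_field g"
proof -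
  obtain \<mu> where \<mu>: "g = \<mu> \<circ>\<^sub>R h" using assms(2) by (rule comp_fieldE)
  then have nc: "nonconst \<mu>" "nonconst h" using assms(1) by (auto simp: nonconst_comp_iff)
  then have "rat_degree \<mu> = 1"
    using assms(3) mult_le_cancel2[of "rat_degree \<mu>" "rat_degree h" 1] \<mu>
    by (simp add: rat_degree_comp nonconst_iff_degree)
  then obtain s where "ratX = (s (0::nat)) \<circ>\<^sub>R \<mu>"
    using powers_X_span[OF nc(1), of ratX] by auto
  then have "h = s 0 \<circ>\<^sub>R g"
    using rat_comp_assoc[OF nc(2), of "s 0" \<mu>] \<mu> by (metis X_comp)
  then show ?thesis by (auto simp: comp_field_def)
qed

lemma degree_1_invertible:
  assumes "rat_degree \<mu> = 1"
  obtains \<nu> where "rat_degree \<nu> = 1" "\<nu> \<circ>\<^sub>R \<mu> = ratX" "\<mu> \<circ>\<^sub>R \<nu> = ratX"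
proof -
  have nc: "nonconst \<mu>" using assms by (simp add: nonconst_iff_degree)
  have "ratX \<in> comp_field \<mu>"
    using comp_field_eqI[of \<mu> ratX] nc assms comp_fieldI[of \<mu> ratX] by simp
  then obtain \<nu> where \<nu>: "ratX = \<nu> \<circ>\<^sub>R \<mu>" by (rule comp_fieldE)
  then have "(\<mu> \<circ>\<^sub>R \<nu>) \<circ>\<^sub>R \<mu> = ratX \<circ>\<^sub>R \<mu>" by (simp add: rat_comp_assoc nc flip: \<nu>)
  then have "\<mu> \<circ>\<^sub>R \<nu> = ratX" using rat_comp_inj[OF nc] by blast
  moreover have "rat_degree \<nu> = 1" using rat_degree_comp[of \<nu> \<mu>] assms by (simp flip: \<nu>)
  ultimately show ?thesis using that \<nu> by simp
qed

section \<open>Lueroth's theorem\<close>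

abbreviation lift_poly :: "'a::comm_ring_1 poly \<Rightarrow> 'a poly poly" where
  "lift_poly p \<equiv> map_poly (\<lambda>a. [:a:]) p"

lemma coeff_lift_poly [simp]: "coeff (lift_poly p) i = [:coeff p i:]"
  by (simp add: coeff_map_poly)

lemma lift_poly_add: "lift_poly (p + q) = lift_poly p + lift_poly q"
  by (rule poly_eqI) simp

lemma lift_poly_smult: "lift_poly (smult c p) = smult [:c:] (lift_poly p)"
  by (rule poly_eqI) simp

lemma lift_poly_mult: "lift_poly (p * q) = lift_poly p * lift_poly q"
  by (induction p) (simp_all add: lift_poly_add lift_poly_smult map_poly_pCons)

lemma poly_lift_poly_const: "poly (lift_poly p) [:b:] = [:poly p b:]"
  by (induction p) (simp_all add: map_poly_pCons)

text \<open>Exchange of the two variables of a bivariate polynomial. The degree of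
  \<open>swap_poly M\<close> is the degree of \<open>M\<close> in its inner variable, which is
  thereby seen to be additive under products.\<close>

definition swap_poly :: "'a::comm_ring_1 poly poly \<Rightarrow> 'a poly poly" where
  "swap_poly M = poly (map_poly lift_poly M) [:[:0, 1:]:]"

lemma swap_poly_0 [simp]: "swap_poly 0 = 0"
  by (simp add: swap_poly_def)

lemma swap_poly_pCons: "swap_poly (pCons c M) = lift_poly c + smult [:0, 1:] (swap_poly M)"
  by (simp add: swap_poly_def map_poly_pCons)

lemma swap_poly_add: "swap_poly (M + N) = swap_poly M + swap_poly N"
  by (induction M N rule: poly_induct2)
    (simp_all add: swap_poly_pCons lift_poly_add smult_add_right)

lemma swap_poly_smult: "swap_poly (smult c M) = lift_poly c * swap_poly M"
  by (induction M) (simp_all add: swap_poly_pCons lift_poly_mult algebra_simps)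

lemma swap_poly_mult: "swap_poly (M * N) = swap_poly M * swap_poly N"
  by (induction M) (simp_all add: swap_poly_pCons swap_poly_add swap_poly_smult algebra_simps)

lemma coeff_coeff_swap_poly: "coeff (coeff (swap_poly M) j) i = coeff (coeff M i) j"
proof (induction M arbitrary: i)
  case (pCons c M)
  then show ?case by (cases i) (simp_all add: swap_poly_pCons)
qed simp

lemma degree_coeff_le_swap: "degree (coeff M i) \<le> degree (swap_poly M)"
proof (rule degree_le, intro allI impI)
  fix j assume "degree (swap_poly M) < j"
  then show "coeff (coeff M i) j = 0"
    by (simp add: coeff_eq_0 flip: coeff_coeff_swap_poly)
qed

lemma degree_swap_le: "(\<And>i. degree (coeff M i) \<le> k) \<Longrightarrow> degree (swap_poly M) \<le> k"
proof (rule degree_le, intro allI impI)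
  fix j assume *: "\<And>i. degree (coeff M i) \<le> k" "k < j"
  have "coeff (coeff M i) j = 0" for i
    by (rule coeff_eq_0) (use *(1)[of i] *(2) in linarith)
  then show "coeff (swap_poly M) j = 0"
    by (intro poly_eqI) (simp add: coeff_coeff_swap_poly)
qed

lemma swap_poly_eq_0_iff [simp]: "swap_poly M = 0 \<longleftrightarrow> M = 0"
proof
  assume "swap_poly M = 0"
  then show "M = 0" by (intro poly_eqI) (simp flip: coeff_coeff_swap_poly)
qed simp

lemma degree_swap_mult:
  fixes M N :: "'a::idom poly poly"
  assumes "M \<noteq> 0" "N \<noteq> 0"
  shows "degree (swap_poly (M * N)) = degree (swap_poly M) + degree (swap_poly N)"
  using assms by (simp add: swap_poly_mult degree_mult_eq)

lemma fract_poly_content_decompose: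
  fixes m :: "ratfun poly"
  assumes "m \<noteq> 0"
  obtains M e where "m = smult e (fract_poly M)" "e \<noteq> 0" "content M = 1" "degree M = degree m"
proof
  show "m = smult (fract_content m) (fract_poly (primitive_part_fract m))"
    by (simp add: content_times_primitive_part_fract)
qed (use assms in auto)

text \<open>The minimal polynomial of \<open>s\<close> over \<open>F\<close>. Division with
  remainder is carried out by hand because \<open>F\<close> is a subset and not a type: the quotient
  has to keep its coefficients in \<open>F\<close>.\<close>

lemma min_relation:
  fixes F :: "ratfun set"
  assumes F: "is_subfield F"
    and ex: "m0 \<noteq> 0" "\<And>i. coeff m0 i \<in> F" "poly m0 s = 0"
  obtains m where "m \<noteq> 0" "\<And>i. coeff m i \<in> F" "poly m s = 0" "lead_coeff m = 1"
    "degree m \<le> degree m0"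
    "\<And>M. (\<And>i. coeff M i \<in> F) \<Longrightarrow> poly M s = 0 \<Longrightarrow> \<exists>n. M = m * n \<and> (\<forall>i. coeff n i \<in> F)"
proof -
  define P where "P m \<longleftrightarrow> m \<noteq> 0 \<and> (\<forall>i. coeff m i \<in> F) \<and> poly m s = 0" for m :: "ratfun poly"
  obtain m1 where m1: "P m1" and least: "\<And>M. P M \<Longrightarrow> degree m1 \<le> degree M"
    using ex_has_least_nat[of P m0 degree] ex unfolding P_def by blast
  define m where "m = smult (inverse (lead_coeff m1)) m1"
  have deg: "degree m = degree m1" using m1 unfolding m_def P_def by simp
  have m: "P m" using m1 unfolding P_def m_def by (auto intro!: is_subfieldD[OF F])
  have lc: "lead_coeff m = 1" using m1 unfolding P_def m_def by simp
  have dvd: "\<exists>n. M = m * n \<and> (\<forall>i. coeff n i \<in> F)" if "\<And>i. coeff M i \<in> F" "poly M s = 0" for M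
    using that
  proof (induction "degree M" arbitrary: M rule: less_induct)
    case less
    show ?case
    proof (cases "M = 0")
      case False
      then have ge: "degree m \<le> degree M" using least[of M] deg less.prems by (simp add: P_def)
      define M' where "M' = M - monom (lead_coeff M) (degree M - degree m) * m"
      have cM': "coeff M' i \<in> F" for i
        using m less.prems(1) unfolding M'_def P_def
        by (auto simp: coeff_monom_mult intro!: is_subfieldD[OF F])
      have pM': "poly M' s = 0" using m less.prems(2) by (simp add: M'_def P_def)
      have "\<exists>n. M' = m * n \<and> (\<forall>i. coeff n i \<in> F)"
      proof (cases "M' = 0")
        case F0: False
        have "degree (monom (lead_coeff M) (degree M - degree m) * m) = degree M"
          using False m ge by (simp add: degree_mult_eq monom_eq_0_iff degree_monom_eq P_def)
        moreover have "coeff M' (degree M) = 0"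
          using lc ge by (simp add: M'_def coeff_monom_mult)
        ultimately have "degree M' < degree M"
          using F0 by (metis M'_def degree_diff_le le_neq_implies_less leading_coeff_0_iff order_refl)
        then show ?thesis using less.hyps cM' pM' by blast
      qed (use is_subfieldD(1)[OF F] in \<open>auto intro!: exI[of _ 0]\<close>)
      then obtain n where n: "M' = m * n" "\<And>i. coeff n i \<in> F" by blast
      have "M = m * (n + monom (lead_coeff M) (degree M - degree m))"
        using n(1) by (simp add: M'_def algebra_simps)
      moreover have "coeff (n + monom (lead_coeff M) (degree M - degree m)) i \<in> F" for i
        using n(2) less.prems(1) is_subfieldD(1,3)[OF F] by simp
      ultimately show ?thesis by blast
    qed (use is_subfieldD(1)[OF F] in \<open>auto intro!: exI[of _ 0]\<close>)
  qed
  show ?thesis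
    using that[of m] m lc dvd least[of m0] deg ex unfolding P_def by auto
qed

lemma coeff_map_cst [simp]: "coeff (map_poly cst p) i = cst (coeff p i)"
  by (simp add: coeff_map_poly)

lemma poly_map_cst [simp]: "poly (map_poly cst p) s = rc.peval p s"
  by (simp add: rc.peval_def)

lemma proportional_not_nonconst:
  assumes "smult a g2 = smult b g1" "a \<noteq> 0 \<or> b \<noteq> 0" "g2 \<noteq> 0"
  shows "\<not> nonconst (Fract g1 g2)"
proof -
  have "b \<noteq> 0" using assms by auto
  then have "g1 = smult (a / b) g2"
    using assms(1) by (metis smult_smult divide_inverse_commute left_inverse smult_1_left)
  then have "Fract g1 g2 = cst (a / b)"
    using assms(3) by (simp add: Fract_conv_to_fract to_fract_smult)
  then show ?thesis by (auto simp: rc.transc_def)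
qed

text \<open>Let \<open>m\<close> be the minimal polynomial of \<open>x\<close> over \<open>F\<close> and \<open>c = g1 / g2\<close> a nonconstant coefficient of \<open>m\<close>.
  The primitive part \<open>M\<close> of \<open>m\<close> divides \<open>g1(T) g2(x) - g2(T) g1(x)\<close>, and comparing degrees in \<open>x\<close>
  the cofactor is constant. Hence \<open>[\<complex>(x) : F] = deg c = [\<complex>(x) : \<complex>(c)]\<close>.\<close>

theorem Lueroth:
  assumes F: "is_subfield F" "range cst \<subseteq> F" and g0: "g0 \<in> F" "nonconst g0"
  obtains h where "nonconst h" "F = comp_field h"
proof -
  \<comment> \<open>\<open>G\<close> is \<open>g1(T) - c g2(T)\<close> with
    \<open>c = g1 / g2\<close> in \<open>F\<close>. It vanishes at \<open>T = x\<close>, and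
    clearing the denominator makes it antisymmetric in \<open>T\<close> and
    \<open>x\<close>.\<close>
  have graph: "\<exists>G. G \<noteq> 0 \<and> (\<forall>i. coeff G i \<in> F) \<and> poly G ratX = 0 \<and>
      smult (to_fract g2) G = fract_poly (smult g2 (lift_poly g1) - smult g1 (lift_poly g2))"
    if c: "Fract g1 g2 \<in> F" "nonconst (Fract g1 g2)" "g2 \<noteq> 0" for g1 g2
  proof (intro exI conjI allI)
    define G where "G = map_poly cst g1 - smult (Fract g1 g2) (map_poly cst g2)"
    show "coeff G i \<in> F" for i
      using c F(2) by (auto simp: G_def intro!: is_subfieldD[OF F(1)])
    show "poly G ratX = 0"
      using c by (simp add: G_def Fract_conv_to_fract)
    show "G \<noteq> 0"
    proof
      assume "G = 0"
      then have "cst (lead_coeff g1) * 0 = coeff G (degree g2)" by simp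
      then have "cst (coeff g1 (degree g2)) = Fract g1 g2 * cst (lead_coeff g2)"
        by (simp add: G_def)
      then have "Fract g1 g2 = cst (coeff g1 (degree g2) / lead_coeff g2)"
        using c(3) by (simp add: rc.\<kappa>_divide field_simps)
      then show False using c(2) by (auto simp: rc.transc_def)
    qed
    show "smult (to_fract g2) G = fract_poly (smult g2 (lift_poly g1) - smult g1 (lift_poly g2))"
      by (rule poly_eqI) (use c(3) in \<open>simp add: G_def coeff_map_poly Fract_conv_to_fract field_simps\<close>)
  qed
  obtain N0 D0 where g0': "g0 = Fract N0 D0" "D0 \<noteq> 0" by (rule ratfun_cases) auto
  then obtain m0 where m0: "m0 \<noteq> 0" "\<And>i. coeff m0 i \<in> F" "poly m0 ratX = 0"
    using graph[of N0 D0] g0 by auto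
  obtain m where m: "m \<noteq> 0" "\<And>i. coeff m i \<in> F" "poly m ratX = 0" "lead_coeff m = 1"
    and mdvd: "\<And>M. (\<And>i. coeff M i \<in> F) \<Longrightarrow> poly M ratX = 0 \<Longrightarrow> m dvd M"
    using min_relation[OF F(1) m0] by (metis dvd_triv_left)
  define n where "n = degree m"
  have indep: "e = 0" if "\<And>i. coeff e i \<in> F" "poly e ratX = 0" "degree e < n" for e
    using mdvd[OF that(1,2)] that(3) unfolding n_def by (meson dvd_imp_degree_le leD)
  \<comment> \<open>If all coefficients were constants, \<open>x\<close> would be a root of a
    nonzero complex polynomial.\<close>
  obtain i where i: "nonconst (coeff m i)"
  proof (rule ccontr)
    assume "\<not> thesis"
    then have "\<forall>i. \<exists>a. coeff m i = cst a" using that by (auto simp: rc.transc_def)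
    then obtain a where a: "\<And>i. coeff m i = cst (a i)" by metis
    define p where "p = Poly (map a [0..<Suc n])"
    have "a i = 0" if "i > n" for i
      using a[of i] coeff_eq_0[of m i] that by (simp add: n_def)
    then have "m = map_poly cst p"
      by (intro poly_eqI) (auto simp: p_def a nth_default_def simp del: upt_Suc)
    then have "to_fract p = 0" "p \<noteq> 0" using m(1,3) by auto
    then show False by simp
  qed
  define c where "c = coeff m i"
  have c: "c \<in> F" "nonconst c" using m i by (simp_all add: c_def)
  obtain g1 g2 where g: "c = Fract g1 g2" "g2 \<noteq> 0" "coprime g1 g2" by (rule ratfun_cases)
  define k where "k = rat_degree c"
  have kmax: "k = max (degree g1) (degree g2)" using g by (simp add: k_def rat_degree_Fract)
  define H where "H = smult g2 (lift_poly g1) - smult g1 (lift_poly g2)"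
  have Hc: "coeff H j = smult (coeff g1 j) g2 - smult (coeff g2 j) g1" for j
    by (simp add: H_def)
  obtain M e where M: "m = smult e (fract_poly M)" "e \<noteq> 0" "content M = 1" "degree M = n"
    using fract_poly_content_decompose[OF m(1)] unfolding n_def by metis
  obtain G where G: "G \<noteq> 0" "\<And>i. coeff G i \<in> F" "poly G ratX = 0"
      "smult (to_fract g2) G = fract_poly H"
    using graph[of g1 g2] c g unfolding H_def by blast
  have "m dvd fract_poly H" using mdvd[OF G(2,3)] by (metis G(4) dvd_smult)
  then have "fract_poly M dvd fract_poly H" using M(1,2) by (simp add: smult_dvd_iff)
  then have "M dvd H" using M(3) by (rule fract_poly_dvdD)
  then obtain N where N: "H = M * N" by blast
  have "H \<noteq> 0" using G(1,4) g(2) by (metis fract_poly_0 smult_eq_0_iff to_fract_eq_0_iff)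
  then have MN: "M \<noteq> 0" "N \<noteq> 0" using N by auto
  \<comment> \<open>A quotient of two coefficients of \<open>M\<close> equals \<open>c\<close>. As
    \<open>g1 / g2\<close> is in lowest terms, \<open>g1\<close> and \<open>g2\<close> divide these
    coefficients, so \<open>M\<close> already uses up the degree \<open>k\<close> that
    \<open>H\<close> can have in \<open>x\<close>.\<close>
  have kle: "k \<le> degree (swap_poly M)"
  proof -
    have "e * to_fract (coeff M n) = 1"
      using m(4) unfolding n_def[symmetric] by (subst (asm) M(1)) (simp add: coeff_map_poly)
    then have Mn: "coeff M n \<noteq> 0" by auto
    then have e: "e = 1 / to_fract (coeff M n)"
      using \<open>e * to_fract (coeff M n) = 1\<close> by (subst nonzero_eq_divide_eq) auto
    have "c = e * to_fract (coeff M i)"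
      unfolding c_def by (subst M(1)) (simp add: coeff_map_poly)
    then have "c = Fract (coeff M i) (coeff M n)" by (simp add: e Fract_conv_to_fract)
    then have "Fract g1 g2 = Fract (coeff M i) (coeff M n)" using g(1) by metis
    then have eq: "g1 * coeff M n = coeff M i * g2" using g(2) Mn by (simp add: eq_fract)
    have Mi: "coeff M i \<noteq> 0"
    proof
      assume "coeff M i = 0"
      then have "c = cst 0" using \<open>c = e * to_fract (coeff M i)\<close> by simp
      then show False using c(2) by (auto simp: rc.transc_def)
    qed
    have "g1 dvd coeff M i" using eq g(3) by (metis coprime_dvd_mult_left_iff dvd_triv_left)
    moreover have "g2 dvd coeff M n"
      using eq g(3) by (metis coprime_commute coprime_dvd_mult_right_iff dvd_triv_right)
    ultimately have "degree g1 \<le> degree (coeff M i)" "degree g2 \<le> degree (coeff M n)"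
      using Mi Mn by (simp_all add: dvd_imp_degree_le)
    then show ?thesis using degree_coeff_le_swap[of M i] degree_coeff_le_swap[of M n] kmax by linarith
  qed
  have "degree (swap_poly H) \<le> k"
    by (rule degree_swap_le)
      (auto simp: Hc kmax intro!: degree_diff_le order.trans[OF degree_smult_le])
  moreover have "degree (swap_poly H) = degree (swap_poly M) + degree (swap_poly N)"
    unfolding N by (rule degree_swap_mult[OF MN])
  ultimately have "degree (swap_poly N) = 0" using kle by linarith
  then obtain \<nu> where \<nu>: "swap_poly N = [:\<nu>:]" by (metis degree_eq_zeroE)
  have N\<nu>: "N = lift_poly \<nu>"
  proof (intro poly_eqI)
    fix i j
    have "coeff (coeff N i) j = coeff (coeff (swap_poly N) j) i" by (simp add: coeff_coeff_swap_poly)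
    then show "coeff (coeff N i) j = coeff (coeff (lift_poly \<nu>) i) j"
      by (cases j) (simp_all add: \<nu>)
  qed
  \<comment> \<open>The cofactor of \<open>M\<close> is now a polynomial \<nu> in \<open>T\<close>
    alone. A root \<beta> of it would be a root of \<open>H\<close> in \<open>T\<close> and make
    \<open>g1\<close> and \<open>g2\<close> proportional.\<close>
  have noroot: False if "poly H [:\<beta>:] = 0" for \<beta>
  proof -
    have "smult (poly g1 \<beta>) g2 = smult (poly g2 \<beta>) g1"
      using that by (simp add: H_def poly_lift_poly_const mult.commute)
    then show False
      using proportional_not_nonconst[of "poly g1 \<beta>" g2 "poly g2 \<beta>" g1] coprime_poly_0[OF g(3)] g c
      by auto
  qed
  have "degree N = 0"
  proof (rule ccontr)
    assume "degree N \<noteq> 0"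
    then have "degree \<nu> \<noteq> 0" using N\<nu> map_poly_degree_leq[of "\<lambda>a. [:a:]" \<nu>] by simp
    then obtain \<beta> where "poly \<nu> \<beta> = 0"
      using fundamental_theorem_of_algebra[of \<nu>] by (auto simp: constant_degree)
    then have "poly H [:\<beta>:] = 0" by (simp add: N N\<nu> poly_lift_poly_const)
    then show False by (rule noroot)
  qed
  then have "degree H = n" using N MN M(4) by (simp add: degree_mult_eq)
  \<comment> \<open>By antisymmetry \<open>H\<close> reaches degree \<open>k\<close> in
    \<open>T\<close> as well; since the cofactor is constant, \<open>k \<le> n\<close>
    follows.\<close>
  moreover have "coeff H k \<noteq> 0"
  proof
    assume "coeff H k = 0"
    then have "smult (coeff g1 k) g2 = smult (coeff g2 k) g1" by (simp add: Hc)
    moreover have "coeff g1 k \<noteq> 0 \<or> coeff g2 k \<noteq> 0"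
    proof (cases "degree g1 > degree g2")
      case True
      then have "g1 \<noteq> 0" by auto
      then show ?thesis using True by (simp add: kmax)
    qed (use g(2) in \<open>simp add: kmax max_absorb2\<close>)
    ultimately show False using proportional_not_nonconst g c by metis
  qed
  ultimately have kn: "k \<le> n" by (metis le_degree)
  have "F \<subseteq> comp_field c"
  proof
    fix f assume f: "f \<in> F"
    obtain s where s: "f = (\<Sum>j<k. (s j \<circ>\<^sub>R c) * ratX ^ j)"
      using powers_X_span[OF c(2)] unfolding k_def by blast
    have sF: "s j \<circ>\<^sub>R c \<in> F" for j using rat_comp_in_subfield[OF F c(1)] .
    \<comment> \<open>\<open>f\<close> is a combination of \<open>1, ..., x^(k-1)\<close> with
      coefficients in \<complex>(c), hence in \<open>F\<close>. As \<open>k \<le> n\<close>, no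
      nontrivial relation over \<open>F\<close> of this degree exists, so only the constant term
      survives.\<close>
    define E where "E = (\<Sum>j<k. monom (s j \<circ>\<^sub>R c) j) - [:f:]"
    have k0: "k > 0" using c(2) by (simp add: k_def nonconst_iff_degree)
    have cE: "coeff E j = (if j < k then s j \<circ>\<^sub>R c else 0) - (if j = 0 then f else 0)" for j
      by (simp add: E_def coeff_sum sum.delta' coeff_pCons split: nat.splits)
    have "E = 0"
    proof (rule indep)
      show "coeff E j \<in> F" for j
        unfolding cE using sF f by (auto intro!: is_subfieldD[OF F(1)])
      show "poly E ratX = 0" by (simp add: E_def poly_sum poly_monom flip: s)
      have "degree E \<le> k - 1" by (rule degree_le) (use k0 in \<open>auto simp: cE\<close>)
      then show "degree E < n" using k0 kn by linarith
    qed
    then have "coeff E 0 = 0" by simp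
    then have "f = s 0 \<circ>\<^sub>R c" using k0 by (simp add: cE)
    then show "f \<in> comp_field c" using comp_fieldI by simp
  qed
  moreover have "comp_field c \<subseteq> F"
    using rat_comp_in_subfield[OF F c(1)] by (auto simp: comp_field_def)
  ultimately show ?thesis using that[of c] c(2) by auto
qed

section \<open>Indecomposability and maximal subfields\<close>

lemma indecomposable_nonconst: "indecomposable p \<Longrightarrow> nonconst p"
  by (simp add: indecomposable_def nonconst_iff_degree)

lemma indecomposable_comp_cases:
  assumes "indecomposable p" "p = r \<circ>\<^sub>R v"
  shows "rat_degree r = 1 \<or> rat_degree v = 1"
proof -
  have *: "rat_degree p = rat_degree r * rat_degree v" "rat_degree p > 1"
    using assms by (auto simp: indecomposable_def rat_degree_comp)
  have "\<not> (rat_degree r < rat_degree p \<and> rat_degree v < rat_degree p)"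
    using assms unfolding indecomposable_def by blast
  then have le: "rat_degree p \<le> rat_degree r \<or> rat_degree p \<le> rat_degree v"
    by (simp only: not_less de_Morgan_conj)
  have pos: "0 < rat_degree r" "0 < rat_degree v"
    using *(2) unfolding *(1) by (auto intro!: Nat.gr0I)
  from le show ?thesis
  proof
    assume "rat_degree p \<le> rat_degree r"
    then have "rat_degree r * rat_degree v \<le> rat_degree r * 1" using *(1) by simp
    then have "rat_degree v \<le> 1" by (simp only: nat_mult_le_cancel1[OF pos(1)])
    then show ?thesis using pos by linarith
  next
    assume "rat_degree p \<le> rat_degree v"
    then have "rat_degree v * rat_degree r \<le> rat_degree v * 1" using *(1) by (simp add: mult.commute)
    then have "rat_degree r \<le> 1" by (simp only: nat_mult_le_cancel1[OF pos(2)])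
    then show ?thesis using pos by linarith
  qed
qed

text \<open>Lueroth turns indecomposability into maximality of \<complex>(p) among proper subfields:
  \<complex>(p, q) is some \<complex>(v), and writing \<open>p\<close> as a function of
  \<open>v\<close> leaves only the two extremes.\<close>

lemma indecomposable_maximal:
  assumes p: "indecomposable p" and q: "q \<notin> comp_field p"
  shows "ratX \<in> gen_field {p, q}"
proof -
  have nc: "nonconst p" using p by (rule indecomposable_nonconst)
  have "p \<in> gen_field {p, q}" using gen_field_superset[of "{p, q}"] by simp
  then obtain v where v: "nonconst v" "gen_field {p, q} = comp_field v"
    using Lueroth[OF subfield_gen_field cst_in_gen_field _ nc] by auto
  then obtain r where r: "p = r \<circ>\<^sub>R v" using gen_field_superset[of "{p, q}"] by (auto elim: comp_fieldE)
  from indecomposable_comp_cases[OF p r] show ?thesis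
  proof
    assume "rat_degree r = 1"
    then have "v \<in> comp_field p"
      using comp_field_eqI[of p v] nc r comp_fieldI by (simp add: rat_degree_comp)
    then have "gen_field {p, q} \<subseteq> comp_field p" using comp_field_trans nc v by metis
    then show ?thesis using q gen_field_superset[of "{p, q}"] by blast
  next
    assume "rat_degree v = 1"
    then have "ratX \<in> comp_field v"
      using comp_field_eqI[of v ratX] v(1) comp_fieldI[of v ratX] by simp
    then show ?thesis using v by simp
  qed
qed

section \<open>Poles and symmetries\<close>

lemma complex_root_exists:
  assumes "n > 0" shows "\<exists>z::complex. z ^ n = c"
proof -
  have "degree (monom 1 n + [:-c:] :: complex poly) = n"
    using assms by (subst degree_add_eq_left) (auto simp: degree_monom_eq)
  then obtain z where "poly (monom 1 n + [:-c:]) z = 0"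
    using fundamental_theorem_of_algebra[of "monom 1 n + [:-c:]"] assms by (auto simp: constant_degree)
  then show ?thesis by (auto simp: poly_monom)
qed

lemma to_fract_monom: "to_fract (monom c n) = cst c * ratX ^ n"
  using rc.peval_monom[of c n ratX] by simp

lemma polynomial_or_pole:
  fixes g :: ratfun
  shows "(\<exists>N. g = to_fract N) \<or> (\<exists>\<alpha>. poly (snd (quot_of_fract g)) \<alpha> = 0)"
proof (cases "degree (snd (quot_of_fract g)) = 0")
  case True
  then obtain b where b: "snd (quot_of_fract g) = [:b:]" by (metis degree_eq_zeroE)
  then have "b \<noteq> 0" by (metis pCons_0_0 snd_quot_of_fract_nonzero)
  have "g = to_fract (fst (quot_of_fract g)) / cst b"
    by (simp flip: b Fract_conv_to_fract)
  also have "\<dots> = to_fract (smult (inverse b) (fst (quot_of_fract g)))"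
    by (simp only: to_fract_smult rc.\<kappa>_inverse divide_inverse mult.commute)
  finally show ?thesis by blast
next
  case False
  then show ?thesis
    using fundamental_theorem_of_algebra[of "snd (quot_of_fract g)"] by (auto simp: constant_degree)
qed

text \<open>The homogenised composite is already in lowest terms, so its denominator divides that of
  any other representation.\<close>

lemma denominator_dvd:
  assumes h: "nonconst h" "h = Fract P Q" "Q \<noteq> 0" "coprime P Q"
    and g: "g = Fract N D" "D \<noteq> 0" "coprime N D"
    and f: "g \<circ>\<^sub>R h = Fract F0 s" "s \<noteq> 0"
  shows "homog (max (degree N) (degree D)) D P Q dvd s"
proof -
  define d where "d = max (degree N) (degree D)"
  have gh: "g \<circ>\<^sub>R h = Fract (homog d N P Q) (homog d D P Q)" and nz: "homog d D P Q \<noteq> 0"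
    using comp_Fract_homog[of P Q D d N] g h d_def by auto
  have "coprime (homog d N P Q) (homog d D P Q)"
    by (rule coprime_homog) (use g h d_def nz in auto)
  moreover have "homog d N P Q * s = F0 * homog d D P Q" using gh f nz by (simp add: eq_fract)
  ultimately show ?thesis
    unfolding d_def by (metis coprime_commute coprime_dvd_mult_right_iff dvd_triv_right)
qed

text \<open>Points where \<open>h\<close> takes the value \<alpha> are poles of the composite, and
  \<open>s\<close> records its finite poles. Algebraically, \<open>P - \<alpha> Q\<close> is the
  homogenised form of the factor \<open>T - \<alpha>\<close> of the denominator.\<close>

lemma pole_value_dvd:
  assumes h: "nonconst h" "h = Fract P Q" "Q \<noteq> 0" "coprime P Q"
    and f: "g \<circ>\<^sub>R h = Fract F0 s" "s \<noteq> 0"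
    and \<alpha>: "poly (snd (quot_of_fract g)) \<alpha> = 0"
  shows "(P - smult \<alpha> Q) dvd s"
proof -
  obtain N D where ND: "g = Fract N D" "D \<noteq> 0" "coprime N D" "D = snd (quot_of_fract g)"
    by (rule ratfun_cases)
  define d where "d = max (degree N) (degree D)"
  obtain D' where D': "D = [:-\<alpha>, 1:] * D'" using \<alpha> ND(4) by (auto simp: poly_eq_0_iff_dvd)
  then have "D' \<noteq> 0" using ND(2) by auto
  then have "degree D = Suc (degree D')" unfolding D' by (subst degree_mult_eq) auto
  then obtain d' where d': "d = Suc d'" "degree D' \<le> d'" "degree D \<le> d"
    unfolding d_def by (cases "max (degree N) (degree D)") auto
  have "to_fract (homog d D P Q) = to_fract Q ^ d * rc.peval D h"
    using h d' by (simp add: to_fract_homog)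
  also have "\<dots> = to_fract Q * (h - cst \<alpha>) * (to_fract Q ^ d' * rc.peval D' h)"
    unfolding D' rc.peval_mult by (simp add: d' rc.peval_pCons rc.\<kappa>_minus)
  also have "to_fract Q * (h - cst \<alpha>) = to_fract (P - smult \<alpha> Q)"
    using h(3) by (simp add: h(2) Fract_conv_to_fract to_fract_smult algebra_simps)
  also have "to_fract Q ^ d' * rc.peval D' h = to_fract (homog d' D' P Q)"
    using h d' by (simp add: to_fract_homog)
  finally have "homog d D P Q = (P - smult \<alpha> Q) * homog d' D' P Q"
    by (simp only: to_fract_mult[symmetric] to_fract_eq_iff)
  then show ?thesis
    using denominator_dvd[OF h ND(1-3) f] unfolding d_def[symmetric] by (metis dvd_mult_left)
qed

lemma pole_infinity_dvd:
  assumes h: "nonconst h" "h = Fract P Q" "Q \<noteq> 0" "coprime P Q"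
    and f: "to_fract N \<circ>\<^sub>R h = Fract F0 s" "s \<noteq> 0" and N: "degree N > 0"
  shows "Q dvd s"
proof -
  have "to_fract (homog (degree N) 1 P Q) = to_fract (Q ^ degree N)"
    using h by (simp add: to_fract_homog to_fract_power)
  then have "homog (degree N) 1 P Q = Q ^ degree N" by (simp only: to_fract_eq_iff)
  then have "Q ^ degree N dvd s"
    using denominator_dvd[OF h _ _ _ f, of N 1] by (simp add: Fract_conv_to_fract)
  then show ?thesis using N by (meson dvd_power dvd_trans)
qed

lemma polynomial_right_factor:
  assumes "nonconst (to_fract N)" "to_fract N \<circ>\<^sub>R b = to_fract G" "nonconst b"
  shows "\<exists>B. b = to_fract B"
proof -
  obtain P Q where PQ: "b = Fract P Q" "Q \<noteq> 0" "coprime P Q" "Q = snd (quot_of_fract b)"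
    by (rule ratfun_cases)
  have "Q dvd 1"
    by (rule pole_infinity_dvd[OF assms(3) PQ(1-3), of N G])
      (use assms in \<open>auto simp: Fract_conv_to_fract nonconst_iff_degree\<close>)
  then have "degree Q = 0" by (simp add: is_unit_iff_degree PQ(2))
  then obtain c where Q: "Q = [:c:]" by (metis degree_eq_zeroE)
  have "poly (snd (quot_of_fract b)) \<alpha> \<noteq> 0" for \<alpha>
    using PQ(2) unfolding PQ(4)[symmetric] Q by simp
  then show ?thesis using polynomial_or_pole[of b] by blast
qed

lemma dvd_monomE:
  fixes A :: "complex poly"
  assumes "A dvd monom 1 n"
  obtains c j where "c \<noteq> 0" "A = monom c j"
proof -
  have A0: "A \<noteq> 0" using assms by (auto simp: monom_eq_0_iff)
  obtain B where B: "A = [:-0, 1:] ^ order 0 A * B" "\<not> [:-0, 1:] dvd B"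
    using order_decomp[OF A0] by blast
  then have B0: "poly B 0 \<noteq> 0" by (simp add: poly_eq_0_iff_dvd)
  have "B dvd monom 1 n" using assms B(1) by (metis dvd_mult_right)
  moreover have "coprime B (monom 1 n)"
    using B0 by (subst coprime_iff_no_common_root) (auto simp: poly_monom monom_eq_0_iff)
  ultimately have "is_unit B" using coprime_common_divisor[of B "monom 1 n" B] by simp
  then have "degree B = 0" using B0 by (subst (asm) is_unit_iff_degree) auto
  then obtain c where c: "B = [:c:]" by (metis degree_eq_zeroE)
  then have "A = monom c (order 0 A)" using B(1) by (simp add: monom_altdef)
  then show ?thesis using that B0 c by auto
qed

section \<open>Laurent polynomials and normal forms of right factors\<close>

lemma laurentI: "Fract F (monom 1 n) \<in> laurent_polys"
  by (auto simp: laurent_polys_def)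

lemma laurentE:
  assumes "f \<in> laurent_polys"
  obtains F n where "f = Fract F (monom 1 n)"
  using assms by (auto simp: laurent_polys_def)

lemma laurentI_dvd:
  assumes "Q dvd monom 1 n" "Q \<noteq> 0" shows "Fract P Q \<in> laurent_polys"
proof -
  obtain R where R: "monom 1 n = Q * R" using assms by blast
  then have "R \<noteq> 0" by (auto simp: monom_eq_0_iff)
  then have "Fract P Q = Fract (P * R) (monom 1 n)" using assms R by (simp add: eq_fract mult_ac)
  then show ?thesis using laurentI by simp
qed

lemma rat_degree_affine:
  assumes "c \<noteq> 0" shows "rat_degree (cst c * g + cst d) = rat_degree g"
  using rat_degree_comp[of "to_fract [:d, c:]" g] assms
  by (simp add: rc.peval_pCons mult.commute add.commute)

lemma rat_degree_inverse:
  shows "rat_degree (inverse g) = rat_degree g"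
proof -
  have "rat_degree (Fract 1 [:0, 1:]) = 1" by (subst rat_degree_Fract) auto
  then have 1: "rat_degree (inverse ratX) = 1" by (simp add: Fract_conv_to_fract inverse_eq_divide)
  show ?thesis
  proof (cases "nonconst g")
    case True
    then show ?thesis using rat_degree_comp[of "inverse ratX" g] 1 by (simp add: rat_comp_hom)
  next
    case False
    then obtain c where "g = cst c" by (auto simp: rc.transc_def)
    then show ?thesis by (simp flip: rc.\<kappa>_inverse)
  qed
qed

text \<open>The Moebius map \<open>1 / (x - \<alpha>)\<close> sends a pole of \<open>F\<close> to
  infinity. Afterwards the poles of the right factor are poles of the composite, so its denominator
  divides \<open>s\<close>.\<close>

lemma pole_to_infinity:
  assumes f: "F \<circ>\<^sub>R p = Fract F0 s" "s \<noteq> 0" and p: "nonconst p"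
    and \<alpha>: "poly (snd (quot_of_fract F)) \<alpha> = 0"
  obtains \<mu> G where "rat_degree \<mu> = 1" "F = G \<circ>\<^sub>R \<mu>" "\<mu> \<circ>\<^sub>R p = inverse (p - cst \<alpha>)"
    "\<exists>P Q. \<mu> \<circ>\<^sub>R p = Fract P Q \<and> Q dvd s \<and> Q \<noteq> 0"
proof -
  obtain P Q where PQ: "p = Fract P Q" "Q \<noteq> 0" "coprime P Q" by (rule ratfun_cases)
  have dvd: "(P - smult \<alpha> Q) dvd s" by (rule pole_value_dvd[OF p PQ f \<alpha>])
  define \<mu> where "\<mu> = inverse (ratX - cst \<alpha>)"
  have \<mu>1: "rat_degree \<mu> = 1"
    using rat_degree_affine[of 1 ratX "-\<alpha>"] by (simp add: \<mu>_def rat_degree_inverse rc.\<kappa>_minus)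
  obtain \<nu> where \<nu>: "\<nu> \<circ>\<^sub>R \<mu> = ratX" using degree_1_invertible[OF \<mu>1] by blast
  have F: "F = (F \<circ>\<^sub>R \<nu>) \<circ>\<^sub>R \<mu>"
    using \<mu>1 by (simp add: rat_comp_assoc \<nu> nonconst_iff_degree)
  have \<mu>p: "\<mu> \<circ>\<^sub>R p = inverse (p - cst \<alpha>)" by (simp add: \<mu>_def rat_comp_hom p)
  have "p - cst \<alpha> = Fract (P - smult \<alpha> Q) Q"
    using PQ(2) by (simp add: PQ(1) Fract_conv_to_fract to_fract_smult field_simps)
  then have "\<mu> \<circ>\<^sub>R p = Fract Q (P - smult \<alpha> Q)"
    using dvd f(2) by (simp add: \<mu>p Fract_conv_to_fract)
  moreover have "P - smult \<alpha> Q \<noteq> 0" using dvd f(2) by auto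
  ultimately show ?thesis using dvd by (intro that[OF \<mu>1 F \<mu>p]) blast
qed

lemma laurent_left_polynomial:
  assumes "to_fract N \<circ>\<^sub>R p \<in> laurent_polys" "nonconst (to_fract N)" "nonconst p"
  shows "p \<in> laurent_polys"
proof -
  obtain F n where F: "to_fract N \<circ>\<^sub>R p = Fract F (monom 1 n)" using assms(1) by (rule laurentE)
  obtain P Q where PQ: "p = Fract P Q" "Q \<noteq> 0" "coprime P Q" by (rule ratfun_cases)
  have "Q dvd monom 1 n"
    by (rule pole_infinity_dvd[OF assms(3) PQ F])
      (use assms(2) in \<open>auto simp: monom_eq_0_iff nonconst_iff_degree\<close>)
  then show ?thesis unfolding PQ(1) by (rule laurentI_dvd) (rule PQ(2))
qed

lemma laurent_unit:
  assumes "g \<in> laurent_polys" "inverse g \<in> laurent_polys" "g \<noteq> 0"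
  obtains c i j where "c \<noteq> 0" "g = cst c * ratX ^ i / ratX ^ j"
proof -
  obtain A n where A: "g = Fract A (monom 1 n)" using assms(1) by (rule laurentE)
  obtain B m where B: "inverse g = Fract B (monom 1 m)" using assms(2) by (rule laurentE)
  have "g * inverse g = 1" using assms(3) by simp
  then have "Fract (A * B) (monom 1 n * monom 1 m) = 1" by (metis A B mult_fract)
  then have "Fract (A * B) (monom 1 (n + m)) = 1" by (simp add: mult_monom)
  then have "A * B = monom 1 (n + m)" by (simp add: One_fract_def eq_fract monom_eq_0_iff)
  then have "A dvd monom 1 (n + m)" by (metis dvd_triv_left)
  then obtain c j where "c \<noteq> 0" "A = monom c j" by (rule dvd_monomE)
  then show ?thesis using that[of c j n] A by (simp add: Fract_conv_to_fract to_fract_monom)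
qed

text \<open>A polynomial \<open>F\<close> leaves \<open>p\<close> no poles besides 0 and infinity.
  Otherwise a finite pole is moved to infinity, which makes the new right factor a Laurent
  polynomial. If a second finite pole \<beta> remains, both \<open>p1 - \<beta>\<close> and its
  inverse are Laurent polynomials, so \<open>p1 - \<beta>\<close> is a constant times a power of
  \<open>x\<close>.\<close>

lemma laurent_normalise:
  assumes f: "F \<circ>\<^sub>R p \<in> laurent_polys" and nc: "nonconst F" "nonconst p"
  obtains \<mu> G where "rat_degree \<mu> = 1" "F = G \<circ>\<^sub>R \<mu>"
    "(\<exists>N. G = to_fract N) \<and> \<mu> \<circ>\<^sub>R p \<in> laurent_polys \<or> (\<exists>k\<ge>1. \<mu> \<circ>\<^sub>R p = ratX ^ k)"
proof (cases "\<exists>N. F = to_fract N")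
  case True
  then have "p \<in> laurent_polys" using laurent_left_polynomial f nc by blast
  then show ?thesis using that[of ratX F] True by simp
next
  case False
  then obtain \<alpha> where \<alpha>: "poly (snd (quot_of_fract F)) \<alpha> = 0" using polynomial_or_pole by blast
  obtain F0 n where F0: "F \<circ>\<^sub>R p = Fract F0 (monom 1 n)" using f by (rule laurentE)
  have nz: "(monom 1 n :: complex poly) \<noteq> 0" by (simp add: monom_eq_0_iff)
  obtain \<mu> G where \<mu>: "rat_degree \<mu> = 1" "F = G \<circ>\<^sub>R \<mu>"
    "\<exists>P Q. \<mu> \<circ>\<^sub>R p = Fract P Q \<and> Q dvd monom 1 n \<and> Q \<noteq> 0"
    using pole_to_infinity[OF F0 nz nc(2) \<alpha>] by metis
  define p1 where "p1 = \<mu> \<circ>\<^sub>R p"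
  have p1: "p1 \<in> laurent_polys" "nonconst p1"
  proof -
    show "p1 \<in> laurent_polys" using \<mu>(3) laurentI_dvd by (auto simp: p1_def)
    show "nonconst p1" using \<mu>(1) nc(2) by (simp add: p1_def nonconst_comp_iff) (simp add: nonconst_iff_degree)
  qed
  have Gp1: "G \<circ>\<^sub>R p1 = Fract F0 (monom 1 n)"
    using F0 by (simp add: \<mu>(2) p1_def rat_comp_assoc nc)
  show ?thesis
  proof (cases "\<exists>N. G = to_fract N")
    case True
    then show ?thesis using that[OF \<mu>(1,2)] p1 p1_def by simp
  next
    case False
    then obtain \<beta> where \<beta>: "poly (snd (quot_of_fract G)) \<beta> = 0" using polynomial_or_pole by blast
    obtain P Q where "inverse (p1 - cst \<beta>) = Fract P Q" "Q dvd monom 1 n" "Q \<noteq> 0"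
      using pole_to_infinity[OF Gp1 nz p1(2) \<beta>] by metis
    then have 1: "inverse (p1 - cst \<beta>) \<in> laurent_polys" using laurentI_dvd by simp
    obtain A m where A: "p1 = Fract A (monom 1 m)" using p1(1) by (rule laurentE)
    have "p1 - cst \<beta> = Fract (A - smult \<beta> (monom 1 m)) (monom 1 m)"
      by (simp add: A Fract_conv_to_fract to_fract_smult field_simps monom_eq_0_iff)
    then have 2: "p1 - cst \<beta> \<in> laurent_polys" using laurentI by simp
    have 3: "p1 - cst \<beta> \<noteq> 0" using p1(2) by (auto simp: rc.transc_def)
    obtain c i j where c: "c \<noteq> 0" "p1 - cst \<beta> = cst c * ratX ^ i / ratX ^ j"
      using laurent_unit[OF 2 1 3] by blast
    have ij: "i \<noteq> j"
    proof
      assume "i = j"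
      then have "p1 = cst (c + \<beta>)" using c(2) by (simp add: rc.\<kappa>_add diff_eq_eq del: to_fract_add)
      then show False using p1(2) by (auto simp: rc.transc_def)
    qed
    define \<mu>1 where "\<mu>1 = cst (inverse c) * ratX + cst (- \<beta> / c)"
    have d1: "rat_degree \<mu>1 = 1" unfolding \<mu>1_def using rat_degree_affine[of "inverse c" ratX] c by simp
    have \<mu>1p: "\<mu>1 \<circ>\<^sub>R p1 = ratX ^ i / ratX ^ j"
    proof -
      have "\<mu>1 \<circ>\<^sub>R p1 = (p1 - cst \<beta>) / cst c"
        by (simp add: \<mu>1_def rat_comp_hom p1 rc.\<kappa>_inverse rc.\<kappa>_mult rc.\<kappa>_minus
            divide_inverse algebra_simps)
      then show ?thesis using c by simp
    qed
    \<comment> \<open>A negative exponent is made positive by taking the reciprocal.\<close>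
    define \<mu>2 where "\<mu>2 = (if i > j then \<mu>1 else inverse \<mu>1)"
    have d2: "rat_degree \<mu>2 = 1" using d1 by (simp add: \<mu>2_def rat_degree_inverse)
    have "\<mu>2 \<circ>\<^sub>R p1 = ratX ^ (if i > j then i - j else j - i)"
      using ij by (auto simp: \<mu>2_def \<mu>1p rat_comp_inverse p1 power_diff)
    then have k: "\<exists>k\<ge>1. \<mu>2 \<circ>\<^sub>R p1 = ratX ^ k" using ij
      by (intro exI[of _ "if i > j then i - j else j - i"]) auto
    obtain \<nu>2 where \<nu>2: "\<nu>2 \<circ>\<^sub>R \<mu>2 = ratX" using degree_1_invertible[OF d2] by blast
    have nc': "nonconst \<mu>" "nonconst \<mu>2" using \<mu>(1) d2 by (simp_all add: nonconst_iff_degree)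
    show ?thesis
    proof (rule that[of "\<mu>2 \<circ>\<^sub>R \<mu>" "G \<circ>\<^sub>R \<nu>2"])
      show "rat_degree (\<mu>2 \<circ>\<^sub>R \<mu>) = 1" using \<mu>(1) d2 by (simp add: rat_degree_comp)
      have "(G \<circ>\<^sub>R \<nu>2) \<circ>\<^sub>R \<mu>2 = G" by (simp add: rat_comp_assoc nc' \<nu>2)
      then show "F = (G \<circ>\<^sub>R \<nu>2) \<circ>\<^sub>R \<mu>2 \<circ>\<^sub>R \<mu>"
        using \<mu>(2) rat_comp_assoc[OF nc'(1), of "G \<circ>\<^sub>R \<nu>2" \<mu>2] by simp
    qed (use k in \<open>simp add: rat_comp_assoc nc p1_def\<close>)
  qed
qed

text \<open>After a finite pole is moved to infinity, a second finite pole \<beta> of the outer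
  function would make \<open>A - \<beta>\<close> a unit among polynomials, hence \<open>A\<close>
  constant.\<close>

lemma polynomial_normalise:
  assumes f: "w \<circ>\<^sub>R a = to_fract F" and nc: "nonconst w" "nonconst a"
  obtains \<mu> W A where "rat_degree \<mu> = 1" "w = to_fract W \<circ>\<^sub>R \<mu>" "\<mu> \<circ>\<^sub>R a = to_fract A"
proof (cases "\<exists>N. w = to_fract N")
  case True
  then obtain A where "a = to_fract A" using polynomial_right_factor f nc by metis
  then show ?thesis using that[of ratX] True by auto
next
  case False
  then obtain \<alpha> where \<alpha>: "poly (snd (quot_of_fract w)) \<alpha> = 0" using polynomial_or_pole by blast
  have f1: "w \<circ>\<^sub>R a = Fract F 1" using f by (simp add: Fract_conv_to_fract)
  have poly: "\<exists>A. g = to_fract A" if g: "g = Fract P Q" "Q dvd 1" "Q \<noteq> 0"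
    for g and P Q :: "complex poly"
  proof -
    have "degree Q = 0" using g(2,3) by (simp add: is_unit_iff_degree)
    then obtain b where b: "Q = [:b:]" by (metis degree_eq_zeroE)
    have "g = to_fract P / cst b" by (simp only: g(1) b Fract_conv_to_fract)
    then have "g = to_fract (smult (inverse b) P)"
      by (simp only: to_fract_smult rc.\<kappa>_inverse divide_inverse mult.commute)
    then show ?thesis by blast
  qed
  obtain \<mu> G where \<mu>: "rat_degree \<mu> = 1" "w = G \<circ>\<^sub>R \<mu>"
    "\<exists>P Q. \<mu> \<circ>\<^sub>R a = Fract P Q \<and> Q dvd 1 \<and> Q \<noteq> 0"
    using pole_to_infinity[OF f1 one_neq_zero nc(2) \<alpha>] by metis
  then obtain A where A: "\<mu> \<circ>\<^sub>R a = to_fract A" using poly by blast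
  have nA: "nonconst (to_fract A)"
    using \<mu>(1) nc nonconst_comp_iff[of \<mu> a] by (simp flip: A) (simp add: nonconst_iff_degree)
  have GA: "G \<circ>\<^sub>R to_fract A = Fract F 1"
    using f1 by (simp add: \<mu>(2) rat_comp_assoc nc A)
  show ?thesis
  proof (cases "\<exists>N. G = to_fract N")
    case True
    then show ?thesis using that \<mu>(1,2) A by blast
  next
    case False
    then obtain \<beta> where \<beta>: "poly (snd (quot_of_fract G)) \<beta> = 0" using polynomial_or_pole by blast
    have "(A - smult \<beta> 1) dvd 1"
      by (rule pole_value_dvd[OF nA _ _ _ GA _ \<beta>]) (simp_all add: Fract_conv_to_fract)
    then have "is_unit (A - [:\<beta>:])" by (simp add: one_pCons)
    moreover have "A - [:\<beta>:] \<noteq> 0" using nA by (auto simp: rc.transc_def)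
    ultimately have "degree (A - [:\<beta>:]) = 0" by (simp add: is_unit_iff_degree)
    then obtain b where "A - [:\<beta>:] = [:b:]" by (metis degree_eq_zeroE)
    then have "A = [:\<beta> + b:]" by (metis add_pCons add_0 diff_add_cancel add.commute)
    then show ?thesis using nA by (auto simp: rc.transc_def)
  qed
qed

section \<open>Powers of x and invariants of scalings and involutions\<close>

lemma nonconst_power_X: "k \<ge> 1 \<Longrightarrow> nonconst (ratX ^ k)"
  and rat_degree_power_X: "rat_degree (ratX ^ k) = k"
proof -
  show *: "rat_degree (ratX ^ k) = k"
    using rat_degree_to_fract[of "monom 1 k"] by (simp add: to_fract_monom degree_monom_eq)
  then show "k \<ge> 1 \<Longrightarrow> nonconst (ratX ^ k)" by (simp add: nonconst_iff_degree)
qed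

lemma power_X_eq: "ratX ^ k = Fract (monom 1 k) 1"
  by (simp add: Fract_conv_to_fract to_fract_monom)

text \<open>A nonzero pole \<alpha> of \<open>H\<close> would give poles of the composite at the
  \<open>k\<close>-th roots of \<alpha>, which are nonzero too.\<close>

lemma laurent_left_of_power:
  assumes f: "H \<circ>\<^sub>R ratX ^ k \<in> laurent_polys" and k: "k \<ge> 1"
  shows "H \<in> laurent_polys"
proof -
  obtain N D where ND: "H = Fract N D" "D \<noteq> 0" "coprime N D" "D = snd (quot_of_fract H)"
    by (rule ratfun_cases)
  obtain F n where F: "H \<circ>\<^sub>R ratX ^ k = Fract F (monom 1 n)" using f by (rule laurentE)
  have root: "\<alpha> = 0" if \<alpha>: "poly D \<alpha> = 0" for \<alpha>
  proof -
    have "(monom 1 k - smult \<alpha> 1) dvd monom 1 n"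
      by (rule pole_value_dvd[OF nonconst_power_X[OF k] power_X_eq _ _ F _ \<alpha>[unfolded ND(4)]])
        (simp_all add: monom_eq_0_iff)
    moreover obtain z where z: "z ^ k = \<alpha>" using complex_root_exists k by (metis One_nat_def Suc_le_eq)
    moreover have "poly (monom 1 k - smult \<alpha> 1) z = 0" by (simp add: poly_monom z)
    ultimately have "poly (monom 1 n) z = 0" by (metis dvdE mult_zero_left poly_mult)
    then show "\<alpha> = 0" using z k by (auto simp: poly_monom)
  qed
  obtain B where B: "D = [:-0, 1:] ^ order 0 D * B" "\<not> [:-0, 1:] dvd B"
    using order_decomp[OF ND(2)] by blast
  have "degree B = 0"
  proof (rule ccontr)
    assume "degree B \<noteq> 0"
    then obtain \<alpha> where \<alpha>: "poly B \<alpha> = 0"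
      using fundamental_theorem_of_algebra[of B] by (auto simp: constant_degree)
    then have "poly D \<alpha> = 0" by (subst B(1)) simp
    then have "\<alpha> = 0" by (rule root)
    then show False using \<alpha> B(2) by (simp add: poly_eq_0_iff_dvd)
  qed
  then have "is_unit B" using B ND(2) by (subst is_unit_iff_degree) auto
  moreover have "D = B * monom 1 (order 0 D)" using B(1) by (simp add: monom_altdef mult.commute)
  ultimately have "D dvd monom 1 (order 0 D)" by (metis dvd_refl mult_unit_dvd_iff')
  then show ?thesis unfolding ND(1) using ND(2) by (rule laurentI_dvd)
qed

text \<open>The substitution \<open>x -> \<alpha> x\<close> fixes \<complex>(x^k) and multiplies the
  basis element \<open>x^i\<close> by \<open>\<alpha>^i\<close>, which differs from 1 for
  \<open>0 < i < k\<close>. An invariant therefore has only the component at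
  \<open>i = 0\<close>.\<close>

lemma invariant_root_of_unity:
  assumes \<alpha>: "\<alpha> ^ k = 1" "\<And>i. 0 < i \<Longrightarrow> i < k \<Longrightarrow> \<alpha> ^ i \<noteq> 1" and k: "k \<ge> 1"
    and e: "e \<circ>\<^sub>R (cst \<alpha> * ratX) = e"
  shows "e \<in> comp_field (ratX ^ k)"
proof -
  define h where "h = ratX ^ k"
  have h: "nonconst h" "rat_degree h = k" using k by (simp_all add: h_def nonconst_power_X rat_degree_power_X)
  have "\<alpha> \<noteq> 0" using \<alpha>(1) k by (auto simp: power_0_left)
  then have m: "nonconst (cst \<alpha> * ratX)" using rat_degree_affine[of \<alpha> ratX 0] by (simp add: nonconst_iff_degree)
  have hm: "h \<circ>\<^sub>R (cst \<alpha> * ratX) = h"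
    by (simp add: h_def rat_comp_power m power_mult_distrib \<alpha>(1) flip: rc.\<kappa>_power)
  obtain s where s: "e = (\<Sum>i<k. (s i \<circ>\<^sub>R h) * ratX ^ i)" using powers_X_span[OF h(1)] h(2) by metis
  have "e \<circ>\<^sub>R (cst \<alpha> * ratX) = (\<Sum>i<k. (s i * cst (\<alpha> ^ i) \<circ>\<^sub>R h) * ratX ^ i)"
    unfolding s by (simp add: rat_comp_hom m h rat_comp_assoc hm power_mult_distrib rc.\<kappa>_power mult_ac)
  then have "(\<Sum>i<k. (s i * (cst (\<alpha> ^ i) - 1) \<circ>\<^sub>R h) * ratX ^ i) = 0"
    using e s by (simp add: rat_comp_hom h algebra_simps sum_subtractf)
  then have "s i * (cst (\<alpha> ^ i) - 1) = 0" if "i < k" for i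
    using powers_X_independent[OF h(1), where k = k and i = i and
        r = "\<lambda>i. s i * (cst (\<alpha> ^ i) - 1)"] that h(2) by simp
  moreover have "cst (\<alpha> ^ i) - 1 \<noteq> 0" if "i < k" "i \<noteq> 0" for i
  proof -
    have "cst (\<alpha> ^ i) \<noteq> cst 1" using \<alpha>(2)[of i] that by (simp only: rc.\<kappa>_eq) simp
    then show ?thesis by simp
  qed
  ultimately have "s i = 0" if "i < k" "i \<noteq> 0" for i using that by (metis mult_eq_0_iff)
  then have "e = (\<Sum>i\<in>{0}. (s i \<circ>\<^sub>R h) * ratX ^ i)"
    unfolding s using k by (intro sum.mono_neutral_right) auto
  then show ?thesis unfolding h_def[symmetric] using comp_fieldI by simp
qed

lemma joukowski_degree:
  assumes "c \<noteq> 0" shows "rat_degree (ratX + cst c / ratX) = 2" "nonconst (ratX + cst c / ratX)"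
proof -
  have eq: "ratX + cst c / ratX = Fract [:c, 0, 1:] [:0, 1:]"
  proof -
    have "to_fract [:c, 0, 1:] = ratX * ratX + cst c"
      by (simp flip: to_fract_mult to_fract_add)
    then show ?thesis by (simp add: Fract_conv_to_fract field_simps)
  qed
  have "coprime [:c, 0, 1:] [:0, 1:]"
    using assms by (subst coprime_iff_no_common_root) auto
  then show "rat_degree (ratX + cst c / ratX) = 2" unfolding eq by (subst rat_degree_Fract) auto
  then show "nonconst (ratX + cst c / ratX)" by (simp add: nonconst_iff_degree)
qed

lemma nonconst_const_over_X: "c \<noteq> 0 \<Longrightarrow> nonconst (cst c / ratX)"
  using rat_degree_affine[of c "inverse ratX" 0]
  by (simp add: nonconst_iff_degree rat_degree_inverse divide_inverse)

text \<open>The same comparison of coordinates, now in the basis \<open>1, x\<close> over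
  \<complex>(x + c / x): the involution \<open>x -> c / x\<close> fixes this field and moves
  \<open>x\<close>.\<close>

lemma invariant_involution:
  assumes c: "c \<noteq> 0" and e: "e \<circ>\<^sub>R (cst c / ratX) = e"
  shows "e \<in> comp_field (ratX + cst c / ratX)"
proof -
  define h where "h = ratX + cst c / ratX"
  have h: "nonconst h" "rat_degree h = 2" using c by (simp_all add: h_def joukowski_degree)
  have m: "nonconst (cst c / ratX)" using c by (rule nonconst_const_over_X)
  have hm: "h \<circ>\<^sub>R (cst c / ratX) = h"
    using c by (simp add: h_def rat_comp_hom m field_simps)
  obtain s where "e = (\<Sum>i<2. (s i \<circ>\<^sub>R h) * ratX ^ i)" using powers_X_span[OF h(1)] h(2) by metis
  then have s: "e = (s 0 \<circ>\<^sub>R h) + (s 1 \<circ>\<^sub>R h) * ratX" by (simp add: numeral_2_eq_2)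
  then have "e \<circ>\<^sub>R (cst c / ratX) = (s 0 \<circ>\<^sub>R h) + (s 1 \<circ>\<^sub>R h) * (cst c / ratX)"
    by (simp add: rat_comp_hom m rat_comp_assoc hm)
  then have "(s 1 \<circ>\<^sub>R h) * (ratX - cst c / ratX) = 0" using e s by (simp add: algebra_simps)
  moreover have "ratX - cst c / ratX \<noteq> 0"
  proof
    assume "ratX - cst c / ratX = 0"
    then have "ratX * ratX = cst c" by (simp add: field_simps)
    then have "to_fract ([:0, 1:] * [:0, 1:]) = cst c" by (simp only: to_fract_mult)
    then show False by (simp only: to_fract_eq_iff) auto
  qed
  ultimately have "s 1 \<circ>\<^sub>R h = 0" by auto
  then have "e = s 0 \<circ>\<^sub>R h" using s by simp
  then show ?thesis unfolding h_def[symmetric] using comp_fieldI by simp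
qed

section \<open>The equation a(p) = b(q) with deg a = deg b\<close>

text \<open>The shift \<open>s\<close> absorbs the coefficient of index \<open>d - 1\<close>. The
  resulting gap of two in the degree is what bounds the error terms at both poles later on.\<close>

lemma complete_the_power:
  fixes a :: "complex poly"
  assumes "degree a = d" "d \<ge> 1"
  obtains s a2 where "a = smult (lead_coeff a) ([:s, 1:] ^ d) + a2" "a2 = 0 \<or> degree a2 + 2 \<le> d"
proof -
  define \<alpha> where "\<alpha> = lead_coeff a"
  have \<alpha>: "\<alpha> \<noteq> 0" using assms by (auto simp: \<alpha>_def)
  define s where "s = coeff a (d - 1) / (of_nat d * \<alpha>)"
  define a2 where "a2 = a - smult \<alpha> ([:s, 1:] ^ d)"
  have deg: "degree ([:s, 1:] ^ d) = d" by (simp add: degree_power_eq)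
  have top: "coeff ([:s, 1:] ^ d) d = 1" using lead_coeff_power[of "[:s, 1:]" d] deg by simp
  have sub: "coeff ([:s, 1:] ^ Suc k) k = of_nat (Suc k) * s" for k
  proof (induction k)
    case (Suc k)
    have "coeff ([:s, 1:] ^ Suc (Suc k)) (Suc k) =
        s * coeff ([:s, 1:] ^ Suc k) (Suc k) + coeff ([:s, 1:] ^ Suc k) k"
      by (subst power_Suc) (simp add: mult_pCons_left del: power_Suc)
    also have "coeff ([:s, 1:] ^ Suc k) (Suc k) = 1"
      using lead_coeff_power[of "[:s, 1:]" "Suc k"] by (simp add: degree_power_eq del: power_Suc)
    finally show ?case using Suc by (simp add: algebra_simps)
  qed simp
  have c1: "coeff a2 d = 0" using top assms by (simp add: a2_def \<alpha>_def)
  have c2: "coeff a2 (d - 1) = 0"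
    using sub[of "d - 1"] assms \<alpha> by (simp add: a2_def s_def field_simps)
  have "degree a2 \<le> d" unfolding a2_def using deg assms
    by (intro degree_diff_le order.trans[OF degree_smult_le]) auto
  have "degree a2 + 2 \<le> d" if "a2 \<noteq> 0"
  proof -
    have "coeff a2 (degree a2) \<noteq> 0" using that by simp
    then have "degree a2 \<noteq> d" "degree a2 \<noteq> d - 1" using c1 c2 by metis+
    then show ?thesis using \<open>degree a2 \<le> d\<close> by linarith
  qed
  then show ?thesis using that[of s a2] by (auto simp: a2_def \<alpha>_def)
qed

lemma sum_of_powers_coeff:
  fixes A B :: "complex poly"
  assumes "degree A \<le> L" "degree B \<le> L" "coeff A L = coeff B L" "d \<ge> 1"
  shows "coeff (\<Sum>i<d. A ^ i * B ^ (d - 1 - i)) ((d - 1) * L) = of_nat d * coeff A L ^ (d - 1)"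
    and "degree (\<Sum>i<d. A ^ i * B ^ (d - 1 - i)) \<le> (d - 1) * L"
proof -
  have *: "coeff (A ^ i * B ^ (d - 1 - i)) ((d - 1) * L) = coeff A L ^ (d - 1) \<and>
      degree (A ^ i * B ^ (d - 1 - i)) \<le> (d - 1) * L" if "i < d" for i
  proof -
    have e: "(d - 1) * L = i * L + (d - 1 - i) * L" using that by (simp flip: add_mult_distrib)
    have "coeff A L ^ (d - 1) = coeff A L ^ i * coeff A L ^ (d - 1 - i)"
      using that by (simp flip: power_add)
    then show ?thesis unfolding e
      using coeff_power_bound[OF assms(1), of i] coeff_power_bound[OF assms(2), of "d - 1 - i"]
        coeff_mult_bound[of "A ^ i" "i * L" "B ^ (d - 1 - i)" "(d - 1 - i) * L"]
        degree_mult_le[of "A ^ i" "B ^ (d - 1 - i)"] assms(3) by auto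
  qed
  show "coeff (\<Sum>i<d. A ^ i * B ^ (d - 1 - i)) ((d - 1) * L) = of_nat d * coeff A L ^ (d - 1)"
    using * by (simp add: coeff_sum)
  show "degree (\<Sum>i<d. A ^ i * B ^ (d - 1 - i)) \<le> (d - 1) * L"
    by (rule degree_sum_le) (use * in auto)
qed

text \<open>The cofactor of \<open>A - B\<close> in \<open>A^d - B^d\<close> has coefficient
  \<open>d c^(d-1)\<close> at index \<open>(d-1) L\<close>, with \<open>c\<close> the common
  coefficient of index \<open>L\<close>; it does not cancel, so the degree of \<open>A - B\<close>
  can be read off.\<close>

lemma power_diff_degree:
  fixes A B :: "complex poly"
  assumes "degree A \<le> L" "degree B \<le> L" "coeff A L = coeff B L" "coeff A L \<noteq> 0" "d \<ge> 1" "A \<noteq> B"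
  shows "degree (A ^ d - B ^ d) = degree (A - B) + (d - 1) * L" "A ^ d - B ^ d \<noteq> 0"
proof -
  define S where "S = (\<Sum>i<d. A ^ i * B ^ (d - 1 - i))"
  have "coeff S ((d - 1) * L) \<noteq> 0" "degree S \<le> (d - 1) * L"
    using sum_of_powers_coeff[OF assms(1-3,5)] assms(4,5) by (auto simp: S_def)
  then have S: "degree S = (d - 1) * L" "S \<noteq> 0" by (auto intro: le_antisym le_degree)
  have "A ^ d - B ^ d = (A - B) * S"
    unfolding S_def by (subst power_diff_sumr2) (simp add: mult.commute)
  then show "degree (A ^ d - B ^ d) = degree (A - B) + (d - 1) * L" "A ^ d - B ^ d \<noteq> 0"
    using S assms(6) by (simp_all add: degree_mult_eq)
qed

text \<open>The counterpart at 0: the cofactor of \<open>A - B\<close> takes the value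
  \<open>d c^(d-1)\<close> there, with \<open>c\<close> the common value of \<open>A\<close> and
  \<open>B\<close>, and is therefore coprime to the monomial.\<close>

lemma power_diff_dvd:
  fixes A B :: "complex poly"
  assumes "coeff A 0 = coeff B 0" "coeff A 0 \<noteq> 0" "d \<ge> 1" "monom 1 n dvd A ^ d - B ^ d"
  shows "monom 1 n dvd A - B"
proof -
  define S where "S = (\<Sum>i<d. A ^ i * B ^ (d - 1 - i))"
  have "poly S 0 = of_nat d * coeff A 0 ^ (d - 1)"
  proof -
    have "poly S 0 = (\<Sum>i<d. coeff A 0 ^ i * coeff A 0 ^ (d - 1 - i))"
      unfolding S_def poly_sum poly_mult poly_power using assms(1) by (simp add: poly_0_coeff_0)
    also have "\<dots> = (\<Sum>i<d. coeff A 0 ^ (d - 1))"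
      by (rule sum.cong) (auto simp flip: power_add)
    finally show ?thesis by simp
  qed
  then have "poly S 0 \<noteq> 0" using assms(2,3) by simp
  then have "coprime (monom 1 n) S"
    by (subst coprime_iff_no_common_root) (auto simp: poly_monom monom_eq_0_iff)
  moreover have "A ^ d - B ^ d = (A - B) * S"
    unfolding S_def by (subst power_diff_sumr2) (simp add: mult.commute)
  ultimately show ?thesis using assms(4) by (simp add: coprime_dvd_mult_left_iff)
qed

text \<open>The exponent \<open>m\<close> is chosen least, so for \<open>m > 0\<close> at least one
  of the two functions has a pole of order exactly \<open>m\<close> at 0.\<close>

lemma laurent_pair:
  assumes "p \<in> laurent_polys" "q \<in> laurent_polys"
  obtains P R m where "p = Fract P (monom 1 m)" "q = Fract R (monom 1 m)"
    "m > 0 \<Longrightarrow> coeff P 0 \<noteq> 0 \<or> coeff R 0 \<noteq> 0"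
proof -
  define T where "T m \<longleftrightarrow> (\<exists>P R. p = Fract P (monom 1 m) \<and> q = Fract R (monom 1 m))" for m
  obtain P n where P: "p = Fract P (monom 1 n)" using assms(1) by (rule laurentE)
  obtain R k where R: "q = Fract R (monom 1 k)" using assms(2) by (rule laurentE)
  have "p = Fract (P * monom 1 k) (monom 1 (n + k))" "q = Fract (R * monom 1 n) (monom 1 (n + k))"
    unfolding P R by (simp_all add: eq_fract monom_eq_0_iff mult_monom mult_ac add.commute)
  then have ex: "T (n + k)" unfolding T_def by blast
  define m where "m = (LEAST m. T m)"
  have "T m" unfolding m_def by (rule LeastI) (rule ex)
  then obtain P R where PR: "p = Fract P (monom 1 m)" "q = Fract R (monom 1 m)"
    unfolding T_def by blast
  have "coeff P 0 \<noteq> 0 \<or> coeff R 0 \<noteq> 0" if "m > 0"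
  proof (rule ccontr)
    assume "\<not> ?thesis"
    then obtain P' R' where "P = pCons 0 P'" "R = pCons 0 R'"
      by (metis coeff_pCons_0 pCons_cases)
    moreover obtain m' where m': "m = Suc m'" using \<open>m > 0\<close> by (cases m) auto
    ultimately have "p = Fract P' (monom 1 m')" "q = Fract R' (monom 1 m')"
      unfolding PR by (simp_all add: eq_fract monom_eq_0_iff monom_Suc)
    then have "T m'" unfolding T_def by blast
    then have "m \<le> m'" unfolding m_def by (rule Least_le)
    then show False using m' by simp
  qed
  then show ?thesis using that PR by blast
qed

text \<open>Both estimates come from the gap of two in \<open>complete_the_power\<close>:
  multiplication by \<open>x^(m d)\<close> leaves a spare factor \<open>x^(2m)\<close> at the rest,
  and its cofactor \<open>W\<close> has degree at most \<open>(d - 2) L\<close>.\<close>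

lemma cleared_evaluation:
  assumes a: "degree a = d" "d \<ge> 1" and p: "p = Fract P (monom 1 m)"
    and L: "degree P \<le> L" "m \<le> L"
  obtains s W where
    "to_fract (smult (lead_coeff a) ((P + smult s (monom 1 m)) ^ d) + monom 1 (2 * m) * W) =
       ratX ^ (m * d) * rc.peval a p"
    "W \<noteq> 0 \<Longrightarrow> 2 * L + degree W \<le> d * L"
proof -
  obtain s a2 where s: "a = smult (lead_coeff a) ([:s, 1:] ^ d) + a2" "a2 = 0 \<or> degree a2 + 2 \<le> d"
    using complete_the_power[OF a] by blast
  define W where "W = (if a2 = 0 then 0 else homog (d - 2) a2 P (monom 1 m))"
  have m0: "(monom 1 m :: complex poly) \<noteq> 0" by (simp add: monom_eq_0_iff)
  have Xm: "to_fract (monom 1 m) = ratX ^ m" by (simp add: to_fract_monom)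
  have W: "ratX ^ (2 * m) * to_fract W = ratX ^ (m * d) * rc.peval a2 p"
  proof (cases "a2 = 0")
    case False
    then have d2: "degree a2 \<le> d - 2" "d = 2 + (d - 2)" using s(2) by auto
    have "to_fract W = (ratX ^ m) ^ (d - 2) * rc.peval a2 p"
      using to_fract_homog[OF m0 d2(1), of P] False by (simp add: W_def p Xm)
    moreover have "ratX ^ (2 * m) * (ratX ^ m) ^ (d - 2) = ratX ^ (m * d)"
    proof -
      obtain d' where d': "d = d' + 2" using d2(2) by (metis add.commute)
      show ?thesis unfolding d' by (simp add: algebra_simps mult_2_right flip: power_mult power_add)
    qed
    ultimately show ?thesis by (simp only: mult.assoc[symmetric])
  qed (simp add: W_def)
  have P1: "to_fract (P + smult s (monom 1 m)) = ratX ^ m * (p + cst s)"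
    by (simp add: p Fract_conv_to_fract to_fract_smult Xm field_simps)
  have "to_fract (smult (lead_coeff a) ((P + smult s (monom 1 m)) ^ d) + monom 1 (2 * m) * W) =
      cst (lead_coeff a) * (ratX ^ m * (p + cst s)) ^ d + ratX ^ (2 * m) * to_fract W"
    by (simp add: to_fract_smult to_fract_power to_fract_monom flip: P1)
  also have "\<dots> = ratX ^ (m * d) * (cst (lead_coeff a) * (p + cst s) ^ d + rc.peval a2 p)"
    unfolding W power_mult[of ratX m d]
    by (subst power_mult_distrib) (simp only: distrib_left mult_ac)
  also have "cst (lead_coeff a) * (p + cst s) ^ d + rc.peval a2 p = rc.peval a p"
  proof -
    have "rc.peval a p = rc.peval (smult (lead_coeff a) ([:s, 1:] ^ d) + a2) p"
      using s(1) by (rule arg_cong)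
    then show ?thesis
      by (simp add: rc.peval_add rc.peval_smult rc.peval_power rc.peval_pCons add.commute)
  qed
  finally have eq: "to_fract (smult (lead_coeff a) ((P + smult s (monom 1 m)) ^ d) + monom 1 (2 * m) * W) =
       ratX ^ (m * d) * rc.peval a p" .
  have "2 * L + degree W \<le> d * L" if "W \<noteq> 0"
  proof -
    have d2: "degree a2 + 2 \<le> d" using s(2) that by (auto simp: W_def split: if_splits)
    have "degree W \<le> (d - 2) * L"
      using coeff_homog_top(2)[of P L "monom 1 m" "d - 2" a2] L
      by (auto simp: W_def degree_monom_eq)
    moreover have "2 * L + (d - 2) * L = d * L"
    proof -
      obtain d' where "d = 2 + d'" using d2 le_Suc_ex[of 2 d] by auto
      then show ?thesis by (simp add: algebra_simps)
    qed
    ultimately show ?thesis by linarith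
  qed
  then show ?thesis using that[OF eq] by blast
qed

lemma solve_linear:
  fixes p k Y :: "'a::field"
  assumes "k * (Y * (p + s)) = A - B * (Y * Y)" "k \<noteq> 0" "Y \<noteq> 0"
  shows "p = - (B / k) * Y + - s + A / k / Y"
proof -
  have "p + s = (k * (Y * (p + s))) / (k * Y)" using assms(2,3) by simp
  also have "\<dots> = A / k / Y - B / k * Y"
    unfolding assms(1) using assms(2,3) by (simp add: diff_divide_distrib)
  finally show ?thesis by (simp add: algebra_simps)
qed

text \<open>Write \<open>p = P / x^m\<close> and \<open>q = R / x^m\<close>. After completing the \<open>d\<close>-th powers, \<open>a(p) = b(q)\<close> says that
  \<open>P1^d - R1^d\<close> has small degree and is divisible by \<open>x^(2m)\<close>, where \<open>P1\<close> and \<open>R1\<close> are shifts of \<open>P\<close> and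
  \<open>R\<close>. So \<open>P1 - \<epsilon> R1\<close> has small degree and \<open>P1 - \<delta> R1\<close> is divisible by \<open>x^(2m)\<close>, for some \<open>d\<close>-th roots
  of unity \<open>\<epsilon>\<close> and \<open>\<delta>\<close>.\<close>

lemma equal_degree_dihedral:
  fixes a b :: "complex poly"
  assumes d: "degree a = d" "degree b = d" "d \<ge> 1"
    and pq: "p \<in> laurent_polys" "q \<in> laurent_polys" "nonconst p"
    and eq: "rc.peval a p = rc.peval b q"
  shows "(\<exists>\<alpha> \<beta>. \<alpha> \<noteq> 0 \<and> q = cst \<alpha> * p + cst \<beta>) \<or>
    (\<exists>n u v w u' v' w'. n \<ge> 1 \<and> u \<noteq> 0 \<and> w \<noteq> 0 \<and> u' \<noteq> 0 \<and> w' \<noteq> 0 \<and>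
       p = cst u * ratX ^ n + cst v + cst w / ratX ^ n \<and>
       q = cst u' * ratX ^ n + cst v' + cst w' / ratX ^ n)"
proof -
  obtain P R m where PR: "p = Fract P (monom 1 m)" "q = Fract R (monom 1 m)"
    and m: "m > 0 \<Longrightarrow> coeff P 0 \<noteq> 0 \<or> coeff R 0 \<noteq> 0"
    using laurent_pair[OF pq(1,2)] by metis
  define L where "L = max m (max (degree P) (degree R))"
  have L: "degree P \<le> L" "degree R \<le> L" "m \<le> L" by (auto simp: L_def)
  define \<alpha> \<beta> where "\<alpha> = lead_coeff a" and "\<beta> = lead_coeff b"
  have "a \<noteq> 0" "b \<noteq> 0" using d by auto
  then have nz: "\<alpha> \<noteq> 0" "\<beta> \<noteq> 0" by (simp_all add: \<alpha>_def \<beta>_def)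
  obtain s W where W: "to_fract (smult \<alpha> ((P + smult s (monom 1 m)) ^ d) + monom 1 (2 * m) * W) =
       ratX ^ (m * d) * rc.peval a p" "W \<noteq> 0 \<Longrightarrow> 2 * L + degree W \<le> d * L"
    using cleared_evaluation[OF d(1,3) PR(1) L(1,3)] unfolding \<alpha>_def by metis
  obtain t V where V: "to_fract (smult \<beta> ((R + smult t (monom 1 m)) ^ d) + monom 1 (2 * m) * V) =
       ratX ^ (m * d) * rc.peval b q" "V \<noteq> 0 \<Longrightarrow> 2 * L + degree V \<le> d * L"
    using cleared_evaluation[OF d(2,3) PR(2) L(2,3)] unfolding \<beta>_def by metis
  \<comment> \<open>Scaling by \<kappa> absorbs the ratio of the leading coefficients of
    \<open>b\<close> and \<open>a\<close>, so that a pure difference of \<open>d\<close>-th powers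
    remains.\<close>
  obtain \<kappa> where \<kappa>: "\<kappa> ^ d = \<beta> / \<alpha>" using complex_root_exists d(3) by (metis One_nat_def Suc_le_eq)
  then have \<kappa>0: "\<kappa> \<noteq> 0" using nz d(3) by (auto simp: power_0_left split: if_splits)
  define P1 where "P1 = P + smult s (monom 1 m)"
  define R1 where "R1 = smult \<kappa> (R + smult t (monom 1 m))"
  define U where "U = smult (1 / \<alpha>) (V - W)"
  have diff: "P1 ^ d - R1 ^ d = monom 1 (2 * m) * U"
  proof -
    have "smult \<alpha> (P1 ^ d) + monom 1 (2 * m) * W = smult \<beta> ((R + smult t (monom 1 m)) ^ d) + monom 1 (2 * m) * V"
      using W(1) V(1) eq unfolding P1_def by (metis to_fract_eq_iff)
    then have "smult \<alpha> (P1 ^ d) - smult \<beta> ((R + smult t (monom 1 m)) ^ d) = monom 1 (2 * m) * (V - W)"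
      by (simp add: algebra_simps)
    then have "smult (1 / \<alpha>) (smult \<alpha> (P1 ^ d) - smult \<beta> ((R + smult t (monom 1 m)) ^ d)) =
        smult (1 / \<alpha>) (monom 1 (2 * m) * (V - W))" by simp
    then show ?thesis
      using nz by (simp add: smult_diff_right R1_def U_def smult_power \<kappa> right_diff_distrib)
  qed
  have Udeg: "2 * L + degree U \<le> d * L" if "U \<noteq> 0"
  proof -
    have VW: "V \<noteq> 0 \<or> W \<noteq> 0" using that by (auto simp: U_def)
    have "degree U \<le> max (degree V) (degree W)"
      by (auto simp: U_def intro!: order.trans[OF degree_smult_le] degree_diff_le_max)
    then show ?thesis using V(2) W(2) VW by (cases "V = 0"; cases "W = 0") (auto simp: max_def split: if_splits)
  qed
  have degs: "degree P1 \<le> L" "degree R1 \<le> L"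
    using L by (auto simp: P1_def R1_def degree_monom_eq
      intro!: degree_add_le order.trans[OF degree_smult_le])
  have P1p: "to_fract P1 = ratX ^ m * (p + cst s)"
    by (simp add: P1_def PR Fract_conv_to_fract to_fract_smult to_fract_monom field_simps)
  have R1q: "to_fract R1 = cst \<kappa> * (ratX ^ m * (q + cst t))"
    by (simp add: R1_def PR Fract_conv_to_fract to_fract_smult to_fract_monom field_simps)
  have linear: ?thesis if "P1 = smult \<zeta> R1" "\<zeta> \<noteq> 0" for \<zeta>
  proof -
    have "ratX ^ m * (p + cst s) = cst \<zeta> * (cst \<kappa> * (ratX ^ m * (q + cst t)))"
      using that(1) by (simp add: to_fract_smult flip: P1p R1q)
    then have "ratX ^ m * (p + cst s) = ratX ^ m * (cst (\<zeta> * \<kappa>) * (q + cst t))"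
      by (simp only: rc.\<kappa>_mult mult_ac)
    then have "p + cst s = cst (\<zeta> * \<kappa>) * (q + cst t)" by simp
    then have "cst (1 / (\<zeta> * \<kappa>)) * (p + cst s) = (cst (1 / (\<zeta> * \<kappa>)) * cst (\<zeta> * \<kappa>)) * (q + cst t)"
      by (simp only: mult.assoc)
    also have "cst (1 / (\<zeta> * \<kappa>)) * cst (\<zeta> * \<kappa>) = 1"
      using that(2) \<kappa>0 by (simp only: rc.\<kappa>_mult[symmetric]) simp
    finally have "q = cst (1 / (\<zeta> * \<kappa>)) * p + cst (s / (\<zeta> * \<kappa>) - t)"
      using that(2) \<kappa>0 by (simp only: rc.\<kappa>_diff rc.\<kappa>_divide rc.\<kappa>_mult) (simp add: field_simps)
    then show ?thesis using that(2) \<kappa>0 by (metis divide_eq_0_iff mult_eq_0_iff zero_neq_one)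
  qed
  have topP1: "coeff P1 L = coeff P L" "coeff R1 L = \<kappa> * coeff R L" if "L > m"
    using that by (simp_all add: P1_def R1_def)
  have botP1: "coeff P1 0 = coeff P 0" "coeff R1 0 = \<kappa> * coeff R 0" if "m > 0"
    using that by (simp_all add: P1_def R1_def)
  have top_coeff: "coeff P L \<noteq> 0 \<or> coeff R L \<noteq> 0" if Lm: "L > m"
  proof (cases "L = degree P")
    case True then show ?thesis using Lm by (cases "P = 0") auto
  next
    case False
    then have "L = degree R" using Lm by (auto simp: L_def max_def split: if_splits)
    then show ?thesis using Lm by (cases "R = 0") auto
  qed
  have top_eq: "coeff P1 L ^ d = coeff R1 L ^ d" if "L > m"
  proof -
    have "coeff (P1 ^ d) (d * L) - coeff (R1 ^ d) (d * L) = coeff (monom 1 (2 * m) * U) (d * L)"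
      by (simp flip: diff)
    also have "\<dots> = 0"
    proof (cases "U = 0")
      case False
      then have "degree (monom 1 (2 * m) * U) = 2 * m + degree U"
        by (simp add: degree_mult_eq monom_eq_0_iff degree_monom_eq)
      then show ?thesis using Udeg[OF False] that by (intro coeff_eq_0) linarith
    qed simp
    finally show ?thesis using coeff_power_bound[OF degs(1), of d] coeff_power_bound[OF degs(2), of d] by simp
  qed
  have bot_eq: "coeff P1 0 ^ d = coeff R1 0 ^ d" if "m > 0"
  proof -
    have "poly (P1 ^ d - R1 ^ d) 0 = 0" unfolding diff using that by (simp add: poly_monom)
    then have "poly P1 0 ^ d = poly R1 0 ^ d" by (simp only: poly_diff poly_power right_minus_eq)
    then show ?thesis by (simp only: poly_0_coeff_0)
  qed
  \<comment> \<open>The difference of the \<open>d\<close>-th powers has degree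
    \<open>degree (P1 - \<epsilon> R1) + (d-1) L\<close>, and also \<open>2 m + degree U\<close>
    with \<open>2 L + degree U \<le> d L\<close>.\<close>
  have degree_eq: "degree (P1 - smult \<epsilon> R1) + L \<le> 2 * m"
    if \<epsilon>: "coeff P1 L = coeff (smult \<epsilon> R1) L" "coeff P1 L \<noteq> 0" "\<epsilon> ^ d = 1" "P1 \<noteq> smult \<epsilon> R1" for \<epsilon>
  proof -
    have "degree (smult \<epsilon> R1) \<le> L" using degs(2) degree_smult_le order.trans by blast
    note pd = power_diff_degree[OF degs(1) this \<epsilon>(1,2) d(3) \<epsilon>(4)]
    have e: "P1 ^ d - (smult \<epsilon> R1) ^ d = monom 1 (2 * m) * U"
      unfolding diff[symmetric] by (simp add: smult_power \<epsilon>(3))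
    have U0: "U \<noteq> 0" using pd(2) unfolding e by auto
    have "2 * m + degree U = degree (P1 - smult \<epsilon> R1) + (d - 1) * L"
      using pd(1) unfolding e by (simp add: degree_mult_eq monom_eq_0_iff degree_monom_eq U0)
    moreover have "d * L = L + (d - 1) * L" using d(3) by (cases d) auto
    ultimately show ?thesis using Udeg[OF U0] by linarith
  qed
  \<comment> \<open>For \<open>2 m < L\<close> the bound on
    \<open>degree (P1 - \<epsilon> R1)\<close> cannot be met, so the two are proportional.\<close>
  have top: ?thesis if Lm: "L > m" "2 * m < L"
  proof -
    from top_coeff[OF Lm(1)] have ne: "coeff R1 L \<noteq> 0" "coeff P1 L \<noteq> 0"
      using top_eq[OF Lm(1)] topP1[OF Lm(1)] \<kappa>0 d(3) by (auto simp: power_0_left)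
    define \<epsilon> where "\<epsilon> = coeff P1 L / coeff R1 L"
    have \<epsilon>: "\<epsilon> ^ d = 1" "\<epsilon> \<noteq> 0" using ne top_eq[OF Lm(1)] by (simp_all add: \<epsilon>_def power_divide)
    have "P1 = smult \<epsilon> R1"
    proof (rule ccontr)
      assume neq: "P1 \<noteq> smult \<epsilon> R1"
      have "coeff P1 L = coeff (smult \<epsilon> R1) L" using ne by (simp add: \<epsilon>_def)
      from degree_eq[OF this ne(2) \<epsilon>(1) neq] show False using Lm by linarith
    qed
    then show ?thesis using linear \<epsilon> by blast
  qed
  show ?thesis
  proof (cases "2 * m < L")
    case True
    then show ?thesis by (intro top) linarith+
  next
    case False
    have m0: "m > 0"
    proof (rule ccontr)
      assume "\<not> m > 0"
      then have "degree P = 0" "m = 0" using False L by auto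
      then obtain c where "P = [:c:]" by (metis degree_eq_zeroE)
      then have "p = cst c" using PR \<open>m = 0\<close> by (simp add: Fract_conv_to_fract to_fract_monom)
      then show False using pq(3) by (auto simp: rc.transc_def)
    qed
    have ne: "coeff R1 0 \<noteq> 0" "coeff P1 0 \<noteq> 0"
      using m[OF m0] bot_eq[OF m0] botP1[OF m0] \<kappa>0 d(3) by (auto simp: power_0_left)
    define \<delta> where "\<delta> = coeff P1 0 / coeff R1 0"
    have \<delta>: "\<delta> ^ d = 1" "\<delta> \<noteq> 0" using ne bot_eq[OF m0] by (simp_all add: \<delta>_def power_divide)
    have "monom 1 (2 * m) dvd P1 - smult \<delta> R1"
      by (rule power_diff_dvd[of _ _ d]) (use ne d(3) diff \<delta> in \<open>auto simp: \<delta>_def smult_power\<close>)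
    then obtain B where B: "P1 - smult \<delta> R1 = monom 1 (2 * m) * B" by blast
    show ?thesis
    proof (cases "B = 0")
      case True
      then show ?thesis using linear[of \<delta>] \<delta> B by simp
    next
      case B0: False
      have "degree (monom 1 (2 * m) * B) = 2 * m + degree B"
        using B0 by (simp add: degree_mult_eq monom_eq_0_iff degree_monom_eq)
      moreover have "degree (P1 - smult \<delta> R1) \<le> L"
        using degs by (intro degree_diff_le order.trans[OF degree_smult_le]) auto
      \<comment> \<open>Since \<open>L \<le> 2 m\<close> in this case, the multiple of
        \<open>x^(2m)\<close> shrinks to a single monomial.\<close>
      ultimately have L2: "L = 2 * m" and "degree B = 0" using False B by auto
      then obtain b where b: "B = [:b:]" by (metis degree_eq_zeroE)
      have bm: "P1 - smult \<delta> R1 = monom b (2 * m)"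
        unfolding B b by (simp add: smult_monom)
      have Lm: "L > m" using L2 m0 by simp
      from top_coeff[OF Lm] have neL: "coeff R1 L \<noteq> 0" "coeff P1 L \<noteq> 0"
        using top_eq[OF Lm(1)] topP1[OF Lm(1)] \<kappa>0 d(3) by (auto simp: power_0_left)
      define \<epsilon> where "\<epsilon> = coeff P1 L / coeff R1 L"
      have \<epsilon>: "\<epsilon> ^ d = 1" "\<epsilon> \<noteq> 0" using neL top_eq[OF Lm] by (simp_all add: \<epsilon>_def power_divide)
      show ?thesis
      proof (cases "P1 = smult \<epsilon> R1")
        case True
        then show ?thesis using linear \<epsilon> by blast
      next
        case neq: False
        have "coeff P1 L = coeff (smult \<epsilon> R1) L" using neL by (simp add: \<epsilon>_def)
        from degree_eq[OF this neL(2) \<epsilon>(1) neq]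
        have "degree (P1 - smult \<epsilon> R1) = 0" using L2 by linarith
        then obtain c where c: "P1 - smult \<epsilon> R1 = [:c:]" by (metis degree_eq_zeroE)
        have c0: "c \<noteq> 0" using neq c by auto
        have b0: "b \<noteq> 0" using B0 b by auto
        have \<epsilon>\<delta>: "\<delta> - \<epsilon> \<noteq> 0"
        proof
          assume "\<delta> - \<epsilon> = 0"
          then have "[:c:] = monom b (2 * m)" using c bm by simp
          then have "coeff [:c:] 0 = coeff (monom b (2 * m)) 0" by simp
          then show False using c0 m0 by simp
        qed
        \<comment> \<open>\<open>P1 - \<delta> R1 = b x^(2m)\<close> and
          \<open>P1 - \<epsilon> R1 = c\<close> are two independent linear equations. Solving them
          and dividing by \<open>x^m\<close> leaves only the powers \<open>x^m\<close>, 1 and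
          \<open>x^(-m)\<close>.\<close>
        have R1: "smult (\<delta> - \<epsilon>) R1 = [:c:] - monom b (2 * m)"
          by (simp add: smult_diff_left flip: c bm)
        have P1: "smult (\<delta> - \<epsilon>) P1 = smult \<delta> [:c:] - smult \<epsilon> (monom b (2 * m))"
          by (simp only: flip: c bm) (simp add: smult_diff_left smult_diff_right mult.commute)
        have X2: "ratX ^ (2 * m) = ratX ^ m * ratX ^ m" by (simp flip: power_add add: mult_2)
        define \<theta> where "\<theta> = \<delta> - \<epsilon>"
        have "cst \<theta> * to_fract P1 = cst (\<delta> * c) - cst (\<epsilon> * b) * ratX ^ (2 * m)"
          using arg_cong[OF P1, of to_fract]
          by (simp add: to_fract_smult to_fract_monom smult_monom \<theta>_def)
        then have "cst \<theta> * (ratX ^ m * (p + cst s)) = cst (\<delta> * c) - cst (\<epsilon> * b) * (ratX ^ m * ratX ^ m)"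
          unfolding P1p X2 .
        then have pe: "p = cst (- (\<epsilon> * b / \<theta>)) * ratX ^ m + cst (- s) + cst (\<delta> * c / \<theta>) / ratX ^ m"
          using \<epsilon>\<delta> unfolding \<theta>_def[symmetric] rc.\<kappa>_minus rc.\<kappa>_divide
          by (intro solve_linear) simp_all
        have "cst \<theta> * to_fract R1 = cst c - cst b * ratX ^ (2 * m)"
          using arg_cong[OF R1, of to_fract]
          by (simp add: to_fract_smult to_fract_monom smult_monom \<theta>_def)
        then have "cst \<theta> * (cst \<kappa> * (ratX ^ m * (q + cst t))) = cst c - cst b * (ratX ^ m * ratX ^ m)"
          unfolding R1q X2 .
        then have qe: "q = cst (- (b / (\<theta> * \<kappa>))) * ratX ^ m + cst (- t) + cst (c / (\<theta> * \<kappa>)) / ratX ^ m"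
          using \<epsilon>\<delta> \<kappa>0 unfolding \<theta>_def[symmetric] rc.\<kappa>_minus rc.\<kappa>_divide rc.\<kappa>_mult
          by (intro solve_linear) (simp_all add: mult.assoc)
        have "m \<ge> 1" "- (\<epsilon> * b / \<theta>) \<noteq> 0" "\<delta> * c / \<theta> \<noteq> 0" "- (b / (\<theta> * \<kappa>)) \<noteq> 0" "c / (\<theta> * \<kappa>) \<noteq> 0"
          using m0 \<epsilon>(2) \<delta>(2) b0 c0 \<epsilon>\<delta> \<kappa>0 by (auto simp: \<theta>_def)
        then show ?thesis using pe qe by blast
      qed
    qed
  qed
qed

section \<open>Branches at infinity\<close>

interpretation ser: complex_embedding "fls_const :: complex \<Rightarrow> complex fls"
  by unfold_locales (simp_all add: fls_plus_const fls_const_mult_const)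

lemma (in complex_embedding) peval_reflect_poly:
  assumes "s \<noteq> 0"
  shows "peval (reflect_poly p) s = s ^ degree p * peval p (inverse s)"
proof (cases "p = 0")
  case False
  have "peval (reflect_poly p) s = (\<Sum>i\<le>degree p. \<kappa> (coeff (reflect_poly p) i) * s ^ i)"
    unfolding peval_altdef
    by (rule sum.mono_neutral_left) (auto simp: coeff_eq_0 degree_reflect_poly_le)
  also have "\<dots> = (\<Sum>i\<le>degree p. \<kappa> (coeff p (degree p - i)) * s ^ i)"
    by (rule sum.cong) (auto simp: coeff_reflect_poly)
  also have "\<dots> = (\<Sum>i\<le>degree p. \<kappa> (coeff p i) * s ^ (degree p - i))"
    by (rule sum.reindex_bij_witness[of _ "\<lambda>i. degree p - i" "\<lambda>i. degree p - i"]) auto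
  also have "\<dots> = s ^ degree p * peval p (inverse s)"
    unfolding peval_altdef sum_distrib_left
  proof (rule sum.cong[OF refl])
    fix i assume "i \<in> {..degree p}"
    then have "s ^ degree p = s ^ (degree p - i) * s ^ i" by (simp flip: power_add)
    then show "\<kappa> (coeff p i) * s ^ (degree p - i) = s ^ degree p * (\<kappa> (coeff p i) * inverse s ^ i)"
      using assms by (simp add: power_inverse)
  qed
  finally show ?thesis .
qed simp

lemma fps_of_poly_compose_eq_peval:
  assumes "fps_nth s 0 = 0"
  shows "fps_to_fls (fps_of_poly c oo s) = ser.peval c (fps_to_fls s)"
proof (induction c)
  case (pCons a c)
  have "fps_of_poly (pCons a c) oo s = fps_const a + s * (fps_of_poly c oo s)"
    by (simp add: fps_of_poly_pCons fps_compose_add_distrib fps_compose_mult_distrib assms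
        fps_X_fps_compose_startby0 mult.commute)
  then show ?case
    using pCons by (simp add: ser.peval_pCons fls_times_fps_to_fls)
qed simp

text \<open>Here \<open>fls_X\<close> is \<open>1 / z\<close>, and \<open>1 / s = c z + \<dots>\<close> is a solution \<open>Y\<close> of \<open>a(Y) = z^A\<close>.\<close>

lemma branch_at_infinity:
  fixes a :: "complex poly"
  assumes A: "degree a = A" "A \<ge> 1"
  obtains s where "fps_nth s 0 = 0" "fps_nth s 1 \<noteq> 0"
    "ser.peval a (inverse (fps_to_fls s)) = inverse (fls_X ^ A)"
proof -
  define C where "C = fps_of_poly (reflect_poly a)"
  have "a \<noteq> 0" using A by auto
  then have C0: "fps_nth C 0 \<noteq> 0" by (simp add: C_def)
  define root :: "nat \<Rightarrow> complex \<Rightarrow> complex" where "root k x = (SOME z. z ^ k = x)" for k x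
  obtain k where k: "A = Suc k" using A(2) by (cases A) auto
  have "root (Suc k) x ^ Suc k = x" for x
    unfolding root_def by (rule someI_ex) (use complex_root_exists[of "Suc k" x] in auto)
  then have R: "fps_radical root (Suc k) C ^ Suc k = C"
    using power_radical[OF C0, of root k] by blast
  define R where "R = fps_radical root (Suc k) C"
  have RA: "R ^ A = C" unfolding R_def k by (rule R)
  then have R0: "fps_nth R 0 \<noteq> 0" using C0 A(2) by (auto simp flip: RA simp: fps_nth_power_0)
  \<comment> \<open>With \<open>C = R^A\<close> the equation for the branch reads
    \<open>s^A = X^A R(s)^A\<close>. It follows from \<open>s / R(s) = X\<close>, which says that
    \<open>s\<close> is the compositional inverse of \<open>W\<close>.\<close>
  define W where "W = fps_X * inverse R"
  have W: "fps_nth W 0 = 0" "fps_nth W 1 \<noteq> 0" using R0 by (simp_all add: W_def)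
  define s where "s = fps_inv W"
  have Ws: "W oo s = fps_X" unfolding s_def by (rule fps_inv_right[OF W])
  have s0: "fps_nth s 0 = 0" by (simp add: s_def fps_inv_def)
  have s1: "fps_nth s 1 \<noteq> 0" using W by (simp add: s_def fps_inv_def)
  have "W ^ A * C = fps_X ^ A"
  proof -
    have "(W * R) = fps_X" using R0 by (simp add: W_def mult.assoc inverse_mult_eq_1)
    then show ?thesis by (simp flip: RA power_mult_distrib)
  qed
  then have "(W ^ A * C) oo s = fps_X ^ A oo s" by simp
  then have "(W oo s) ^ A * (C oo s) = (fps_X oo s) ^ A"
    by (simp add: fps_compose_mult_distrib[OF s0] fps_compose_power[OF s0])
  then have "fps_X ^ A * (C oo s) = s ^ A"
    by (simp add: Ws fps_X_fps_compose_startby0[OF s0])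
  then have "fps_to_fls (fps_X ^ A * (C oo s)) = fps_to_fls (s ^ A)" by simp
  then have eq: "fls_X ^ A * ser.peval (reflect_poly a) (fps_to_fls s) = fps_to_fls s ^ A"
    by (simp add: fls_times_fps_to_fls fps_to_fls_power C_def fps_of_poly_compose_eq_peval[OF s0])
  have S0: "fps_to_fls s \<noteq> 0" using s1 by auto
  have "fls_X ^ A * (fps_to_fls s ^ A * ser.peval a (inverse (fps_to_fls s))) = fps_to_fls s ^ A"
    using eq by (simp add: ser.peval_reflect_poly[OF S0] A(1))
  then have "fps_to_fls s ^ A * (fls_X ^ A * ser.peval a (inverse (fps_to_fls s))) = fps_to_fls s ^ A * 1"
    by (simp add: mult_ac)
  then have "fls_X ^ A * ser.peval a (inverse (fps_to_fls s)) = 1"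
    using S0 by (subst (asm) mult_cancel_left) auto
  then have "ser.peval a (inverse (fps_to_fls s)) = inverse (fls_X ^ A)"
    by (metis inverse_unique)
  then show ?thesis using that s0 s1 by blast
qed

lemma peval_fls_compose:
  assumes "H \<noteq> 0" "fps_nth H 0 = 0"
  shows "ser.peval p (fls_compose_fps x H) = fls_compose_fps (ser.peval p x) H"
  by (induction p) (simp_all add: ser.peval_pCons fls_compose_fps_add fls_compose_fps_mult assms)

lemma subfield_range_fls_compose:
  assumes "H \<noteq> 0" "fps_nth H 0 = 0"
  shows "is_subfield (range (\<lambda>F :: complex fls. fls_compose_fps F H))"
  unfolding is_subfield_def
proof (intro conjI ballI)
  let ?K = "range (\<lambda>F :: complex fls. fls_compose_fps F H)"
  show "0 \<in> ?K" "1 \<in> ?K"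
    using rangeI[of "\<lambda>F. fls_compose_fps F H" 0] rangeI[of "\<lambda>F. fls_compose_fps F H" 1] by simp_all
  fix x assume "x \<in> ?K"
  then obtain F where F: "x = fls_compose_fps F H" by blast
  have "- x = fls_compose_fps (- F) H" "inverse x = fls_compose_fps (inverse F) H"
    by (simp_all add: F fls_compose_fps_inverse assms)
  then show "- x \<in> ?K" "inverse x \<in> ?K" by blast+
  fix y assume "y \<in> ?K"
  then obtain G where G: "y = fls_compose_fps G H" by blast
  have "x + y = fls_compose_fps (F + G) H" "x * y = fls_compose_fps (F * G) H"
    by (simp_all add: F G fls_compose_fps_add fls_compose_fps_mult assms)
  then show "x + y \<in> ?K" "x * y \<in> ?K" by blast+
qed

lemma fls_subdegree_compose:
  assumes "H \<noteq> 0" "fps_nth H 0 = 0"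
  shows "fls_subdegree (fls_compose_fps F H) = fls_subdegree F * int (subdegree H)"
proof (cases "F = 0")
  case False
  have "fps_nth (fls_base_factor_to_fps F) 0 \<noteq> 0" using False by simp
  then have nz: "fls_base_factor_to_fps F \<noteq> 0" "subdegree (fls_base_factor_to_fps F) = 0"
    by (metis fps_zero_nth, metis subdegree_eq_0)
  then have "fls_base_factor_to_fps F oo H \<noteq> 0"
    using assms by (simp only: fps_compose_eq_0_iff) auto
  then show ?thesis
    unfolding fls_compose_fps_def using assms nz(2)
    by (subst fls_subdegree_mult) (auto simp: fls_subdegree_fls_to_fps)
qed simp

text \<open>By unique factorisation \<Phi> is, up to a constant, a product of some of the linear
  factors, and each of these has its coefficients in \<open>K\<close>.\<close>

lemma linear_factors_in_subfield:
  fixes T :: "'e::field set"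
  assumes K: "is_subfield K" and fin: "finite T" "T \<subseteq> K"
    and dvd: "\<Phi> dvd smult c (\<Prod>y\<in>T. [:-y, 1:])" and c: "c \<noteq> 0"
  shows "\<exists>u M. u \<noteq> 0 \<and> \<Phi> = smult u M \<and> lead_coeff M = 1 \<and> (\<forall>i. coeff M i \<in> K)"
  using fin dvd
proof (induction T arbitrary: \<Phi> rule: finite_induct)
  case empty
  then have "\<Phi> dvd [:c:]" by simp
  then have "degree \<Phi> = 0" using c by (metis dvd_imp_degree_le degree_pCons_0 le_zero_eq pCons_eq_0_iff)
  then obtain u where u: "\<Phi> = [:u:]" by (metis degree_eq_zeroE)
  then have "u \<noteq> 0" using \<open>\<Phi> dvd [:c:]\<close> c by auto
  then show ?case
    using is_subfieldD(1,2)[OF K] by (intro exI[of _ u] exI[of _ 1]) (auto simp: u coeff_pCons one_pCons split: nat.splits)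
next
  case (insert y T)
  have dvd: "\<Phi> dvd [:-y, 1:] * smult c (\<Prod>y\<in>T. [:-y, 1:])"
    using insert.prems(2) insert.hyps by simp
  show ?case
  proof (cases "poly \<Phi> y = 0")
    case True
    then obtain \<Psi> where \<Psi>: "\<Phi> = [:-y, 1:] * \<Psi>" by (auto simp: poly_eq_0_iff_dvd)
    then have "\<Psi> dvd smult c (\<Prod>y\<in>T. [:-y, 1:])" using dvd by (simp only: dvd_mult_cancel_left) auto
    then obtain u M where M: "u \<noteq> 0" "\<Psi> = smult u M" "lead_coeff M = 1" "\<And>i. coeff M i \<in> K"
      using insert.IH insert.prems by blast
    have "coeff ([:-y, 1:] * M) i \<in> K" for i
      using M(4) insert.prems(1) is_subfieldD(1)[OF K]
      by (cases i) (auto simp: mult_pCons_left coeff_pCons intro!: is_subfieldD[OF K])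
    moreover have "lead_coeff ([:-y, 1:] * M) = 1" using M(3) by (simp only: lead_coeff_mult) simp
    moreover have "\<Phi> = smult u ([:-y, 1:] * M)" using M(2) \<Psi> by simp
    ultimately show ?thesis using M(1) by blast
  next
    case False
    from dvd obtain \<Theta> where \<Theta>: "[:-y, 1:] * smult c (\<Prod>y\<in>T. [:-y, 1:]) = \<Phi> * \<Theta>" by blast
    have "poly ([:-y, 1:] * smult c (\<Prod>y\<in>T. [:-y, 1:])) y = 0" by simp
    then have "poly \<Phi> y * poly \<Theta> y = 0" unfolding \<Theta> by simp
    then have "poly \<Theta> y = 0" using False by simp
    then obtain \<Theta>' where "\<Theta> = [:-y, 1:] * \<Theta>'" by (auto simp: poly_eq_0_iff_dvd)
    then have "[:-y, 1:] * smult c (\<Prod>y\<in>T. [:-y, 1:]) = [:-y, 1:] * (\<Phi> * \<Theta>')"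
      using \<Theta> by (simp only: mult_ac)
    then have "smult c (\<Prod>y\<in>T. [:-y, 1:]) = \<Phi> * \<Theta>'" by (subst (asm) mult_cancel_left) auto
    then show ?thesis using insert.IH insert.prems by auto
  qed
qed

lemma poly_eq_prod_linear:
  fixes f :: "'e::field poly"
  assumes "finite T" "\<And>y. y \<in> T \<Longrightarrow> poly f y = 0" "degree f = card T" "f \<noteq> 0"
  shows "f = smult (lead_coeff f) (\<Prod>y\<in>T. [:-y, 1:])"
proof -
  have "(\<Prod>y\<in>T. [:-y, 1:]) dvd f"
    using assms(1,2)
  proof (induction T arbitrary: f rule: finite_induct)
    case (insert y T)
    then have "poly f y = 0" by simp
    then obtain g where g: "f = [:-y, 1:] * g" unfolding poly_eq_0_iff_dvd by blast
    have "poly g x = 0" if "x \<in> T" for x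
      using insert.prems[of x] insert.hyps(2) that by (auto simp: g)
    then have "(\<Prod>y\<in>T. [:-y, 1:]) dvd g" by (rule insert.IH)
    then show ?case using insert.hyps by (simp add: g mult_dvd_mono del: mult_pCons_left)
  qed simp
  then obtain g where g: "f = (\<Prod>y\<in>T. [:-y, 1:]) * g" by blast
  have deg: "degree (\<Prod>y\<in>T. [:-y, 1:]) = card T"
    by (subst degree_prod_eq_sum_degree) auto
  have "g \<noteq> 0" "(\<Prod>y\<in>T. [:-y, 1:]) \<noteq> 0" using g assms(4) by auto
  then have "degree g = 0" using assms(3) deg by (subst (asm) g) (simp add: degree_mult_eq)
  then obtain c where c: "g = [:c:]" by (metis degree_eq_zeroE)
  have "lead_coeff (\<Prod>y\<in>T. [:-y, 1:]) = 1" by (simp add: lead_coeff_prod)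
  then have "lead_coeff f = c"
    using lead_coeff_mult[of "\<Prod>y\<in>T. [:-y, 1:]" g] unfolding g[symmetric] by (simp add: c)
  moreover have "f = smult c (\<Prod>y\<in>T. [:-y, 1:])" using g c by simp
  ultimately show ?thesis by metis
qed

lemma map_poly_peval_mult:
  "map_poly (\<lambda>c. ser.peval c x) (M * N) = map_poly (\<lambda>c. ser.peval c x) M * map_poly (\<lambda>c. ser.peval c x) N"
  by (rule poly_eqI) (simp add: coeff_map_poly coeff_mult ser.peval_sum ser.peval_mult)

text \<open>Over \<open>\<complex>((1/z))\<close> with \<open>u = z^(A B')\<close>, where \<open>A' = A / gcd A B\<close> and \<open>B' = B / gcd A B\<close>, the roots of
  \<open>b(Y) = u\<close> are Laurent series in \<open>z^A'\<close>, hence so are the coefficients of every factor of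
  \<open>b(Y) - a(x)\<close> at a root \<open>x\<close> of \<open>a(x) = u\<close>. But \<open>x\<close> has order \<open>B'\<close>.\<close>

lemma factor_coefficients_generate:
  fixes a b :: "complex poly"
  assumes A: "degree a = A" "A \<ge> 1" and B: "degree b = B" "B \<ge> 1"
    and fac: "lift_poly b - [:a:] = \<Phi> * \<Psi>"
    and gen: "ratX \<in> gen_field (insert (to_fract a) (range (\<lambda>k. to_fract (coeff \<Phi> k))))"
  shows "A dvd B"
proof -
  define e where "e = gcd A B"
  obtain A' B' where AB: "A = A' * e" "B = B' * e" "coprime A' B'"
    unfolding e_def using gcd_coprime_exists[of A B] A(2) by auto
  have pos: "A' \<ge> 1" "B' \<ge> 1" "e \<ge> 1"
    using A(2) B(2) by (auto simp: AB Suc_le_eq intro!: Nat.gr0I)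
  have ABe: "A * B' = A' * B" by (simp add: AB)
  obtain sa where sa: "fps_nth sa 0 = 0" "fps_nth sa 1 \<noteq> 0"
    "ser.peval a (inverse (fps_to_fls sa)) = inverse (fls_X ^ A)"
    using branch_at_infinity[OF A] by metis
  obtain sb where sb: "fps_nth sb 0 = 0" "fps_nth sb 1 \<noteq> 0"
    "ser.peval b (inverse (fps_to_fls sb)) = inverse (fls_X ^ B)"
    using branch_at_infinity[OF B] by metis
  define Hm :: "complex \<Rightarrow> nat \<Rightarrow> complex fps" where "Hm c n = fps_const c * fps_X ^ n" for c n
  have Hm: "Hm c n \<noteq> 0" "fps_nth (Hm c n) 0 = 0" "subdegree (Hm c n) = n" if "c \<noteq> 0" "n \<ge> 1" for c n
    using that by (auto simp: Hm_def fps_nth_power_0)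
  have HmX: "fls_compose_fps (inverse (fls_X ^ k)) (Hm c n) = inverse (fls_const (c ^ k) * fls_X ^ (n * k))"
    if "c \<noteq> 0" "n \<ge> 1" for c n k
  proof -
    have "fps_to_fls (Hm c n) = fls_const c * fls_X ^ n"
      by (simp add: Hm_def fls_times_fps_to_fls fps_to_fls_power)
    then show ?thesis
      using Hm[OF that] by (simp add: fls_compose_fps_inverse fls_compose_fps_power power_mult_distrib
          power_mult ser.\<kappa>_power)
  qed
  \<comment> \<open>Substituting \<open>X^B'\<close> into one branch and \<open>z X^A'\<close> into
    the other gives both \<open>a(x)\<close> and \<open>b(y z)\<close> the value \<open>u\<close>,
    because \<open>A * B' = A' * B\<close>. The \<open>B\<close>-th roots of unity \<open>z\<close>
    provide all roots of \<open>b(Y) = u\<close>.\<close>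
  define x where "x = fls_compose_fps (inverse (fps_to_fls sa)) (Hm 1 B')"
  define y where "y z = fls_compose_fps (inverse (fps_to_fls sb)) (Hm z A')" for z
  define u :: "complex fls" where "u = inverse (fls_X ^ (A * B'))"
  have ax: "ser.peval a x = u"
    unfolding x_def u_def using pos
    by (simp add: peval_fls_compose Hm sa(3) HmX mult.commute)
  define Z where "Z = {z::complex. z ^ B = 1}"
  have Z: "finite Z" "card Z = B" "0 \<notin> Z"
    using B(2) by (auto simp: Z_def card_roots_unity_eq power_0_left intro: finite_roots_unity)
  have b_root: "ser.peval b (y z) = u" if "z \<in> Z" for z
  proof -
    have z: "z \<noteq> 0" "z ^ B = 1" using that Z(3) by (auto simp: Z_def)
    then show ?thesis
      unfolding y_def u_def ABe using pos by (simp add: peval_fls_compose Hm sb(3) HmX)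
  qed
  define K where "K = range (\<lambda>F :: complex fls. fls_compose_fps F (Hm 1 A'))"
  have K: "is_subfield K"
    unfolding K_def by (rule subfield_range_fls_compose) (use pos in \<open>simp_all add: Hm\<close>)
  have constK: "range fls_const \<subseteq> K"
  proof
    fix w :: "complex fls" assume "w \<in> range fls_const"
    then obtain c where "w = fls_compose_fps (fls_const c) (Hm 1 A')" by auto
    then show "w \<in> K" unfolding K_def by blast
  qed
  have yK: "y z \<in> K" if "z \<in> Z" for z
  proof -
    have z: "z \<noteq> 0" using that Z(3) by auto
    have "Hm z 1 oo Hm 1 A' = Hm z A'"
      using Hm[of 1 A'] pos by (simp add: Hm_def fps_compose_mult_distrib fps_nth_power_0 fps_X_fps_compose_startby0)
    then have "y z = fls_compose_fps (fls_compose_fps (inverse (fps_to_fls sb)) (Hm z 1)) (Hm 1 A')"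
      unfolding y_def using Hm[of 1 A'] Hm[of z 1] z pos by (simp add: fls_compose_fps_assoc)
    then show ?thesis unfolding K_def by blast
  qed
  have inj: "inj_on y Z"
  proof (rule inj_onI)
    fix z w assume zw: "z \<in> Z" "w \<in> Z" "y z = y w"
    then have nz: "z \<noteq> 0" "w \<noteq> 0" using Z(3) by auto
    have yz: "y v = inverse (fps_to_fls (sb oo Hm v A'))" if "v \<noteq> 0" for v
      unfolding y_def using Hm[of v A'] that pos by (simp add: fls_compose_fps_inverse)
    have "sb oo Hm z A' = sb oo Hm w A'"
      using zw(3) by (simp add: yz nz)
    then have "fps_inv sb oo (sb oo Hm z A') = fps_inv sb oo (sb oo Hm w A')" by simp
    then have "(fps_inv sb oo sb) oo Hm z A' = (fps_inv sb oo sb) oo Hm w A'"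
      using Hm nz pos sb(1) by (simp add: fps_compose_assoc)
    then have "Hm z A' = Hm w A'"
      using fps_inv[OF sb(1,2)] Hm nz pos by (simp add: fps_X_fps_compose_startby0)
    then have "fps_nth (Hm z A') A' = fps_nth (Hm w A') A'" by simp
    then show "z = w" by (simp add: Hm_def)
  qed
  define ev where "ev M = map_poly (\<lambda>c. ser.peval c x) M" for M
  have cev: "coeff (ev M) i = ser.peval (coeff M i) x" for M i by (simp add: ev_def coeff_map_poly)
  have evF: "ev (lift_poly b - [:a:]) = map_poly fls_const b - [:u:]"
    by (rule poly_eqI) (simp add: cev coeff_map_poly coeff_pCons ser.peval_diff ax split: nat.splits)
  have cevF: "coeff (map_poly fls_const b - [:u:]) i = fls_const (coeff b i) - (if i = 0 then u else 0)" for i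
    by (simp add: coeff_map_poly coeff_pCons split: nat.splits)
  have lcF: "coeff (map_poly fls_const b - [:u:]) B = fls_const (lead_coeff b)"
    using B unfolding cevF by simp
  have b0: "b \<noteq> 0" using B by auto
  have degF: "degree (map_poly fls_const b - [:u:]) = B"
  proof (rule antisym)
    show "degree (map_poly fls_const b - [:u:]) \<le> B"
    proof (rule degree_le, intro allI impI)
      fix i assume "B < i"
      then show "coeff (map_poly fls_const b - [:u:]) i = 0"
        unfolding cevF using B by (simp add: coeff_eq_0)
    qed
    show "B \<le> degree (map_poly fls_const b - [:u:])"
      by (rule le_degree) (use b0 in \<open>simp only: lcF ser.\<kappa>_eq_0 leading_coeff_0_iff not_False_eq_True\<close>)
  qed
  have F0: "map_poly fls_const b - [:u:] \<noteq> 0" using degF B(2) by auto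
  have "map_poly fls_const b - [:u:] =
      smult (lead_coeff (map_poly fls_const b - [:u:])) (\<Prod>y\<in>y ` Z. [:-y, 1:])"
  proof (rule poly_eq_prod_linear)
    show "poly (map_poly fls_const b - [:u:]) v = 0" if "v \<in> y ` Z" for v
      using that b_root by (auto simp: ser.peval_def)
    show "degree (map_poly fls_const b - [:u:]) = card (y ` Z)"
      using degF Z(2) card_image[OF inj] by simp
  qed (use Z(1) F0 in auto)
  moreover have "ev \<Phi> dvd map_poly fls_const b - [:u:]"
    unfolding evF[symmetric] fac ev_def map_poly_peval_mult by simp
  ultimately have "ev \<Phi> dvd smult (lead_coeff (map_poly fls_const b - [:u:])) (\<Prod>y\<in>y ` Z. [:-y, 1:])"
    by simp
  moreover have yZ: "y ` Z \<subseteq> K" using yK by blast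
  moreover have lc0: "lead_coeff (map_poly fls_const b - [:u:]) \<noteq> 0"
    using F0 by (simp only: leading_coeff_0_iff not_False_eq_True)
  ultimately obtain c M where M: "c \<noteq> 0" "ev \<Phi> = smult c M" "lead_coeff M = 1" "\<And>i. coeff M i \<in> K"
    using linear_factors_in_subfield[OF K finite_imageI[OF Z(1)] yZ _ lc0] by metis
  \<comment> \<open>The leading coefficients of \<Phi> and \<Psi> multiply to the constant leading
    coefficient of \<open>b\<close>, so they are constants, and the scalar \<open>c\<close> with
    them.\<close>
  have cK: "c \<in> K"
  proof -
    have "lift_poly b - [:a:] \<noteq> 0" using evF F0 by (auto simp: ev_def)
    then have nz: "\<Phi> \<noteq> 0" "\<Psi> \<noteq> 0" using fac by auto
    have cF: "coeff (lift_poly b - [:a:]) i = [:coeff b i:] - (if i = 0 then a else 0)" for i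
      by (simp add: coeff_pCons split: nat.splits)
    have "degree (lift_poly b - [:a:]) = B"
    proof (rule antisym)
      show "degree (lift_poly b - [:a:]) \<le> B"
      proof (rule degree_le, intro allI impI)
        fix i assume "B < i"
        then show "coeff (lift_poly b - [:a:]) i = 0" unfolding cF using B by (simp add: coeff_eq_0)
      qed
      have "coeff b B \<noteq> 0" using b0 B(1) by (metis leading_coeff_0_iff)
      then have "coeff (lift_poly b - [:a:]) B \<noteq> 0" unfolding cF using B(2) by simp
      then show "B \<le> degree (lift_poly b - [:a:])" by (rule le_degree)
    qed
    then have "lead_coeff (lift_poly b - [:a:]) = [:lead_coeff b:]"
      unfolding cF using B by simp
    then have "lead_coeff \<Phi> * lead_coeff \<Psi> = [:lead_coeff b:]" by (simp add: fac lead_coeff_mult)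
    then have "degree (lead_coeff \<Phi> * lead_coeff \<Psi>) = 0" by simp
    then have "degree (lead_coeff \<Phi>) = 0" using nz by (simp add: degree_mult_eq)
    then obtain l where l: "lead_coeff \<Phi> = [:l:]" by (metis degree_eq_zeroE)
    then have l0: "l \<noteq> 0" using nz by (metis leading_coeff_0_iff pCons_0_0)
    have "coeff (ev \<Phi>) (degree \<Phi>) = fls_const l" by (simp add: cev l)
    moreover have "degree (ev \<Phi>) \<le> degree \<Phi>" unfolding ev_def by (rule map_poly_degree_leq)
    ultimately have "lead_coeff (ev \<Phi>) = fls_const l"
      using l0 by (metis le_antisym le_degree ser.\<kappa>_eq_0)
    then have "c = fls_const l" using M(1,2,3) by simp
    then show ?thesis using constK by auto
  qed
  have Xdeg: "fls_subdegree x = - int B'"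
  proof -
    have "subdegree sa = 1" using sa by (intro subdegreeI) (auto simp: less_Suc_eq_0_disj)
    then show ?thesis
      unfolding x_def using pos Hm[of 1 B'] by (simp add: fls_subdegree_compose fls_subdegree_fls_to_fps)
  qed
  have xt: "ser.transc x"
    unfolding ser.transc_def using Xdeg pos by auto
  \<comment> \<open>The functions whose value at the branch lies in \<open>K\<close> form a field.
    It contains the given generators, hence \<open>x\<close>.\<close>
  define S where "S = {g. ser.reval x g \<in> K}"
  have S: "is_subfield S" unfolding S_def by (rule ser.subfield_vimage_reval[OF K xt])
  have "gen_field (insert (to_fract a) (range (\<lambda>k. to_fract (coeff \<Phi> k)))) \<subseteq> S"
  proof (rule gen_field_least[OF S])
    show "range cst \<subseteq> S" using constK by (auto simp: S_def)
    have "u = fls_compose_fps (inverse (fls_X ^ B)) (Hm 1 A')"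
      using pos by (simp add: HmX u_def ABe)
    then have "u \<in> K" unfolding K_def by blast
    then have "to_fract a \<in> S" by (simp add: S_def ax)
    moreover have "to_fract (coeff \<Phi> k) \<in> S" for k
    proof -
      have "ser.peval (coeff \<Phi> k) x = c * coeff M k" using M(2) cev[of \<Phi> k] by simp
      then show ?thesis using is_subfieldD(4)[OF K cK M(4)] by (simp add: S_def)
    qed
    ultimately show "insert (to_fract a) (range (\<lambda>k. to_fract (coeff \<Phi> k))) \<subseteq> S" by auto
  qed
  then have "ratX \<in> S" using gen by blast
  then have "x \<in> K" by (simp add: S_def)
  then obtain F where "x = fls_compose_fps F (Hm 1 A')" unfolding K_def by blast
  \<comment> \<open>The branch has order \<open>-B'\<close>, whereas every order in \<open>K\<close>
    is a multiple of \<open>A'\<close>.\<close>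
  then have "- int B' = fls_subdegree F * int A'"
    using Xdeg pos Hm[of 1 A'] by (simp add: fls_subdegree_compose)
  then have "int A' dvd int B'" by (metis dvd_minus_iff dvd_triv_right)
  then have "A' dvd B'" by simp
  then show ?thesis by (simp add: AB)
qed

section \<open>Exchanging right factors\<close>

lemma prime_degree_indecomposable:
  assumes "prime (rat_degree a)" shows "indecomposable a"
  unfolding indecomposable_def
proof (intro conjI notI)
  show "rat_degree a > 1" using assms prime_gt_1_nat by blast
  assume "\<exists>g h. a = g \<circ>\<^sub>R h \<and> rat_degree g < rat_degree a \<and> rat_degree h < rat_degree a"
  then obtain g h where gh: "a = g \<circ>\<^sub>R h" "rat_degree g < rat_degree a" "rat_degree h < rat_degree a"
    by blast
  have "rat_degree a = rat_degree g * rat_degree h" unfolding gh(1) by (rule rat_degree_comp)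
  then have "rat_degree g = 1 \<or> rat_degree h = 1" using assms prime_product by metis
  then show False using gh(2,3) \<open>rat_degree a = _\<close> by auto
qed

section \<open>Powers of x and roots of unity\<close>

lemma power_X_comp: "nonconst h \<Longrightarrow> ratX ^ k \<circ>\<^sub>R h = h ^ k"
  by (simp add: rat_comp_power)

lemma indecomposable_power_X_prime:
  assumes "indecomposable (ratX ^ k)" shows "prime k"
  unfolding prime_nat_iff
proof (intro conjI allI impI)
  show k1: "k > 1" using assms by (simp add: indecomposable_def rat_degree_power_X)
  fix m assume "m dvd k"
  then obtain n where n: "k = m * n" by blast
  then have n1: "n \<ge> 1" using k1 by (cases n) auto
  have "ratX ^ k = ratX ^ m \<circ>\<^sub>R ratX ^ n"
    using n n1 by (simp add: power_X_comp nonconst_power_X mult.commute flip: power_mult)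
  from indecomposable_comp_cases[OF assms this] have "m = 1 \<or> n = 1"
    by (simp add: rat_degree_power_X)
  then show "m = 1 \<or> m = k" using n by auto
qed

lemma coprime_powers_eq_1:
  fixes \<alpha> :: complex
  assumes "\<alpha> ^ i = 1" "\<alpha> ^ j = 1" "coprime i j"
  shows "\<alpha> = 1"
proof (cases "i = 0")
  case True
  then show ?thesis using assms by simp
next
  case False
  then obtain x y where "i * x = j * y + gcd i j" using bezout_nat[of i j] by blast
  then have xy: "i * x = j * y + 1" using assms(3) by simp
  have "1 = (\<alpha> ^ i) ^ x" using assms(1) by simp
  also have "\<dots> = (\<alpha> ^ j) ^ y * \<alpha>" by (simp add: xy flip: power_mult)
  finally show ?thesis using assms(2) by simp
qed

lemma prime_root_primitive:
  fixes \<alpha> :: complex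
  assumes "prime k" "\<alpha> ^ k = 1" "\<alpha> \<noteq> 1" "0 < i" "i < k"
  shows "\<alpha> ^ i \<noteq> 1"
proof
  assume "\<alpha> ^ i = 1"
  moreover have "coprime i k"
    using assms by (metis coprime_commute prime_imp_coprime_nat nat_dvd_not_less)
  ultimately show False using coprime_powers_eq_1 assms by blast
qed

lemma primitive_root_exists:
  assumes "prime k" obtains \<zeta> :: complex where "\<zeta> ^ k = 1" "\<zeta> \<noteq> 1"
proof -
  have "card {z::complex. z ^ k = 1} = k"
    using assms prime_gt_0_nat by (intro card_roots_unity_eq) auto
  moreover have "k > 1" using assms prime_gt_1_nat by blast
  ultimately have "\<not> {z::complex. z ^ k = 1} \<subseteq> {1}"
    by (metis card_mono card.empty card_insert_disjoint finite.emptyI finite_insert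
        One_nat_def empty_iff leD)
  then show ?thesis using that by blast
qed

lemma nonconst_scale: "\<alpha> \<noteq> 0 \<Longrightarrow> nonconst (cst \<alpha> * ratX)"
  using rat_degree_affine[of \<alpha> ratX 0] by (simp add: nonconst_iff_degree)

lemma in_comp_field_power_iff:
  assumes k: "prime k" and \<zeta>: "\<zeta> ^ k = 1" "\<zeta> \<noteq> 1"
  shows "e \<in> comp_field (ratX ^ k) \<longleftrightarrow> e \<circ>\<^sub>R (cst \<zeta> * ratX) = e"
proof
  have k1: "k \<ge> 1" using k prime_ge_1_nat by blast
  then have "\<zeta> \<noteq> 0" using \<zeta>(1) by (auto simp: power_0_left)
  then have m: "nonconst (cst \<zeta> * ratX)" by (rule nonconst_scale)
  assume "e \<in> comp_field (ratX ^ k)"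
  then obtain r where r: "e = r \<circ>\<^sub>R ratX ^ k" by (rule comp_fieldE)
  have "ratX ^ k \<circ>\<^sub>R (cst \<zeta> * ratX) = ratX ^ k"
    by (simp add: power_X_comp m power_mult_distrib \<zeta> flip: rc.\<kappa>_power)
  then show "e \<circ>\<^sub>R (cst \<zeta> * ratX) = e" unfolding r by (simp add: rat_comp_assoc m)
next
  assume "e \<circ>\<^sub>R (cst \<zeta> * ratX) = e"
  then show "e \<in> comp_field (ratX ^ k)"
    using invariant_root_of_unity[of \<zeta> k e] prime_root_primitive[OF k \<zeta>] \<zeta> prime_ge_1_nat[OF k] by blast
qed

text \<open>Writing \<open>b = N / D\<close>, the function \<open>q\<close> is a root of
  \<open>N(T) - u D(T)\<close>, a polynomial over \<complex>(h) of degree at most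
  \<open>deg b\<close>. As \<open>q\<close> generates \<complex>(x) over \<complex>(h), this bounds
  \<open>deg h\<close>.\<close>

lemma rat_degree_le_of_common_multiple:
  assumes u: "u = b \<circ>\<^sub>R q" "u = c \<circ>\<^sub>R h" "nonconst u" and X: "ratX \<in> gen_field {h, q}"
  shows "rat_degree h \<le> rat_degree b"
proof -
  have "nonconst (b \<circ>\<^sub>R q)" "nonconst (c \<circ>\<^sub>R h)" using u by metis+
  then have nc: "nonconst h" "nonconst c" "nonconst q" by (simp_all add: nonconst_comp_iff)
  obtain N D where ND: "b = Fract N D" "D \<noteq> 0" "coprime N D" by (rule ratfun_cases)
  define k where "k = rat_degree b"
  have k: "degree N \<le> k" "degree D \<le> k" using ND by (simp_all add: k_def rat_degree_Fract)
  define r where "r i = cst (coeff N i) - c * cst (coeff D i)" for i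
  have sm: "rc.peval M q = (\<Sum>i\<le>k. cst (coeff M i) * q ^ i)" if "degree M \<le> k" for M
    unfolding rc.peval_altdef
    by (rule sum.mono_neutral_left) (use that in \<open>auto simp: coeff_eq_0\<close>)
  have "(\<Sum>i\<le>k. (r i \<circ>\<^sub>R h) * q ^ i) = rc.peval N q - u * rc.peval D q"
    unfolding sm[OF k(1)] sm[OF k(2)] sum_distrib_left sum_subtractf[symmetric]
    by (rule sum.cong) (auto simp: r_def rat_comp_hom nc u(2) algebra_simps)
  also have "\<dots> = 0"
  proof -
    have "rc.peval D q \<noteq> 0" using rc.peval_eq_0_iff[OF nc(3)] ND(2) by simp
    moreover have "u = rc.peval N q / rc.peval D q"
      unfolding u(1) ND(1) by (rule rat_comp_Fract[OF nc(3) ND(2)])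
    ultimately show ?thesis by simp
  qed
  finally have rel: "(\<Sum>i\<le>k. (r i \<circ>\<^sub>R h) * q ^ i) = 0" .
  \<comment> \<open>A vanishing coefficient at this index would make \<open>c\<close> a
    constant.\<close>
  have "r (degree D) \<noteq> 0"
  proof
    assume "r (degree D) = 0"
    then have "c = cst (coeff N (degree D) / lead_coeff D)"
      using ND(2) by (simp add: r_def rc.\<kappa>_divide field_simps)
    then show False using nc(2) by (auto simp: rc.transc_def)
  qed
  then show ?thesis
    using rat_degree_le_of_relation[OF nc(1) X rel] k(2) unfolding k_def by blast
qed

text \<open>A proper splitting \<open>a = c \<circ> d\<close> would put
  \<open>h = d \<circ> p\<close> strictly between. If \<open>h\<close> lies in \<complex>(q), it
  contradicts the minimality of \<open>u\<close>; otherwise \<complex>(h, q) is everything, so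
  \<open>deg h \<le> deg b = deg p\<close> and \<open>d\<close> has degree at most 1.\<close>

lemma left_factor_indecomposable:
  assumes pq: "indecomposable p" "indecomposable q"
    and u: "u = a \<circ>\<^sub>R p" "u = b \<circ>\<^sub>R q" "nonconst u"
    and min: "\<And>h. h \<in> comp_field p \<Longrightarrow> h \<in> comp_field q \<Longrightarrow> u \<in> comp_field h \<Longrightarrow>
      rat_degree u \<le> rat_degree h"
    and deg: "rat_degree b = rat_degree p"
  shows "indecomposable a" "rat_degree a = rat_degree q"
proof -
  have "rat_degree u = rat_degree a * rat_degree p" by (simp only: u(1) rat_degree_comp)
  moreover have "rat_degree u = rat_degree b * rat_degree q" by (simp only: u(2) rat_degree_comp)
  moreover have p0: "rat_degree p > 0" using pq(1) by (simp add: indecomposable_def)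
  ultimately show aq: "rat_degree a = rat_degree q" using deg by simp
  have nc: "nonconst p" "nonconst a" using u by (auto simp: nonconst_comp_iff)
  show "indecomposable a"
    unfolding indecomposable_def
  proof (intro conjI notI)
    show "rat_degree a > 1" using aq pq(2) by (simp add: indecomposable_def)
    assume "\<exists>g h. a = g \<circ>\<^sub>R h \<and> rat_degree g < rat_degree a \<and> rat_degree h < rat_degree a"
    then obtain c d where cd: "a = c \<circ>\<^sub>R d" "rat_degree c < rat_degree a" "rat_degree d < rat_degree a"
      by blast
    define h where "h = d \<circ>\<^sub>R p"
    have uh: "u = c \<circ>\<^sub>R h" by (simp add: u(1) cd(1) h_def rat_comp_assoc nc)
    have hp: "h \<in> comp_field p" unfolding h_def by (rule comp_fieldI)
    have degh: "rat_degree h = rat_degree d * rat_degree p" by (simp add: h_def rat_degree_comp)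
    have dega: "rat_degree a = rat_degree c * rat_degree d" unfolding cd(1) by (rule rat_degree_comp)
    show False
    proof (cases "h \<in> comp_field q")
      case True
      have "rat_degree u \<le> rat_degree h" by (rule min[OF hp True]) (simp add: uh comp_fieldI)
      then have "rat_degree a * rat_degree p \<le> rat_degree d * rat_degree p"
        by (simp add: degh u(1) rat_degree_comp)
      then show False using p0 cd(3) by simp
    next
      case False
      then have "ratX \<in> gen_field {h, q}"
        using indecomposable_maximal[OF pq(2)] by (simp add: insert_commute)
      then have "rat_degree h \<le> rat_degree b"
        using rat_degree_le_of_common_multiple u(2,3) uh by blast
      then have "rat_degree d * rat_degree p \<le> 1 * rat_degree p" by (simp add: degh deg)
      then have "rat_degree d \<le> 1" using p0 by simp
      then show False using dega cd(2) by (cases "rat_degree d = 0") auto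
    qed
  qed
qed

definition exchangeable :: "ratfun \<Rightarrow> ratfun \<Rightarrow> ratfun \<Rightarrow> bool" where
  "exchangeable f p q \<longleftrightarrow> (\<exists>a b w. f = w \<circ>\<^sub>R (a \<circ>\<^sub>R p) \<and> a \<circ>\<^sub>R p = b \<circ>\<^sub>R q \<and>
     indecomposable a \<and> indecomposable b \<and> rat_degree a = rat_degree q \<and> rat_degree b = rat_degree p)"

text \<open>For nonconstant \<open>f\<close>, \<open>p\<close> and \<open>q\<close> such a
  \<open>u\<close> generates \<complex>(p) \<inter> \<complex>(q). Describing it by least degree
  makes its existence immediate.\<close>

definition minimal_common :: "ratfun \<Rightarrow> ratfun \<Rightarrow> ratfun \<Rightarrow> ratfun \<Rightarrow> bool" where
  "minimal_common f p q u \<longleftrightarrow> u \<in> comp_field p \<and> u \<in> comp_field q \<and> f \<in> comp_field u \<and>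
     (\<forall>h. h \<in> comp_field p \<longrightarrow> h \<in> comp_field q \<longrightarrow> f \<in> comp_field h \<longrightarrow> rat_degree u \<le> rat_degree h)"

lemma minimal_common_exists:
  assumes "f \<in> comp_field p" "f \<in> comp_field q"
  obtains u where "minimal_common f p q u"
proof -
  define P where "P h \<longleftrightarrow> h \<in> comp_field p \<and> h \<in> comp_field q \<and> f \<in> comp_field h" for h
  have "P f" using assms by (simp add: P_def self_in_comp_field)
  from ex_has_least_nat[of P f rat_degree, OF this] show ?thesis
    using that unfolding minimal_common_def P_def by blast
qed

lemma exchangeable_of_minimal:
  assumes pq: "indecomposable p" "indecomposable q" and f: "nonconst f"
    and min: "minimal_common f p q u" and u: "u = b \<circ>\<^sub>R q" and deg: "rat_degree b = rat_degree p"
  shows "exchangeable f p q"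
proof -
  obtain w where w: "f = w \<circ>\<^sub>R u" using min unfolding minimal_common_def by (auto elim: comp_fieldE)
  obtain a where a: "u = a \<circ>\<^sub>R p" using min unfolding minimal_common_def by (auto elim: comp_fieldE)
  have nu: "nonconst u" using f unfolding w by (simp add: nonconst_comp_iff)
  have m: "rat_degree u \<le> rat_degree h"
    if h: "h \<in> comp_field p" "h \<in> comp_field q" "u \<in> comp_field h" for h
  proof -
    have "nonconst h" using h(3) nu by (auto simp: nonconst_comp_iff elim: comp_fieldE)
    then have "f \<in> comp_field h" using comp_field_trans h(3) min unfolding minimal_common_def by blast
    then show ?thesis using min h unfolding minimal_common_def by blast
  qed
  have 1: "indecomposable a" "rat_degree a = rat_degree q"
    using left_factor_indecomposable[OF pq a u nu m deg] by blast+
  have "indecomposable b"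
    using left_factor_indecomposable(1)[OF pq(2,1) u a nu m 1(2)] by blast
  then show ?thesis
    unfolding exchangeable_def using 1 deg w a u by metis
qed

text \<open>\<open>k\<close> and \<open>l\<close> are distinct primes, so a nontrivial
  \<open>l\<close>-th root of unity acts on \<open>x^k\<close> by another nontrivial one, and
  \<open>f\<close> is a function of \<open>x^(k l)\<close>. This gives \<open>deg b \<le> k\<close>,
  while coprimality gives \<open>k dvd rat_degree b\<close>.\<close>

lemma exchangeable_powers:
  assumes ind: "indecomposable (ratX ^ k)" "indecomposable (ratX ^ l)" and kl: "k \<noteq> l"
    and f: "f \<in> comp_field (ratX ^ k)" "f \<in> comp_field (ratX ^ l)" "nonconst f"
  shows "exchangeable f (ratX ^ k) (ratX ^ l)"
proof -
  have pr: "prime k" "prime l" using ind by (simp_all add: indecomposable_power_X_prime)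
  then have cop: "coprime k l" using kl by (simp add: primes_coprime)
  have k1: "k \<ge> 1" "l \<ge> 1" using pr prime_ge_1_nat by blast+
  obtain \<zeta> :: complex where \<zeta>: "\<zeta> ^ l = 1" "\<zeta> \<noteq> 1" using primitive_root_exists[OF pr(2)] by blast
  then have "\<zeta> \<noteq> 0" using k1 by (auto simp: power_0_left)
  then have m: "nonconst (cst \<zeta> * ratX)" by (rule nonconst_scale)
  obtain F where F: "f = F \<circ>\<^sub>R ratX ^ k" using f(1) by (rule comp_fieldE)
  define \<xi> where "\<xi> = \<zeta> ^ k"
  have \<xi>: "\<xi> ^ l = 1" "\<xi> \<noteq> 1"
  proof -
    show "\<xi> ^ l = 1" using \<zeta>(1) by (metis \<xi>_def power_commutes power_mult mult.commute power_one)
    show "\<xi> \<noteq> 1" using coprime_powers_eq_1[of \<zeta> k l] \<zeta> cop unfolding \<xi>_def by blast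
  qed
  then have m': "nonconst (cst \<xi> * ratX)" using \<open>\<zeta> \<noteq> 0\<close> by (intro nonconst_scale) (simp add: \<xi>_def)
  have nk: "nonconst (ratX ^ k)" using k1 by (simp add: nonconst_power_X)
  have "ratX ^ k \<circ>\<^sub>R (cst \<zeta> * ratX) = cst \<xi> * ratX ^ k"
    by (simp add: power_X_comp m power_mult_distrib \<xi>_def rc.\<kappa>_power)
  also have "\<dots> = (cst \<xi> * ratX) \<circ>\<^sub>R ratX ^ k" by (simp only: rat_comp_mult[OF nk] cst_comp X_comp)
  finally have "ratX ^ k \<circ>\<^sub>R (cst \<zeta> * ratX) = (cst \<xi> * ratX) \<circ>\<^sub>R ratX ^ k" .
  then have "(F \<circ>\<^sub>R (cst \<xi> * ratX)) \<circ>\<^sub>R ratX ^ k = f \<circ>\<^sub>R (cst \<zeta> * ratX)"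
    by (simp add: F rat_comp_assoc nk m)
  also have "\<dots> = F \<circ>\<^sub>R ratX ^ k" using in_comp_field_power_iff[OF pr(2) \<zeta>] f(2) F by simp
  finally have "F \<circ>\<^sub>R (cst \<xi> * ratX) = F" using rat_comp_inj nonconst_power_X k1 by blast
  then have "F \<in> comp_field (ratX ^ l)" using in_comp_field_power_iff[OF pr(2) \<xi>] by blast
  then obtain G where "F = G \<circ>\<^sub>R ratX ^ l" by (rule comp_fieldE)
  then have G: "f = G \<circ>\<^sub>R ratX ^ (k * l)"
    unfolding F using nonconst_power_X[OF k1(2)]
    by (simp add: rat_comp_assoc nk power_X_comp mult.commute flip: power_mult)
  obtain u where u: "minimal_common f (ratX ^ k) (ratX ^ l) u" using minimal_common_exists f by blast
  then obtain a where ab1: "u = a \<circ>\<^sub>R ratX ^ k" unfolding minimal_common_def by (auto elim: comp_fieldE)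
  obtain b where ab2: "u = b \<circ>\<^sub>R ratX ^ l" using u unfolding minimal_common_def by (auto elim: comp_fieldE)
  note ab = ab1 ab2
  have "ratX ^ (k * l) = ratX ^ k \<circ>\<^sub>R ratX ^ l" "ratX ^ (k * l) = ratX ^ l \<circ>\<^sub>R ratX ^ k"
    using nk nonconst_power_X[OF k1(2)]
    by (simp_all add: power_X_comp mult.commute flip: power_mult)
  then have "ratX ^ (k * l) \<in> comp_field (ratX ^ k)" "ratX ^ (k * l) \<in> comp_field (ratX ^ l)"
    by (metis comp_fieldI)+
  moreover have "f \<in> comp_field (ratX ^ (k * l))" unfolding G by (rule comp_fieldI)
  ultimately have "rat_degree u \<le> rat_degree (ratX ^ (k * l))" using u unfolding minimal_common_def by blast
  then have "rat_degree b * l \<le> k * l"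
    unfolding ab(2) by (simp add: rat_degree_comp rat_degree_power_X)
  then have le: "rat_degree b \<le> k" using k1 by simp
  have "rat_degree a * k = rat_degree b * l"
    using ab by (metis rat_degree_comp rat_degree_power_X)
  then have "k dvd rat_degree b * l" by (metis dvd_triv_right)
  then have "k dvd rat_degree b" using cop by (simp add: coprime_dvd_mult_left_iff)
  moreover have "rat_degree b > 0"
  proof -
    have "f \<in> comp_field u" using u by (simp add: minimal_common_def)
    then have "nonconst u" using f(3) by (auto simp: nonconst_comp_iff elim: comp_fieldE)
    then show ?thesis unfolding ab(2) nonconst_comp_iff by (simp add: nonconst_iff_degree)
  qed
  ultimately have "rat_degree b = k" using le by (simp add: dvd_imp_le le_antisym)
  then show ?thesis
    using exchangeable_of_minimal[OF ind f(3) u ab(2)] by (simp add: rat_degree_power_X)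
qed

lemma comp_field_affine:
  assumes "\<alpha> \<noteq> 0" "nonconst q" shows "cst \<alpha> * q + cst \<beta> \<in> comp_field q" "q \<in> comp_field (cst \<alpha> * q + cst \<beta>)"
proof -
  show 1: "cst \<alpha> * q + cst \<beta> \<in> comp_field q"
    using comp_fieldI[of "cst \<alpha> * ratX + cst \<beta>" q] assms by (simp add: rat_comp_hom)
  show "q \<in> comp_field (cst \<alpha> * q + cst \<beta>)"
    by (rule comp_field_eqI[OF _ 1]) (use assms in \<open>simp_all add: rat_degree_affine nonconst_iff_degree\<close>)
qed

lemma in_comp_field_joukowski_iff:
  assumes c: "c \<noteq> 0"
  shows "e \<in> comp_field (ratX + cst c / ratX) \<longleftrightarrow> e \<circ>\<^sub>R (cst c / ratX) = e"
proof
  have m: "nonconst (cst c / ratX)" using c by (rule nonconst_const_over_X)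
  assume "e \<in> comp_field (ratX + cst c / ratX)"
  then obtain r where r: "e = r \<circ>\<^sub>R (ratX + cst c / ratX)" by (rule comp_fieldE)
  have "(ratX + cst c / ratX) \<circ>\<^sub>R (cst c / ratX) = ratX + cst c / ratX"
    using c by (simp add: rat_comp_hom m field_simps)
  then show "e \<circ>\<^sub>R (cst c / ratX) = e" unfolding r by (simp only: rat_comp_assoc[OF m])
qed (rule invariant_involution[OF c])

text \<open>\<open>q\<close> is a function of degree 2 composed with \<open>x^n\<close>, so
  indecomposability forces \<open>n = 1\<close>, and what is left is an affine function of
  \<open>x + (w / u) / x\<close>.\<close>

lemma dihedral_indecomposable:
  assumes ind: "indecomposable q" and q: "q = cst u * ratX ^ n + cst v + cst w / ratX ^ n"
    and nz: "n \<ge> 1" "u \<noteq> 0" "w \<noteq> 0"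
  shows "comp_field q = comp_field (ratX + cst (w / u) / ratX)" "rat_degree q = 2"
proof -
  define J where "J = ratX + cst (w / u) / ratX"
  have J: "nonconst J" "rat_degree J = 2" unfolding J_def using nz by (simp_all add: joukowski_degree)
  define Q where "Q = cst u * J + cst v"
  have Q: "rat_degree Q = 2" "nonconst Q"
    using J nz by (simp_all add: Q_def rat_degree_affine nonconst_iff_degree)
  have n: "nonconst (ratX ^ n)" using nz by (simp add: nonconst_power_X)
  have "q = Q \<circ>\<^sub>R ratX ^ n"
    using nz by (simp add: Q_def J_def q rat_comp_hom n rc.\<kappa>_divide field_simps)
  then have "rat_degree (ratX ^ n) = 1"
    using indecomposable_comp_cases[OF ind] Q by fastforce
  then have qQ: "q = Q" using \<open>q = Q \<circ>\<^sub>R ratX ^ n\<close> by (simp add: rat_degree_power_X)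
  then show "rat_degree q = 2" using Q by simp
  have "Q \<in> comp_field J" "J \<in> comp_field Q"
    unfolding Q_def using comp_field_affine[OF nz(2) J(1)] by blast+
  then have "comp_field Q = comp_field J" using comp_field_trans J(1) Q(2) by blast
  then show "comp_field q = comp_field (ratX + cst (w / u) / ratX)" unfolding qQ J_def .
qed

lemma laurent_comp_scale:
  assumes "p \<in> laurent_polys" "\<zeta> \<noteq> 0"
  shows "p \<circ>\<^sub>R (cst \<zeta> * ratX) \<in> laurent_polys"
proof -
  obtain P n where P: "p = Fract P (monom 1 n)" using assms(1) by (rule laurentE)
  have s: "cst \<zeta> * ratX = to_fract [:0, \<zeta>:]" by (simp flip: to_fract_smult)
  have m: "nonconst (cst \<zeta> * ratX)" using assms(2) by (rule nonconst_scale)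
  have "p \<circ>\<^sub>R (cst \<zeta> * ratX) = to_fract (pcompose P [:0, \<zeta>:]) / (cst (\<zeta> ^ n) * ratX ^ n)"
    using m unfolding P by (simp add: rat_comp_Fract monom_eq_0_iff rc.peval_monom power_mult_distrib rc.\<kappa>_power)
      (simp add: s peval_to_fract)
  also have "\<dots> = Fract (smult (inverse (\<zeta> ^ n)) (pcompose P [:0, \<zeta>:])) (monom 1 n)"
    by (simp add: Fract_conv_to_fract to_fract_smult to_fract_monom rc.\<kappa>_inverse divide_inverse mult_ac)
  finally show ?thesis using laurentI by simp
qed

text \<open>Since \<open>G(q(\<zeta> x)) = G(q(x))\<close> for a \<open>k\<close>-th root of unity \<open>\<zeta>\<close>, either \<open>q(\<zeta> x)\<close> is an affine function
  of \<open>q(x)\<close>, or \<open>q\<close> is of Joukowski type \<open>u x + v + w / x\<close> and \<open>f\<close> is invariant under a dihedral group.\<close>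

lemma exchangeable_power_polynomial:
  assumes ind: "indecomposable (ratX ^ k)" "indecomposable q"
    and q: "q \<in> laurent_polys" "q \<notin> comp_field (ratX ^ k)"
    and f: "f = to_fract G \<circ>\<^sub>R q" "f \<in> comp_field (ratX ^ k)" "nonconst f"
  shows "exchangeable f (ratX ^ k) q"
proof -
  have pr: "prime k" using ind by (simp add: indecomposable_power_X_prime)
  have k1: "k \<ge> 1" using pr prime_ge_1_nat by blast
  have nk: "nonconst (ratX ^ k)" using k1 by (rule nonconst_power_X)
  have nq: "nonconst q" using ind(2) by (rule indecomposable_nonconst)
  obtain \<zeta> :: complex where \<zeta>: "\<zeta> ^ k = 1" "\<zeta> \<noteq> 1" using primitive_root_exists[OF pr] by blast
  then have \<zeta>0: "\<zeta> \<noteq> 0" using k1 by (auto simp: power_0_left)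
  define m where "m = cst \<zeta> * ratX"
  have m: "nonconst m" unfolding m_def using \<zeta>0 by (rule nonconst_scale)
  have inv: "e \<in> comp_field (ratX ^ k) \<longleftrightarrow> e \<circ>\<^sub>R m = e" for e
    unfolding m_def by (rule in_comp_field_power_iff[OF pr \<zeta>])
  have G: "degree G \<ge> 1"
  proof -
    have "nonconst (to_fract G)" using f(1,3) by (simp only: nonconst_comp_iff)
    then show ?thesis by (simp add: nonconst_iff_degree)
  qed
  \<comment> \<open>The two right factors to be compared are \<open>q\<close> and its rotated copy,
    with the same outer polynomial \<open>G\<close>.\<close>
  have "rc.peval G q = rc.peval G (q \<circ>\<^sub>R m)"
    using f(2) unfolding inv f(1) by (simp add: rat_comp_peval m)
  moreover have "q \<circ>\<^sub>R m \<in> laurent_polys"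
    unfolding m_def using q(1) \<zeta>0 by (rule laurent_comp_scale)
  ultimately consider \<alpha> \<beta> where "\<alpha> \<noteq> 0" "q \<circ>\<^sub>R m = cst \<alpha> * q + cst \<beta>" |
    n u v w where "n \<ge> 1" "u \<noteq> 0" "w \<noteq> 0" "q = cst u * ratX ^ n + cst v + cst w / ratX ^ n"
    using equal_degree_dihedral[OF refl refl G q(1) _ nq] by blast
  then show ?thesis
  proof cases
    case (1 \<alpha> \<beta>)
    define mi where "mi i = cst (\<zeta> ^ i) * ratX" for i
    have mi: "mi i \<circ>\<^sub>R m = mi (Suc i)" for i by (simp add: mi_def m_def rat_comp_hom m[unfolded m_def] rc.\<kappa>_mult)
    have mik: "mi k = ratX" by (simp add: mi_def \<zeta>)
    \<comment> \<open>For \<open>\<alpha> = 1\<close>, rotating \<open>k\<close> times adds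
      \<open>k \<beta>\<close> to \<open>q\<close> and returns to \<open>q\<close>, so
      \<open>\<beta> = 0\<close> and \<open>q\<close> would be a function of
      \<open>x^k\<close>.\<close>
    have "\<alpha> \<noteq> 1"
    proof
      assume \<alpha>: "\<alpha> = 1"
      have "q \<circ>\<^sub>R mi i = q + cst (of_nat i * \<beta>)" for i
      proof (induction i)
        case (Suc i)
        have "q \<circ>\<^sub>R mi (Suc i) = (q \<circ>\<^sub>R mi i) \<circ>\<^sub>R m" by (simp add: rat_comp_assoc m mi)
        also have "\<dots> = (q \<circ>\<^sub>R m) + cst (of_nat i * \<beta>)" unfolding Suc by (simp add: rat_comp_hom m)
        also have "\<dots> = q + (cst \<beta> + cst (of_nat i * \<beta>))" using 1(2) \<alpha> by simp
        finally show ?case by (simp only: rc.\<kappa>_add[symmetric]) (simp add: algebra_simps)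
      qed (simp add: mi_def)
      from this[of k] have "q = q + cst (of_nat k * \<beta>)" unfolding mik by simp
      then have "\<beta> = 0" using k1 by simp
      then have "q \<circ>\<^sub>R m = q" using 1(2) \<alpha> by simp
      then show False using inv q(2) by blast
    qed
    \<comment> \<open>\<gamma> is the fixed point of \<open>t -> \<alpha> t + \<beta>\<close>;
      subtracting it makes \<open>q0\<close> an eigenvector of the rotation.\<close>
    define \<gamma> where "\<gamma> = \<beta> / (1 - \<alpha>)"
    define q0 where "q0 = q - cst \<gamma>"
    have q0q: "q0 = cst 1 * q + cst (- \<gamma>)" by (simp add: q0_def rc.\<kappa>_minus)
    have nq0: "nonconst q0" "rat_degree q0 = rat_degree q"
      using rat_degree_affine[of 1 q "-\<gamma>"] nq unfolding q0q by (simp_all add: nonconst_iff_degree)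
    have q0m: "q0 \<circ>\<^sub>R m = cst \<alpha> * q0"
    proof -
      have "\<beta> - \<gamma> = - (\<alpha> * \<gamma>)" using \<open>\<alpha> \<noteq> 1\<close> by (simp add: \<gamma>_def field_simps)
      then have "cst \<beta> - cst \<gamma> = - (cst \<alpha> * cst \<gamma>)"
        by (simp only: rc.\<kappa>_diff[symmetric] rc.\<kappa>_mult[symmetric] rc.\<kappa>_minus[symmetric])
      then show ?thesis using 1(2) by (simp add: q0_def rat_comp_hom m algebra_simps)
    qed
    have "q0 \<circ>\<^sub>R mi i = cst (\<alpha> ^ i) * q0" for i
    proof (induction i)
      case (Suc i)
      have "q0 \<circ>\<^sub>R mi (Suc i) = (q0 \<circ>\<^sub>R mi i) \<circ>\<^sub>R m" by (simp add: rat_comp_assoc m mi)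
      also have "\<dots> = cst (\<alpha> ^ i) * (cst \<alpha> * q0)" unfolding Suc by (simp add: rat_comp_hom m q0m)
      finally show ?case by (simp only: power_Suc2 rc.\<kappa>_mult mult.assoc)
    qed (simp add: mi_def)
    from this[of k] have "cst (\<alpha> ^ k) * q0 = cst 1 * q0" unfolding mik by simp
    moreover have "q0 \<noteq> 0" using nq0 by (auto simp: rc.transc_def)
    ultimately have \<alpha>k: "\<alpha> ^ k = 1" by (simp only: mult_cancel_right rc.\<kappa>_eq) simp
    \<comment> \<open>\<open>q0\<close> carries the rotation by \<zeta> to the rotation by \<alpha>,
      again a nontrivial \<open>k\<close>-th root of unity, so invariance can be tested on the left
      factor \<open>e\<close>.\<close>
    have inv0: "e \<circ>\<^sub>R q0 \<in> comp_field (ratX ^ k) \<longleftrightarrow> e \<in> comp_field (ratX ^ k)" for e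
    proof -
      have n: "nonconst (cst \<alpha> * ratX)" using 1(1) by (rule nonconst_scale)
      have "(e \<circ>\<^sub>R q0) \<circ>\<^sub>R m = e \<circ>\<^sub>R ((cst \<alpha> * ratX) \<circ>\<^sub>R q0)"
        by (simp add: rat_comp_assoc m q0m rat_comp_hom nq0)
      then have "(e \<circ>\<^sub>R q0) \<circ>\<^sub>R m = (e \<circ>\<^sub>R (cst \<alpha> * ratX)) \<circ>\<^sub>R q0"
        by (simp add: rat_comp_assoc nq0)
      then have "(e \<circ>\<^sub>R q0) \<circ>\<^sub>R m = e \<circ>\<^sub>R q0 \<longleftrightarrow> e \<circ>\<^sub>R (cst \<alpha> * ratX) = e"
        using rat_comp_inj[OF nq0(1)] by metis
      then show ?thesis
        using inv[of "e \<circ>\<^sub>R q0"] in_comp_field_power_iff[OF pr \<alpha>k \<open>\<alpha> \<noteq> 1\<close>, of e] by blast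
    qed
    have qq0: "q \<in> comp_field q0" "q0 \<in> comp_field q"
      unfolding q0q using comp_field_affine[OF one_neq_zero nq] by blast+
    obtain u where u: "minimal_common f (ratX ^ k) q u"
      using minimal_common_exists f comp_fieldI by metis
    then obtain b where b: "u = b \<circ>\<^sub>R q" unfolding minimal_common_def by (auto elim: comp_fieldE)
    have "f \<in> comp_field u" using u by (simp add: minimal_common_def)
    then have nu: "nonconst u" using f(3) by (auto simp: nonconst_comp_iff elim: comp_fieldE)
    have "u \<in> comp_field q0" using u comp_field_trans[OF nq0(1) qq0(1)] unfolding minimal_common_def by blast
    then obtain b0 where b0: "u = b0 \<circ>\<^sub>R q0" by (rule comp_fieldE)
    have "b0 \<in> comp_field (ratX ^ k)" using inv0[of b0] u unfolding b0 minimal_common_def by blast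
    then obtain r where "b0 = r \<circ>\<^sub>R ratX ^ k" by (rule comp_fieldE)
    then have kb0: "k dvd rat_degree b0" by (simp add: rat_degree_comp rat_degree_power_X)
    have degs: "rat_degree b * rat_degree q = rat_degree b0 * rat_degree q"
      using b b0 nq0(2) by (metis rat_degree_comp)
    moreover have q0deg: "rat_degree q > 0" using nq by (simp add: nonconst_iff_degree)
    ultimately have kb: "k dvd rat_degree b" using kb0 by simp
    \<comment> \<open>\<open>q0^k\<close> lies in both fields and \<open>f\<close> is a function of
      it, so it bounds \<open>deg u\<close> from above. Together with
      \<open>k dvd rat_degree b\<close> this pins \<open>deg b\<close> down to
      \<open>k\<close>.\<close>
    have "rat_degree u \<le> rat_degree (q0 ^ k)"
    proof -
      have eq: "q0 ^ k = ratX ^ k \<circ>\<^sub>R q0" by (simp add: power_X_comp nq0)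
      have "q0 ^ k \<in> comp_field (ratX ^ k)" unfolding eq inv0 by (rule self_in_comp_field)
      moreover have "q0 ^ k \<in> comp_field q"
        using comp_field_trans[OF nq qq0(2)] comp_fieldI[of "ratX ^ k" q0] eq by auto
      moreover have "f \<in> comp_field (q0 ^ k)"
      proof -
        have "f \<in> comp_field q" unfolding f(1) by (rule comp_fieldI)
        then have "f \<in> comp_field q0" using comp_field_trans[OF nq0(1) qq0(1)] by blast
        then obtain G0 where G0: "f = G0 \<circ>\<^sub>R q0" by (rule comp_fieldE)
        then have "G0 \<in> comp_field (ratX ^ k)" using inv0 f(2) by simp
        then obtain r where "G0 = r \<circ>\<^sub>R ratX ^ k" by (rule comp_fieldE)
        then have "f = r \<circ>\<^sub>R q0 ^ k" using G0 eq by (simp add: rat_comp_assoc nq0)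
        then show ?thesis using comp_fieldI by simp
      qed
      ultimately show ?thesis using u unfolding minimal_common_def by blast
    qed
    also have "\<dots> = k * rat_degree q"
      using rat_degree_comp[of "ratX ^ k" q0] nq0 by (simp add: power_X_comp rat_degree_power_X)
    finally have "rat_degree b \<le> k" using q0deg unfolding b rat_degree_comp by simp
    moreover have "rat_degree b > 0"
      using nu unfolding b nonconst_comp_iff by (simp add: nonconst_iff_degree)
    ultimately have "rat_degree b = k" using kb by (simp add: dvd_imp_le le_antisym)
    then show ?thesis
      using exchangeable_of_minimal[OF ind f(3) u b] by (simp add: rat_degree_power_X)
  next
    case (2 n u v w)
    define c where "c = w / u"
    have c: "c \<noteq> 0" "c ^ k \<noteq> 0" using 2 by (auto simp: c_def)
    have cq: "comp_field q = comp_field (ratX + cst c / ratX)" "rat_degree q = 2"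
      unfolding c_def using dihedral_indecomposable[OF ind(2) 2(4,1-3)] by blast+
    have mc: "nonconst (cst c / ratX)" using c by (intro nonconst_const_over_X)
    \<comment> \<open>\<open>a \<circ> x^k\<close> is \<open>x^k + c^k / x^k\<close>, invariant both
      under the rotation and under the involution \<open>x -> c / x\<close> that determines
      \<complex>(q).\<close>
    define a where "a = ratX + cst (c ^ k) / ratX"
    have a: "rat_degree a = 2" unfolding a_def using c by (intro joukowski_degree)
    have ak: "(a \<circ>\<^sub>R ratX ^ k) \<circ>\<^sub>R (cst c / ratX) = a \<circ>\<^sub>R ratX ^ k"
      using c by (simp add: a_def rat_comp_hom nk mc power_divide rc.\<kappa>_power field_simps)
    then have "a \<circ>\<^sub>R ratX ^ k \<in> comp_field q"
      unfolding cq in_comp_field_joukowski_iff[OF c(1)] .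
    then obtain b where b: "a \<circ>\<^sub>R ratX ^ k = b \<circ>\<^sub>R q" by (rule comp_fieldE)
    then have "rat_degree a * k = rat_degree b * rat_degree q"
      by (metis rat_degree_comp rat_degree_power_X)
    then have bk: "rat_degree b = k" using a cq(2) by simp
    obtain F where F: "f = F \<circ>\<^sub>R ratX ^ k" using f(2) by (rule comp_fieldE)
    have "f \<in> comp_field q" unfolding f(1) by (rule comp_fieldI)
    then have "f \<circ>\<^sub>R (cst c / ratX) = f" unfolding cq in_comp_field_joukowski_iff[OF c(1)] .
    moreover have "ratX ^ k \<circ>\<^sub>R (cst c / ratX) = (cst (c ^ k) / ratX) \<circ>\<^sub>R ratX ^ k"
      by (simp add: rat_comp_hom nk mc power_divide rc.\<kappa>_power)
    ultimately have "(F \<circ>\<^sub>R (cst (c ^ k) / ratX)) \<circ>\<^sub>R ratX ^ k = F \<circ>\<^sub>R ratX ^ k"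
      unfolding F by (simp only: rat_comp_assoc[OF mc] rat_comp_assoc[OF nk])
    then have "F \<circ>\<^sub>R (cst (c ^ k) / ratX) = F" using rat_comp_inj[OF nk] by blast
    then have "F \<in> comp_field a" unfolding a_def in_comp_field_joukowski_iff[OF c(2)] .
    then obtain r where "F = r \<circ>\<^sub>R a" by (rule comp_fieldE)
    then have "f = r \<circ>\<^sub>R (a \<circ>\<^sub>R ratX ^ k)" unfolding F by (simp only: rat_comp_assoc[OF nk])
    moreover have "indecomposable a" "indecomposable b"
      using a bk pr two_is_prime_nat by (intro prime_degree_indecomposable; simp)+
    ultimately show ?thesis
      unfolding exchangeable_def using b a bk cq(2) by (metis rat_degree_power_X)
  qed
qed

text \<open>Comparing coefficients of \<open>f = P / x^n\<close> gives
  \<open>\<zeta>^i = \<zeta>^n\<close> wherever \<open>coeff P i\<close> is nonzero. Since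
  \<open>f\<close> is not constant, this happens for some \<open>i \<noteq> n\<close>.\<close>

lemma scaling_root_of_unity:
  assumes f: "f \<in> laurent_polys" "nonconst f" and \<zeta>: "\<zeta> \<noteq> 0" "f \<circ>\<^sub>R (cst \<zeta> * ratX) = f"
  obtains N where "N \<ge> 1" "\<zeta> ^ N = 1"
proof -
  obtain P n where P: "f = Fract P (monom 1 n)" using f(1) by (rule laurentE)
  have s: "cst \<zeta> * ratX = to_fract [:0, \<zeta>:]" by (simp flip: to_fract_smult)
  have m: "nonconst (to_fract [:0, \<zeta>:])" using nonconst_scale[OF \<zeta>(1)] unfolding s .
  have "f = to_fract (pcompose P [:0, \<zeta>:]) / to_fract (pcompose (monom 1 n) [:0, \<zeta>:])"
    using \<zeta>(2) unfolding s P by (subst (asm) rat_comp_Fract[OF m])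
      (simp_all add: monom_eq_0_iff peval_to_fract)
  moreover have X: "pcompose (monom 1 n) [:0, \<zeta>:] = monom (\<zeta> ^ n) n"
    by (rule poly_eqI) (simp add: coeff_pcompose_linear)
  ultimately have "Fract P (monom 1 n) = Fract (pcompose P [:0, \<zeta>:]) (monom (\<zeta> ^ n) n)"
    by (simp add: P Fract_conv_to_fract)
  then have "P * monom (\<zeta> ^ n) n = pcompose P [:0, \<zeta>:] * monom 1 n"
    using \<zeta>(1) by (simp add: eq_fract monom_eq_0_iff)
  then have "smult (\<zeta> ^ n) P * monom 1 n = pcompose P [:0, \<zeta>:] * monom 1 n"
    by (metis mult_smult_left mult_smult_right smult_monom mult.right_neutral)
  then have eq: "smult (\<zeta> ^ n) P = pcompose P [:0, \<zeta>:]"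
    by (subst (asm) mult_cancel_right) (auto simp: monom_eq_0_iff)
  have "\<exists>i. i \<noteq> n \<and> coeff P i \<noteq> 0"
  proof (rule ccontr)
    assume "\<not> ?thesis"
    then have "P = monom (coeff P n) n" by (intro poly_eqI) auto
    then have "to_fract P = cst (coeff P n) * ratX ^ n" by (metis to_fract_monom)
    then have "f = cst (coeff P n)" by (simp add: P Fract_conv_to_fract to_fract_monom)
    then show False using f(2) by (auto simp: rc.transc_def)
  qed
  then obtain i where i: "i \<noteq> n" "coeff P i \<noteq> 0" by blast
  have "\<zeta> ^ n * coeff P i = \<zeta> ^ i * coeff P i"
    using arg_cong[OF eq, of "\<lambda>p. coeff p i"] by (simp add: coeff_pcompose_linear)
  then have ni: "\<zeta> ^ n = \<zeta> ^ i" using i(2) by simp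
  show ?thesis
  proof (cases "i < n")
    case True
    then have "\<zeta> ^ i * \<zeta> ^ (n - i) = \<zeta> ^ i * 1" using ni by (simp flip: power_add)
    then show ?thesis using that[of "n - i"] True \<zeta>(1) by simp
  next
    case False
    then have "\<zeta> ^ n * \<zeta> ^ (i - n) = \<zeta> ^ i" by (simp flip: power_add)
    then have "\<zeta> ^ n * \<zeta> ^ (i - n) = \<zeta> ^ n * 1" by (simp only: ni mult.right_neutral)
    then show ?thesis using that[of "i - n"] False i(1) \<zeta>(1) by simp
  qed
qed

text \<open>A suitable power of \<zeta> has prime order \<open>k\<close>, where \<open>k\<close> is
  a prime factor of the order of \<zeta>; its invariants are the functions of
  \<open>x^k\<close>.\<close>

lemma scaling_invariant_in_power_field:
  assumes f: "f \<in> laurent_polys" "nonconst f"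
    and \<zeta>: "\<zeta> \<noteq> 0" "\<zeta> \<noteq> 1" "f \<circ>\<^sub>R (cst \<zeta> * ratX) = f"
  obtains k where "prime k" "f \<in> comp_field (ratX ^ k)"
proof -
  define T where "T N \<longleftrightarrow> N \<ge> 1 \<and> \<zeta> ^ N = 1" for N
  obtain N0 where "T N0" using scaling_root_of_unity[OF f \<zeta>(1,3)] unfolding T_def by metis
  define N where "N = (LEAST N. T N)"
  have N: "T N" unfolding N_def by (rule LeastI) fact
  have least: "N \<le> M" if "T M" for M unfolding N_def using that by (rule Least_le)
  have "N \<noteq> 1" using N \<zeta>(2) by (auto simp: T_def)
  then obtain k where k: "prime k" "k dvd N" using prime_factor_nat by blast
  then obtain d where d: "N = k * d" by blast
  have d1: "d \<ge> 1" using N d by (cases d) (auto simp: T_def)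
  define \<xi> where "\<xi> = \<zeta> ^ d"
  have \<xi>k: "\<xi> ^ k = 1" using N d by (simp add: \<xi>_def T_def mult.commute flip: power_mult)
  have "\<xi> \<noteq> 1"
  proof
    assume "\<xi> = 1"
    then have "N \<le> d" using d1 by (intro least) (simp add: T_def \<xi>_def)
    then show False using d d1 prime_gt_1_nat[OF k(1)] by simp
  qed
  have m: "nonconst (cst \<zeta> * ratX)" using \<zeta>(1) by (rule nonconst_scale)
  have "f \<circ>\<^sub>R (cst (\<zeta> ^ i) * ratX) = f" for i
  proof (induction i)
    case (Suc i)
    have "cst (\<zeta> ^ Suc i) * ratX = (cst (\<zeta> ^ i) * ratX) \<circ>\<^sub>R (cst \<zeta> * ratX)"
      by (simp only: rat_comp_mult[OF m] cst_comp X_comp power_Suc2 rc.\<kappa>_mult mult.assoc)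
    then have "f \<circ>\<^sub>R (cst (\<zeta> ^ Suc i) * ratX) = (f \<circ>\<^sub>R (cst (\<zeta> ^ i) * ratX)) \<circ>\<^sub>R (cst \<zeta> * ratX)"
      by (simp only: rat_comp_assoc[OF m])
    then show ?case by (simp only: Suc \<zeta>(3))
  qed simp
  then have "f \<circ>\<^sub>R (cst \<xi> * ratX) = f" unfolding \<xi>_def .
  then show ?thesis using that[OF k(1)] in_comp_field_power_iff[OF k(1) \<xi>k \<open>\<xi> \<noteq> 1\<close>] by blast
qed

text \<open>Let \<open>\<Phi>\<close> be the minimal polynomial of \<open>q\<close> over \<open>\<complex>(p)\<close>. By Lueroth its coefficients generate a field
  \<open>\<complex>(h)\<close> between \<open>\<complex>(u)\<close> and \<open>\<complex>(p)\<close>. If \<open>h \<in> \<complex>(q)\<close>, minimality of \<open>u\<close> shows that \<open>\<Phi>\<close> is defined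
  over \<open>\<complex>(u)\<close>; otherwise \<open>\<complex>(h, q) = \<complex>(x)\<close>, and comparing degrees gives \<open>\<complex>(h) = \<complex>(p)\<close>.\<close>

lemma minimal_polynomial_dichotomy:
  assumes pq: "indecomposable p" "indecomposable q" "q \<notin> comp_field p"
    and u: "u = rc.peval A p" "u = rc.peval B q" and deg: "degree A \<ge> 1" "degree B \<ge> 1"
    and min: "\<And>h. h \<in> comp_field p \<Longrightarrow> h \<in> comp_field q \<Longrightarrow> u \<in> comp_field h \<Longrightarrow>
      rat_degree u \<le> rat_degree h"
  shows "rat_degree p = degree B \<or> degree A dvd degree B"
proof -
  have ncp: "nonconst p" and ncq: "nonconst q" using pq by (simp_all add: indecomposable_nonconst)
  have ncA: "nonconst (to_fract A)" and ncB: "nonconst (to_fract B)"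
    using deg by (simp_all add: nonconst_iff_degree)
  have uA: "u = to_fract A \<circ>\<^sub>R p" and uB: "u = to_fract B \<circ>\<^sub>R q" using u by simp_all
  have ncu: "nonconst u" unfolding uA nonconst_comp_iff using ncA ncp by simp
  have subp: "is_subfield (comp_field p)" using ncp by (rule subfield_comp_field)
  define d where "d = rat_degree p"
  obtain c where c: "\<exists>i\<le>d. c i \<noteq> 0" "(\<Sum>i\<le>d. (c i \<circ>\<^sub>R p) * q ^ i) = 0"
    using relation_exists[OF ncp] unfolding d_def by blast
  define m0 where "m0 = (\<Sum>i\<le>d. monom (c i \<circ>\<^sub>R p) i)"
  have cm0: "coeff m0 i = (if i \<le> d then c i \<circ>\<^sub>R p else 0)" for i
    by (simp add: m0_def coeff_sum)
  have "m0 \<noteq> 0"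
  proof
    assume "m0 = 0"
    then have "c i \<circ>\<^sub>R p = 0" if "i \<le> d" for i using cm0[of i] that by simp
    then show False using c(1) rat_comp_eq_0_iff[OF ncp] by blast
  qed
  moreover have "coeff m0 i \<in> comp_field p" for i
    unfolding cm0 using is_subfieldD(1)[OF subp] comp_fieldI by simp
  moreover have "poly m0 q = 0" using c(2) by (simp add: m0_def poly_sum poly_monom)
  ultimately obtain m where m: "m \<noteq> 0" "\<And>i. coeff m i \<in> comp_field p" "poly m q = 0" "degree m \<le> degree m0"
    and mdvd: "\<And>M. (\<And>i. coeff M i \<in> comp_field p) \<Longrightarrow> poly M q = 0 \<Longrightarrow>
      \<exists>n. M = m * n \<and> (\<forall>i. coeff n i \<in> comp_field p)"
    using min_relation[OF subp, of m0 q] by metis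
  have degm: "degree m \<le> d"
    using m(4) by (rule order.trans) (rule degree_le, simp add: cm0)
  \<comment> \<open>This is \<open>B(T) - A(x)\<close>; replacing \<open>x\<close> by
    \<open>p\<close> turns it into \<open>B(T) - u\<close>, which vanishes at
    \<open>T = q\<close>.\<close>
  define L where "L = lift_poly B - [:A:]"
  have cL: "coeff L i = [:coeff B i:] - (if i = 0 then A else 0)" for i
    by (simp add: L_def coeff_pCons split: nat.splits)
  have "\<exists>n. map_poly cst B - [:u:] = m * n \<and> (\<forall>i. coeff n i \<in> comp_field p)"
  proof (rule mdvd)
    show "coeff (map_poly cst B - [:u:]) i \<in> comp_field p" for i
      using cst_in_comp_field[of p] comp_fieldI[of "to_fract A" p] uA is_subfieldD(1)[OF subp]
      by (auto simp: coeff_pCons intro!: is_subfieldD(7)[OF subp] split: nat.splits)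
    show "poly (map_poly cst B - [:u:]) q = 0" using u(2) by simp
  qed
  then obtain n where n: "map_poly cst B - [:u:] = m * n" "\<And>i. coeff n i \<in> comp_field p" by blast
  \<comment> \<open>As \<open>p\<close> is transcendental, \<complex>(p) is a copy of \<complex>(x),
    and \<open>pull\<close> is the inverse isomorphism. It moves the factorisation to \<complex>(x),
    where Gauss's lemma yields a factor \<Phi> of \<open>L\<close> with polynomial
    coefficients.\<close>
  define pull where "pull r = (THE s. s \<circ>\<^sub>R p = r)" for r
  have pull_comp: "pull (s \<circ>\<^sub>R p) = s" for s
    unfolding pull_def using rat_comp_inj[OF ncp] by blast
  have pull: "pull r \<circ>\<^sub>R p = r" if "r \<in> comp_field p" for r
    using that by (auto simp: pull_comp elim: comp_fieldE)
  have pull0: "pull 0 = 0" using pull_comp[of 0] by simp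
  define m' where "m' = map_poly pull m"
  define n' where "n' = map_poly pull n"
  have cm': "coeff m' i \<circ>\<^sub>R p = coeff m i" and cn': "coeff n' i \<circ>\<^sub>R p = coeff n i" for i
    using m(2) n(2) by (simp_all add: m'_def n'_def coeff_map_poly pull0 pull)
  have prod: "m' * n' = fract_poly L"
  proof (rule poly_eqI)
    fix i
    have "coeff (m' * n') i \<circ>\<^sub>R p = coeff (m * n) i"
      by (simp add: coeff_mult rat_comp_hom ncp cm' cn')
    also have "\<dots> = coeff (fract_poly L) i \<circ>\<^sub>R p"
      unfolding n(1)[symmetric]
      by (cases i) (simp_all add: coeff_map_poly cL rat_comp_hom ncp u(1) del: to_fract_comp,
        simp_all add: rc.peval_diff)
    finally show "coeff (m' * n') i = coeff (fract_poly L) i" using rat_comp_inj[OF ncp] by blast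
  qed
  have "m' \<noteq> 0"
  proof
    assume "m' = 0"
    then have "coeff m i = 0" for i using cm'[of i] by simp
    then show False using m(1) by (simp add: poly_eq_iff)
  qed
  then obtain \<Phi> e where \<Phi>: "m' = smult e (fract_poly \<Phi>)" "e \<noteq> 0" "content \<Phi> = 1" "degree \<Phi> = degree m'"
    using fract_poly_content_decompose by metis
  define N where "N = degree \<Phi>"
  have Nd: "N \<le> d"
    unfolding N_def \<Phi>(4) m'_def using map_poly_degree_leq degm order.trans by blast
  have "fract_poly \<Phi> dvd fract_poly L"
    unfolding prod[symmetric] \<Phi>(1) mult_smult_left by (intro dvd_smult dvd_triv_left)
  then have "\<Phi> dvd L" using \<Phi>(3) by (rule fract_poly_dvdD)
  then obtain \<Psi> where \<Psi>: "L = \<Phi> * \<Psi>" by blast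
  have \<Phi>0: "\<Phi> \<noteq> 0" using \<Phi>(3) by auto
  have ep: "e \<circ>\<^sub>R p \<noteq> 0" using \<Phi>(2) rat_comp_eq_0_iff[OF ncp] by blast
  have cm: "coeff m i = (e \<circ>\<^sub>R p) * (to_fract (coeff \<Phi> i) \<circ>\<^sub>R p)" for i
    unfolding cm'[symmetric] \<Phi>(1) by (simp add: coeff_map_poly rat_comp_mult[OF ncp])
  have "(e \<circ>\<^sub>R p) * (\<Sum>i\<le>N. (to_fract (coeff \<Phi> i) \<circ>\<^sub>R p) * q ^ i) = (\<Sum>i\<le>N. coeff m i * q ^ i)"
    by (simp only: sum_distrib_left cm mult.assoc)
  also have "\<dots> = poly m q"
  proof -
    have "coeff m i = 0" if "i > N" for i
      unfolding cm using that coeff_eq_0[of \<Phi> i] by (simp add: N_def)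
    then have "degree m \<le> N" by (intro degree_le) auto
    then show ?thesis
      unfolding poly_altdef by (intro sum.mono_neutral_right) (auto simp: coeff_eq_0)
  qed
  finally have rel: "(\<Sum>i\<le>N. (to_fract (coeff \<Phi> i) \<circ>\<^sub>R p) * q ^ i) = 0"
    using m(3) ep by simp
  define S where "S = insert (to_fract A) (range (\<lambda>k. to_fract (coeff \<Phi> k)))"
  have SA: "to_fract A \<in> gen_field S" and S\<Phi>: "to_fract (coeff \<Phi> k) \<in> gen_field S" for k
    using gen_field_superset[of S] by (auto simp: S_def)
  obtain r where r: "nonconst r" "gen_field S = comp_field r"
    using Lueroth[OF subfield_gen_field cst_in_gen_field SA ncA] by metis
  have "\<forall>k. \<exists>s. to_fract (coeff \<Phi> k) = s \<circ>\<^sub>R r" using S\<Phi> unfolding r(2) by (metis comp_fieldE)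
  then obtain s where s: "\<And>k. to_fract (coeff \<Phi> k) = s k \<circ>\<^sub>R r" by metis
  obtain t where t: "to_fract A = t \<circ>\<^sub>R r" using SA unfolding r(2) by (rule comp_fieldE)
  define h where "h = r \<circ>\<^sub>R p"
  have nch: "nonconst h" unfolding h_def nonconst_comp_iff using r(1) ncp by simp
  have sh: "to_fract (coeff \<Phi> k) \<circ>\<^sub>R p = s k \<circ>\<^sub>R h" for k
    unfolding s h_def by (rule rat_comp_assoc[OF ncp])
  have uh: "u \<in> comp_field h"
    unfolding uA t h_def rat_comp_assoc[OF ncp] by (rule comp_fieldI)
  have sN: "s N \<noteq> 0" using s[of N] \<Phi>0 by (auto simp: N_def)
  have relh: "(\<Sum>i\<le>N. (s i \<circ>\<^sub>R h) * q ^ i) = 0" using rel unfolding sh .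
  have hp: "h \<in> comp_field p" unfolding h_def by (rule comp_fieldI)
  show ?thesis
  proof (cases "h \<in> comp_field q")
    case True
    have "h \<in> comp_field u"
      by (rule comp_field_eqI[OF ncu uh]) (rule min[OF hp True uh])
    then obtain v where v: "h = v \<circ>\<^sub>R u" by (rule comp_fieldE)
    then have ncv: "nonconst v" using nch by (simp only: nonconst_comp_iff)
    \<comment> \<open>\<open>h\<close> and \<open>u\<close> generate the same field and
      \<open>u\<close> is \<open>B \<circ> q\<close>. Cancelling \<open>q\<close> on the right turns
      the relation for \<open>q\<close> into one for \<open>x\<close> over \<complex>(B), which
      forces \<open>degree B \<le> N\<close>.\<close>
    have "(\<Sum>i\<le>N. (((s i \<circ>\<^sub>R v) \<circ>\<^sub>R to_fract B) * ratX ^ i)) \<circ>\<^sub>R q = (\<Sum>i\<le>N. (s i \<circ>\<^sub>R h) * q ^ i)"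
      unfolding v uB by (simp only: rat_comp_hom[OF ncq] rat_comp_assoc[OF ncq] rat_comp_assoc[OF ncu[unfolded uB]] X_comp)
    then have "(\<Sum>i<Suc N. (((s i \<circ>\<^sub>R v) \<circ>\<^sub>R to_fract B) * ratX ^ i)) = 0"
      using relh rat_comp_eq_0_iff[OF ncq] by (simp only: lessThan_Suc_atMost)
    then have "s N \<circ>\<^sub>R v = 0" if "Suc N \<le> degree B"
      using powers_X_independent[OF ncB, where r = "\<lambda>i. s i \<circ>\<^sub>R v" and k = "Suc N" and i = N] that by simp
    then have "degree B \<le> N" using sN rat_comp_eq_0_iff[OF ncv] by (meson not_less_eq_eq)
    moreover have "d \<le> degree B"
      using rat_degree_le_of_common_multiple[OF uB uA ncu indecomposable_maximal[OF pq(1,3)]]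
      by (simp add: d_def)
    ultimately show ?thesis using Nd by (simp add: d_def)
  next
    case False
    then have "ratX \<in> gen_field {h, q}"
      using indecomposable_maximal[OF pq(2)] by (simp add: insert_commute)
    then have "rat_degree h \<le> N"
      using rat_degree_le_of_relation[OF nch _ relh] sN by blast
    then have "rat_degree h \<le> d" using Nd by (rule order.trans)
    then have "rat_degree r * d \<le> 1 * d" by (simp only: h_def rat_degree_comp d_def mult_1)
    moreover have "d > 0" using ncp by (simp add: d_def nonconst_iff_degree)
    ultimately have "rat_degree r \<le> 1" by (simp only: mult_le_cancel2)
    \<comment> \<open>\<open>r\<close> has degree 1, so \<open>A\<close> and the coefficients of
      \<Phi> generate all of \<complex>(x), as the argument with branches at infinity
      requires.\<close>
    then have "ratX \<in> comp_field r"
      using comp_field_eqI[OF r(1), of ratX] comp_fieldI[of r ratX] by simp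
    then have "ratX \<in> gen_field S" by (simp only: r(2))
    then have "degree A dvd degree B"
      unfolding S_def by (rule factor_coefficients_generate[OF refl deg(1) refl deg(2) \<Psi>[unfolded L_def]])
    then show ?thesis by blast
  qed
qed

lemma exchangeable_or_power:
  assumes pq: "indecomposable p" "indecomposable q" "q \<notin> comp_field p"
    and L: "p \<in> laurent_polys" "q \<in> laurent_polys"
    and f: "f \<in> laurent_polys" "nonconst f" "f = to_fract F \<circ>\<^sub>R p" "f = to_fract G \<circ>\<^sub>R q"
  shows "exchangeable f p q \<or> (\<exists>k. prime k \<and> f \<in> comp_field (ratX ^ k))"
proof -
  have ncp: "nonconst p" and ncq: "nonconst q" using pq by (simp_all add: indecomposable_nonconst)
  have pq': "p \<notin> comp_field q"
  proof
    assume "p \<in> comp_field q"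
    then obtain r where r: "p = r \<circ>\<^sub>R q" by (rule comp_fieldE)
    have "rat_degree q \<noteq> 1" using pq(2) by (simp add: indecomposable_def)
    then have "rat_degree r = 1" using indecomposable_comp_cases[OF pq(1) r] by blast
    then have "q \<in> comp_field p"
      using comp_field_eqI[of p q] ncp r comp_fieldI by (simp add: rat_degree_comp)
    then show False using pq(3) by blast
  qed
  obtain u0 where u0: "minimal_common f p q u0" using minimal_common_exists f(3,4) comp_fieldI by metis
  obtain a0 where a0: "u0 = a0 \<circ>\<^sub>R p" using u0 unfolding minimal_common_def by (auto elim: comp_fieldE)
  obtain b0 where b0: "u0 = b0 \<circ>\<^sub>R q" using u0 unfolding minimal_common_def by (auto elim: comp_fieldE)
  obtain w0 where w0: "f = w0 \<circ>\<^sub>R u0" using u0 unfolding minimal_common_def by (auto elim: comp_fieldE)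
  have nc0: "nonconst w0" "nonconst u0" using f(2) unfolding w0 nonconst_comp_iff by simp_all
  then have nca: "nonconst a0" "nonconst b0"
    using a0 b0 nonconst_comp_iff by metis+
  have "(w0 \<circ>\<^sub>R a0) \<circ>\<^sub>R p = to_fract F \<circ>\<^sub>R p" using w0 a0 f(3) by (simp only: rat_comp_assoc[OF ncp])
  then have "w0 \<circ>\<^sub>R a0 = to_fract F" using rat_comp_inj[OF ncp] by blast
  \<comment> \<open>Minimality concerns only degrees, so \<open>u0\<close> may be changed by a
    Moebius map. \<mu> makes the part of \<open>f\<close> to the left of \<open>u\<close> a
    polynomial, and then both left factors of \<open>u\<close> become polynomials as well.\<close>
  then obtain \<mu> W A where \<mu>: "rat_degree \<mu> = 1" "w0 = to_fract W \<circ>\<^sub>R \<mu>" "\<mu> \<circ>\<^sub>R a0 = to_fract A"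
    using polynomial_normalise[OF _ nc0(1) nca(1)] by metis
  have nc\<mu>: "nonconst \<mu>" using \<mu>(1) by (simp add: nonconst_iff_degree)
  have ncW: "nonconst (to_fract W)" using nc0(1) unfolding \<mu>(2) nonconst_comp_iff by simp
  define u where "u = \<mu> \<circ>\<^sub>R u0"
  have ncu: "nonconst u" unfolding u_def nonconst_comp_iff using nc\<mu> nc0 by simp
  have uA: "u = to_fract A \<circ>\<^sub>R p" unfolding u_def a0 \<mu>(3)[symmetric] by (rule rat_comp_assoc[OF ncp, symmetric])
  define b where "b = \<mu> \<circ>\<^sub>R b0"
  have ub: "u = b \<circ>\<^sub>R q" unfolding u_def b0 b_def by (rule rat_comp_assoc[OF ncq, symmetric])
  have fu: "f = to_fract W \<circ>\<^sub>R u" unfolding u_def w0 \<mu>(2) by (rule rat_comp_assoc[OF nc0(2)])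
  have "(to_fract W \<circ>\<^sub>R b) \<circ>\<^sub>R q = to_fract G \<circ>\<^sub>R q" using fu ub f(4) by (simp only: rat_comp_assoc[OF ncq])
  then have "to_fract W \<circ>\<^sub>R b = to_fract G" using rat_comp_inj[OF ncq] by blast
  moreover have ncb: "nonconst b" using ncu unfolding ub nonconst_comp_iff by simp
  ultimately obtain B where B: "b = to_fract B" using polynomial_right_factor[OF ncW] by blast
  have uB: "u = to_fract B \<circ>\<^sub>R q" using ub B by simp
  have pe: "u = rc.peval A p" "u = rc.peval B q" using uA uB by simp_all
  have deg: "degree A \<ge> 1" "degree B \<ge> 1"
  proof -
    have "nonconst (to_fract A)" using ncu unfolding uA nonconst_comp_iff by simp
    then show "degree A \<ge> 1" by (simp add: nonconst_iff_degree)
    show "degree B \<ge> 1" using ncb B by (simp add: nonconst_iff_degree)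
  qed
  have min: "minimal_common f p q u"
    unfolding minimal_common_def
  proof (intro conjI allI impI)
    show "u \<in> comp_field p" "u \<in> comp_field q" "f \<in> comp_field u"
      using uA ub fu comp_fieldI by metis+
    fix h assume "h \<in> comp_field p" "h \<in> comp_field q" "f \<in> comp_field h"
    then have "rat_degree u0 \<le> rat_degree h" using u0 unfolding minimal_common_def by blast
    then show "rat_degree u \<le> rat_degree h" by (simp add: u_def rat_degree_comp \<mu>(1))
  qed
  have m: "rat_degree u \<le> rat_degree h"
    if h: "h \<in> comp_field p" "h \<in> comp_field q" "u \<in> comp_field h" for h
  proof -
    have "nonconst h" using h(3) ncu by (auto simp: nonconst_comp_iff elim: comp_fieldE)
    then have "f \<in> comp_field h" using comp_field_trans h(3) min unfolding minimal_common_def by blast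
    then show ?thesis using min h unfolding minimal_common_def by blast
  qed
  have degs: "degree A * rat_degree p = degree B * rat_degree q"
    using arg_cong[OF trans[OF uA[symmetric] uB], of rat_degree] by (simp only: rat_degree_comp rat_degree_to_fract)
  \<comment> \<open>The dichotomy is used with \<open>p\<close> and \<open>q\<close> in both orders;
    if neither equality holds, \<open>degree A\<close> and \<open>degree B\<close> divide each
    other.\<close>
  consider "rat_degree p = degree B" | "rat_degree q = degree A" | "degree A = degree B"
    using minimal_polynomial_dichotomy[OF pq pe deg m]
      minimal_polynomial_dichotomy[OF pq(2,1) pq' pe(2,1) deg(2,1) m] dvd_antisym by blast
  then show ?thesis
  proof cases
    case 1
    then show ?thesis using exchangeable_of_minimal[OF pq(1,2) f(2) min uB] by simp
  next
    case 2
    then have "rat_degree p = degree B" using degs deg by (metis mult.commute mult_cancel1 not_one_le_zero)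
    then show ?thesis using exchangeable_of_minimal[OF pq(1,2) f(2) min uB] by simp
  next
    case 3
    consider \<alpha> \<beta> where "\<alpha> \<noteq> 0" "q = cst \<alpha> * p + cst \<beta>" |
      n t v w t' v' w' where "n \<ge> 1" "t \<noteq> 0" "w \<noteq> 0" "t' \<noteq> 0" "w' \<noteq> 0"
        "p = cst t * ratX ^ n + cst v + cst w / ratX ^ n"
        "q = cst t' * ratX ^ n + cst v' + cst w' / ratX ^ n"
      using equal_degree_dihedral[OF refl 3[symmetric] deg(1) L ncp] pe by metis
    then show ?thesis
    proof cases
      case 1
      then show ?thesis using comp_field_affine(1)[OF 1(1) ncp] pq(3) by blast
    next
      case (2 n t v w t' v' w')
      define c where "c = w / t"
      define c' where "c' = w' / t'"
      have c: "c \<noteq> 0" "c' \<noteq> 0" using 2 by (simp_all add: c_def c'_def)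
      have cp: "comp_field p = comp_field (ratX + cst c / ratX)"
        unfolding c_def by (rule dihedral_indecomposable(1)[OF pq(1) 2(6,1,2,3)])
      have cq: "comp_field q = comp_field (ratX + cst c' / ratX)"
        unfolding c'_def by (rule dihedral_indecomposable(1)[OF pq(2) 2(7,1,4,5)])
      have ne: "c' \<noteq> c" using cp cq pq(3) self_in_comp_field[of q] by auto
      have "f \<in> comp_field p" "f \<in> comp_field q" using f(3,4) comp_fieldI by metis+
      then have inv: "f \<circ>\<^sub>R (cst c / ratX) = f" "f \<circ>\<^sub>R (cst c' / ratX) = f"
        unfolding cp cq in_comp_field_joukowski_iff[OF c(1)] in_comp_field_joukowski_iff[OF c(2)] by blast+
      have nc': "nonconst (cst c' / ratX)" using c(2) by (rule nonconst_const_over_X)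
      \<comment> \<open>The product of the two involutions is a scaling, nontrivial because
        \<open>c\<close> and \<open>c'\<close> differ.\<close>
      have "(cst c / ratX) \<circ>\<^sub>R (cst c' / ratX) = cst (c / c') * ratX"
        using c by (simp add: rat_comp_hom nc' rc.\<kappa>_divide)
      then have "f \<circ>\<^sub>R (cst (c / c') * ratX) = (f \<circ>\<^sub>R (cst c / ratX)) \<circ>\<^sub>R (cst c' / ratX)"
        by (simp only: rat_comp_assoc[OF nc'])
      also have "\<dots> = f" by (simp only: inv)
      finally have "f \<circ>\<^sub>R (cst (c / c') * ratX) = f" .
      then show ?thesis
        using scaling_invariant_in_power_field[OF f(1,2), of "c / c'"] c ne by (metis divide_eq_0_iff divide_eq_1_iff)
    qed
  qed
qed

section \<open>Chains of complete decompositions\<close>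

lemma rat_comp_list_Nil [simp]: "rat_comp_list [] = ratX"
  and rat_comp_list_Cons [simp]: "rat_comp_list (p # ps) = p \<circ>\<^sub>R rat_comp_list ps"
  by (simp_all add: rat_comp_list_def)

lemma nonconst_rat_comp_list: "(\<forall>p\<in>set ps. indecomposable p) \<Longrightarrow> nonconst (rat_comp_list ps)"
  by (induction ps) (auto simp: nonconst_comp_iff indecomposable_nonconst)

lemma rat_comp_list_append:
  assumes "\<forall>p\<in>set qs. indecomposable p"
  shows "rat_comp_list (ps @ qs) = rat_comp_list ps \<circ>\<^sub>R rat_comp_list qs"
  by (induction ps) (simp_all add: rat_comp_assoc nonconst_rat_comp_list[OF assms])

lemma rat_comp_list_snoc:
  "indecomposable p \<Longrightarrow> rat_comp_list (ps @ [p]) = rat_comp_list ps \<circ>\<^sub>R p"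
  by (simp add: rat_comp_list_append)

lemma rat_degree_rat_comp_list_gt_1:
  assumes "ps \<noteq> []" "\<forall>p\<in>set ps. indecomposable p"
  shows "rat_degree (rat_comp_list ps) > 1"
proof (cases ps)
  case (Cons p qs)
  have "rat_degree p > 1" using assms Cons by (simp add: indecomposable_def)
  moreover have "rat_degree (rat_comp_list qs) > 0"
    using nonconst_rat_comp_list[of qs] assms Cons by (simp add: nonconst_iff_degree)
  ultimately have "rat_degree p * rat_degree (rat_comp_list qs) > 1"
    by (metis One_nat_def less_1_mult mult.right_neutral nat_neq_iff not_less_eq less_one)
  then show ?thesis by (simp add: Cons rat_degree_comp)
qed (use assms in simp)

lemma complete_snoc:
  assumes "ps \<noteq> []"
  shows "complete_decomposition (ps @ [p]) f \<longleftrightarrow>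
    complete_decomposition ps (rat_comp_list ps) \<and> indecomposable p \<and> f = rat_comp_list ps \<circ>\<^sub>R p"
  using assms by (auto simp: complete_decomposition_def rat_comp_list_snoc)

lemma complete_singleton: "complete_decomposition [p] f \<longleftrightarrow> indecomposable p \<and> f = p"
  by (auto simp: complete_decomposition_def)

lemma complete_eq: "complete_decomposition ps f \<Longrightarrow> f = rat_comp_list ps"
  by (simp add: complete_decomposition_def)

lemma complete_decomposition_exists:
  "rat_degree f > 1 \<Longrightarrow> \<exists>ps. complete_decomposition ps f"
proof (induction "rat_degree f" arbitrary: f rule: less_induct)
  case less
  show ?case
  proof (cases "indecomposable f")
    case True
    then have "complete_decomposition [f] f" by (simp add: complete_singleton)
    then show ?thesis by blast
  next
    case False
    then obtain g h where gh: "f = g \<circ>\<^sub>R h" "rat_degree g < rat_degree f" "rat_degree h < rat_degree f"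
      using less.prems by (auto simp: indecomposable_def)
    have prod: "rat_degree f = rat_degree g * rat_degree h" unfolding gh(1) by (rule rat_degree_comp)
    have "rat_degree g > 1"
    proof (rule ccontr)
      assume "\<not> rat_degree g > 1"
      then have "rat_degree g * rat_degree h \<le> 1 * rat_degree h" by (intro mult_le_mono1) simp
      then show False using prod gh(3) by simp
    qed
    moreover have "rat_degree h > 1"
    proof (rule ccontr)
      assume "\<not> rat_degree h > 1"
      then have "rat_degree g * rat_degree h \<le> rat_degree g * 1" by (intro mult_le_mono2) simp
      then show False using prod gh(2) by simp
    qed
    ultimately obtain ps qs where c: "complete_decomposition ps g" "complete_decomposition qs h"
      using less.hyps gh(2,3) by blast
    then have "complete_decomposition (ps @ qs) f"
      using gh(1) by (auto simp: complete_decomposition_def rat_comp_list_append)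
    then show ?thesis by blast
  qed
qed

lemma indecomposable_left_unit:
  assumes "indecomposable p" "rat_degree \<mu> = 1"
  shows "indecomposable (\<mu> \<circ>\<^sub>R p)"
  unfolding indecomposable_def
proof (intro conjI notI)
  have deg: "rat_degree (\<mu> \<circ>\<^sub>R p) = rat_degree p" using assms(2) by (simp add: rat_degree_comp)
  show "rat_degree (\<mu> \<circ>\<^sub>R p) > 1" unfolding deg using assms(1) by (simp add: indecomposable_def)
  obtain \<nu> where \<nu>: "rat_degree \<nu> = 1" "\<nu> \<circ>\<^sub>R \<mu> = ratX" using degree_1_invertible[OF assms(2)] by metis
  assume "\<exists>g h. \<mu> \<circ>\<^sub>R p = g \<circ>\<^sub>R h \<and> rat_degree g < rat_degree (\<mu> \<circ>\<^sub>R p) \<and> rat_degree h < rat_degree (\<mu> \<circ>\<^sub>R p)"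
  then obtain g h where gh: "\<mu> \<circ>\<^sub>R p = g \<circ>\<^sub>R h" "rat_degree g < rat_degree p" "rat_degree h < rat_degree p"
    unfolding deg by blast
  have ncp: "nonconst p" using assms(1) by (rule indecomposable_nonconst)
  have "nonconst (\<mu> \<circ>\<^sub>R p)"
    using assms(1) deg by (simp add: nonconst_iff_degree indecomposable_def)
  then have nch: "nonconst h" unfolding gh(1) nonconst_comp_iff by simp
  have "p = (\<nu> \<circ>\<^sub>R \<mu>) \<circ>\<^sub>R p" by (simp add: \<nu>(2))
  also have "\<dots> = (\<nu> \<circ>\<^sub>R g) \<circ>\<^sub>R h" by (simp only: rat_comp_assoc[OF ncp] rat_comp_assoc[OF nch] gh(1))
  finally have "p = (\<nu> \<circ>\<^sub>R g) \<circ>\<^sub>R h" .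
  moreover have "rat_degree (\<nu> \<circ>\<^sub>R g) < rat_degree p" using gh(2) \<nu>(1) by (simp add: rat_degree_comp)
  ultimately show False using assms(1) gh(3) unfolding indecomposable_def by blast
qed

lemma indecomposable_right_unit:
  assumes "indecomposable p" "rat_degree \<nu> = 1"
  shows "indecomposable (p \<circ>\<^sub>R \<nu>)"
  unfolding indecomposable_def
proof (intro conjI notI)
  have deg: "rat_degree (p \<circ>\<^sub>R \<nu>) = rat_degree p" using assms(2) by (simp add: rat_degree_comp)
  show "rat_degree (p \<circ>\<^sub>R \<nu>) > 1" unfolding deg using assms(1) by (simp add: indecomposable_def)
  obtain \<mu> where \<mu>: "rat_degree \<mu> = 1" "\<nu> \<circ>\<^sub>R \<mu> = ratX" using degree_1_invertible[OF assms(2)] by metis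
  assume "\<exists>g h. p \<circ>\<^sub>R \<nu> = g \<circ>\<^sub>R h \<and> rat_degree g < rat_degree (p \<circ>\<^sub>R \<nu>) \<and> rat_degree h < rat_degree (p \<circ>\<^sub>R \<nu>)"
  then obtain g h where gh: "p \<circ>\<^sub>R \<nu> = g \<circ>\<^sub>R h" "rat_degree g < rat_degree p" "rat_degree h < rat_degree p"
    unfolding deg by blast
  have nc\<mu>: "nonconst \<mu>" using \<mu>(1) by (simp add: nonconst_iff_degree)
  have "p = p \<circ>\<^sub>R (\<nu> \<circ>\<^sub>R \<mu>)" by (simp add: \<mu>(2))
  also have "\<dots> = (g \<circ>\<^sub>R h) \<circ>\<^sub>R \<mu>" by (simp only: rat_comp_assoc[OF nc\<mu>, symmetric] gh(1))
  also have "\<dots> = g \<circ>\<^sub>R (h \<circ>\<^sub>R \<mu>)" by (rule rat_comp_assoc[OF nc\<mu>])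
  finally have "p = g \<circ>\<^sub>R (h \<circ>\<^sub>R \<mu>)" .
  moreover have "rat_degree (h \<circ>\<^sub>R \<mu>) < rat_degree p" using gh(3) \<mu>(1) by (simp add: rat_degree_comp)
  ultimately show False using assms(1) gh(2) unfolding indecomposable_def by blast
qed

definition complete_step :: "ratfun \<Rightarrow> ratfun list \<Rightarrow> ratfun list \<Rightarrow> bool" where
  "complete_step f D E \<longleftrightarrow> complete_decomposition D f \<and> complete_decomposition E f \<and> ritt_step D E"

text \<open>The degrees are carried along separately because a single step, replacing a pair by
  another with the same composition, by itself preserves only the product of the two
  degrees.\<close>

definition linked :: "ratfun \<Rightarrow> ratfun list \<Rightarrow> ratfun list \<Rightarrow> bool" where
  "linked f D E \<longleftrightarrow> mset (map rat_degree D) = mset (map rat_degree E) \<and> (complete_step f)\<^sup>*\<^sup>* D E"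

lemma linked_refl: "linked f D D"
  by (simp add: linked_def)

lemma linked_trans: "linked f C D \<Longrightarrow> linked f D E \<Longrightarrow> linked f C E"
  by (auto simp: linked_def)

lemma linked_sym:
  assumes "linked f D E" shows "linked f E D"
proof -
  have "ritt_step x y \<Longrightarrow> ritt_step y x" for x y
    unfolding ritt_step_def by metis
  then have step: "complete_step f x y \<Longrightarrow> complete_step f y x" for x y
    by (auto simp: complete_step_def)
  have "(complete_step f)\<^sup>*\<^sup>* D E" using assms by (simp add: linked_def)
  then have "(complete_step f)\<^sup>*\<^sup>* E D"
    by (induction rule: rtranclp_induct) (auto intro: converse_rtranclp_into_rtranclp step)
  then show ?thesis using assms by (simp add: linked_def)
qed

lemma linked_snoc:
  assumes "linked F D E" "indecomposable p"
  shows "linked (F \<circ>\<^sub>R p) (D @ [p]) (E @ [p])"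
proof -
  have step: "complete_step (F \<circ>\<^sub>R p) (x @ [p]) (y @ [p])" if xy: "complete_step F x y" for x y
  proof -
    have c: "complete_decomposition (z @ [p]) (F \<circ>\<^sub>R p)" if "complete_decomposition z F" for z
      using that assms(2) by (auto simp: complete_decomposition_def rat_comp_list_snoc)
    have "ritt_step (x @ [p]) (y @ [p])"
      using xy unfolding complete_step_def ritt_step_def by (metis append.assoc)
    then show ?thesis using c xy by (simp add: complete_step_def)
  qed
  have "(complete_step F)\<^sup>*\<^sup>* D E" using assms(1) by (simp add: linked_def)
  then have "(complete_step (F \<circ>\<^sub>R p))\<^sup>*\<^sup>* (D @ [p]) (E @ [p])"
    by (induction rule: rtranclp_induct) (auto intro: rtranclp.rtrancl_into_rtrancl step)
  then show ?thesis using assms(1) by (simp add: linked_def)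
qed

text \<open>Equal pairs do not form a \<open>ritt_step\<close>; they are joined by the chain of
  length zero.\<close>

lemma linked_last_two:
  assumes c: "complete_decomposition (us @ [a, p]) f" "complete_decomposition (us @ [b, q]) f"
    and eq: "a \<circ>\<^sub>R p = b \<circ>\<^sub>R q" and deg: "{#rat_degree a, rat_degree p#} = {#rat_degree b, rat_degree q#}"
  shows "linked f (us @ [a, p]) (us @ [b, q])"
proof (cases "(a, p) = (b, q)")
  case False
  then have "ritt_step (us @ [a, p]) (us @ [b, q])"
    unfolding ritt_step_def using eq by (intro exI[of _ us] exI[of _ "[]"]) auto
  then have "(complete_step f)\<^sup>*\<^sup>* (us @ [a, p]) (us @ [b, q])"
    using c by (intro r_into_rtranclp) (simp add: complete_step_def)
  then show ?thesis using deg by (simp add: linked_def)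
qed (simp add: linked_refl)

text \<open>Inserting \<mu> and its inverse between the last two functions keeps their composition,
  so a change of variable costs at most one step. It needs a function to the left of
  \<open>p\<close>, hence \<open>ps \<noteq> []\<close>.\<close>

lemma linked_unit:
  assumes ps: "ps \<noteq> []" and c: "complete_decomposition (ps @ [p]) f"
    and \<mu>: "rat_degree \<mu> = 1" "rat_comp_list ps = G \<circ>\<^sub>R \<mu>"
  obtains ps1 where "ps1 \<noteq> []" "complete_decomposition ps1 G" "indecomposable (\<mu> \<circ>\<^sub>R p)"
    "linked f (ps @ [p]) (ps1 @ [\<mu> \<circ>\<^sub>R p])"
proof -
  obtain us a where us: "ps = us @ [a]" using ps by (metis rev_exhaust)
  have ind: "indecomposable p" "indecomposable a" "\<forall>x\<in>set us. indecomposable x"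
    using c by (auto simp: complete_decomposition_def us)
  obtain \<nu> where \<nu>: "rat_degree \<nu> = 1" "\<nu> \<circ>\<^sub>R \<mu> = ratX" "\<mu> \<circ>\<^sub>R \<nu> = ratX"
    using degree_1_invertible[OF \<mu>(1)] by metis
  have nc: "nonconst \<mu>" "nonconst \<nu>" "nonconst p"
    using \<mu>(1) \<nu>(1) ind(1) by (simp_all add: nonconst_iff_degree indecomposable_def)
  define ps1 where "ps1 = us @ [a \<circ>\<^sub>R \<nu>]"
  have ind': "indecomposable (a \<circ>\<^sub>R \<nu>)" "indecomposable (\<mu> \<circ>\<^sub>R p)"
    using indecomposable_right_unit[OF ind(2) \<nu>(1)] indecomposable_left_unit[OF ind(1) \<mu>(1)] by auto
  have "G = (G \<circ>\<^sub>R \<mu>) \<circ>\<^sub>R \<nu>" by (simp add: rat_comp_assoc[OF nc(2)] \<nu>(3))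
  also have "\<dots> = (rat_comp_list us \<circ>\<^sub>R a) \<circ>\<^sub>R \<nu>"
    unfolding \<mu>(2)[symmetric] us rat_comp_list_snoc[OF ind(2)] ..
  also have "\<dots> = rat_comp_list ps1"
    unfolding ps1_def rat_comp_list_snoc[OF ind'(1)] by (rule rat_comp_assoc[OF nc(2)])
  finally have G: "G = rat_comp_list ps1" .
  then have cG: "complete_decomposition ps1 G"
    using ind ind' by (auto simp: complete_decomposition_def ps1_def)
  have eq: "a \<circ>\<^sub>R p = (a \<circ>\<^sub>R \<nu>) \<circ>\<^sub>R (\<mu> \<circ>\<^sub>R p)"
  proof -
    have "nonconst (\<mu> \<circ>\<^sub>R p)" using ind'(2) by (rule indecomposable_nonconst)
    then have "(a \<circ>\<^sub>R \<nu>) \<circ>\<^sub>R (\<mu> \<circ>\<^sub>R p) = a \<circ>\<^sub>R ((\<nu> \<circ>\<^sub>R \<mu>) \<circ>\<^sub>R p)"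
      by (simp only: rat_comp_assoc nc(3))
    then show ?thesis by (simp add: \<nu>(2))
  qed
  have f: "f = rat_comp_list us \<circ>\<^sub>R (a \<circ>\<^sub>R p)"
    using c ind by (simp add: complete_decomposition_def us rat_comp_list_append)
  have c': "complete_decomposition (us @ [a \<circ>\<^sub>R \<nu>, \<mu> \<circ>\<^sub>R p]) f"
    using ind ind' f eq by (auto simp: complete_decomposition_def rat_comp_list_append)
  have "linked f (us @ [a, p]) (us @ [a \<circ>\<^sub>R \<nu>, \<mu> \<circ>\<^sub>R p])"
    by (rule linked_last_two[OF _ c' eq])
      (use c \<mu>(1) \<nu>(1) in \<open>simp_all add: us rat_degree_comp\<close>)
  then show ?thesis using that[of ps1] cG ind' by (simp add: ps1_def us)
qed

section \<open>The inductive step for given right factors\<close>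

context
  fixes f :: ratfun
  assumes IH: "\<And>F ps qs. rat_degree F < rat_degree f \<Longrightarrow> F \<in> laurent_polys \<Longrightarrow>
    complete_decomposition ps F \<Longrightarrow> complete_decomposition qs F \<Longrightarrow> linked F ps qs"
begin

lemma linked_exchangeable:
  assumes ps: "complete_decomposition ps F" "F \<in> laurent_polys" "f = F \<circ>\<^sub>R p" "indecomposable p"
    and qs: "complete_decomposition qs G" "G \<in> laurent_polys" "f = G \<circ>\<^sub>R q" "indecomposable q"
    and or: "q \<in> comp_field p \<or> exchangeable f p q"
  shows "linked f (ps @ [p]) (qs @ [q])"
proof -
  have ncp: "nonconst p" and ncq: "nonconst q" using ps qs by (simp_all add: indecomposable_nonconst)
  have ne: "ps \<noteq> []" "qs \<noteq> []" using ps(1) qs(1) by (simp_all add: complete_decomposition_def)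
  have F: "F = rat_comp_list ps" and G: "G = rat_comp_list qs" using ps(1) qs(1) by (simp_all add: complete_eq)
  have ncF: "nonconst F" "nonconst G"
    using ps(1) qs(1) nonconst_rat_comp_list by (auto simp: complete_decomposition_def)
  have lt: "rat_degree F < rat_degree f" "rat_degree G < rat_degree f"
  proof -
    have "rat_degree p > 1" "rat_degree q > 1" using ps(4) qs(4) by (simp_all add: indecomposable_def)
    moreover have "rat_degree F > 0" "rat_degree G > 0" using ncF by (simp_all add: nonconst_iff_degree)
    ultimately have "rat_degree F < rat_degree F * rat_degree p" "rat_degree G < rat_degree G * rat_degree q"
      by simp_all
    then show "rat_degree F < rat_degree f" "rat_degree G < rat_degree f"
      using rat_degree_comp[of F p] rat_degree_comp[of G q] ps(3) qs(3) by metis+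
  qed
  from or show ?thesis
  proof
    assume "q \<in> comp_field p"
    then obtain r where r: "q = r \<circ>\<^sub>R p" by (rule comp_fieldE)
    have "rat_degree p \<noteq> 1" using ps(4) by (simp add: indecomposable_def)
    \<comment> \<open>The two right factors differ by a function of degree 1, which
      \<open>linked_unit\<close> moves into the left part.\<close>
    then have r1: "rat_degree r = 1" using indecomposable_comp_cases[OF qs(4) r] by blast
    obtain \<mu> where \<mu>: "rat_degree \<mu> = 1" "\<mu> \<circ>\<^sub>R r = ratX" "r \<circ>\<^sub>R \<mu> = ratX"
      using degree_1_invertible[OF r1] by metis
    have nc\<mu>: "nonconst \<mu>" "nonconst r" using \<mu>(1) r1 by (simp_all add: nonconst_iff_degree)
    have "(G \<circ>\<^sub>R r) \<circ>\<^sub>R p = F \<circ>\<^sub>R p" using ps(3) qs(3) r by (simp only: rat_comp_assoc[OF ncp])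
    then have "G \<circ>\<^sub>R r = F" using rat_comp_inj[OF ncp] by blast
    then have GF: "G = F \<circ>\<^sub>R \<mu>" using rat_comp_assoc[OF nc\<mu>(1), of G r] \<mu>(3) by simp
    have p: "\<mu> \<circ>\<^sub>R q = p" using rat_comp_assoc[OF ncp, of \<mu> r] \<mu>(2) r by simp
    have "complete_decomposition (qs @ [q]) f"
      unfolding complete_snoc[OF ne(2)] using qs G by simp
    then obtain qs1 where "complete_decomposition qs1 F" "linked f (qs @ [q]) (qs1 @ [p])"
      using linked_unit[OF ne(2) _ \<mu>(1), of q f F] GF G p by metis
    moreover from this have "linked f (ps @ [p]) (qs1 @ [p])"
      using linked_snoc[OF IH[OF lt(1) ps(2,1)] ps(4)] ps(3) by simp
    ultimately show ?thesis using linked_trans linked_sym by blast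
  next
    assume "exchangeable f p q"
    then obtain a b w where ab: "f = w \<circ>\<^sub>R (a \<circ>\<^sub>R p)" "a \<circ>\<^sub>R p = b \<circ>\<^sub>R q" "indecomposable a" "indecomposable b"
      "rat_degree a = rat_degree q" "rat_degree b = rat_degree p" unfolding exchangeable_def by blast
    have "(w \<circ>\<^sub>R a) \<circ>\<^sub>R p = F \<circ>\<^sub>R p" using ab(1) ps(3) by (simp only: rat_comp_assoc[OF ncp])
    then have wa: "w \<circ>\<^sub>R a = F" using rat_comp_inj[OF ncp] by blast
    have "(w \<circ>\<^sub>R b) \<circ>\<^sub>R q = G \<circ>\<^sub>R q" using ab(1,2) qs(3) by (simp only: rat_comp_assoc[OF ncq])
    then have wb: "w \<circ>\<^sub>R b = G" using rat_comp_inj[OF ncq] by blast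
    have ncw: "nonconst w" using ncF(1) unfolding wa[symmetric] nonconst_comp_iff by simp
    have "\<exists>ws a' b'. complete_decomposition (ws @ [a']) F \<and> complete_decomposition (ws @ [b']) G \<and>
      a' \<circ>\<^sub>R p = b' \<circ>\<^sub>R q \<and> rat_degree a' = rat_degree q \<and> rat_degree b' = rat_degree p"
    proof (cases "rat_degree w = 1")
      case True
      \<comment> \<open>A function \<open>w\<close> of degree 1 has no complete decomposition; it is
        absorbed into \<open>a\<close> and \<open>b\<close>.\<close>
      have "complete_decomposition ([] @ [F]) F" "complete_decomposition ([] @ [G]) G"
        using indecomposable_left_unit[OF ab(3) True] indecomposable_left_unit[OF ab(4) True] wa wb
        by (simp_all add: complete_singleton)
      moreover have "rat_degree F = rat_degree q" "rat_degree G = rat_degree p"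
        using ab(5,6) True by (simp_all add: rat_degree_comp flip: wa wb)
      ultimately show ?thesis using ps(3) qs(3) by metis
    next
      case False
      then have "rat_degree w > 1" using ncw by (simp add: nonconst_iff_degree)
      then obtain ws where ws: "complete_decomposition ws w" using complete_decomposition_exists by blast
      then have "ws \<noteq> []" "rat_comp_list ws = w" by (simp_all add: complete_decomposition_def)
      then have "complete_decomposition (ws @ [a]) F" "complete_decomposition (ws @ [b]) G"
        using ws ab(3,4) wa wb by (simp_all add: complete_snoc)
      then show ?thesis using ab by metis
    qed
    then obtain ws a' b' where w: "complete_decomposition (ws @ [a']) F" "complete_decomposition (ws @ [b']) G"
      "a' \<circ>\<^sub>R p = b' \<circ>\<^sub>R q" "rat_degree a' = rat_degree q" "rat_degree b' = rat_degree p" by blast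
    have "linked f (ps @ [p]) ((ws @ [a']) @ [p])"
      using linked_snoc[OF IH[OF lt(1) ps(2,1) w(1)] ps(4)] ps(3) by simp
    moreover have "linked f (qs @ [q]) ((ws @ [b']) @ [q])"
      using linked_snoc[OF IH[OF lt(2) qs(2,1) w(2)] qs(4)] qs(3) by simp
    moreover have "linked f (ws @ [a', p]) (ws @ [b', q])"
    proof (rule linked_last_two[OF _ _ w(3)])
      have "complete_decomposition ((ws @ [a']) @ [p]) f" "complete_decomposition ((ws @ [b']) @ [q]) f"
        using w(1,2) ps(3,4) qs(3,4) complete_eq[OF w(1)] complete_eq[OF w(2)] by (simp_all add: complete_snoc del: append_assoc)
      then show "complete_decomposition (ws @ [a', p]) f" "complete_decomposition (ws @ [b', q]) f" by simp_all
    qed (simp add: w(4,5) add_mset_commute)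
    ultimately have "linked f (ps @ [p]) (ws @ [a', p])" "linked f (qs @ [q]) (ws @ [b', q])"
      "linked f (ws @ [a', p]) (ws @ [b', q])" by simp_all
    then show ?thesis by (blast intro: linked_trans linked_sym)
  qed
qed

lemma linked_power_polynomial:
  assumes ps: "complete_decomposition ps (to_fract N)" "f = to_fract N \<circ>\<^sub>R p" "indecomposable p" "p \<in> laurent_polys"
    and qs: "complete_decomposition qs G" "f = G \<circ>\<^sub>R ratX ^ k" "indecomposable (ratX ^ k)"
    and f: "f \<in> laurent_polys" "nonconst f"
  shows "linked f (ps @ [p]) (qs @ [ratX ^ k])"
proof -
  have "k \<ge> 1" using indecomposable_power_X_prime[OF qs(3)] prime_ge_1_nat by blast
  then have G: "G \<in> laurent_polys" using laurent_left_of_power f(1) qs(2) by blast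
  have N: "to_fract N \<in> laurent_polys"
    using laurentI[of N 0] by (simp add: Fract_conv_to_fract to_fract_monom)
  have "p \<in> comp_field (ratX ^ k) \<or> exchangeable f (ratX ^ k) p"
    using exchangeable_power_polynomial[OF qs(3) ps(3,4) _ ps(2) _ f(2)] qs(2) comp_fieldI by metis
  then have "linked f (qs @ [ratX ^ k]) (ps @ [p])"
    by (intro linked_exchangeable[OF qs(1) G qs(2,3) ps(1) N ps(2,3)])
  then show ?thesis by (rule linked_sym)
qed

lemma linked_polynomials:
  assumes ps: "complete_decomposition ps (to_fract M)" "f = to_fract M \<circ>\<^sub>R p" "indecomposable p" "p \<in> laurent_polys"
    and qs: "complete_decomposition qs (to_fract N)" "f = to_fract N \<circ>\<^sub>R q" "indecomposable q" "q \<in> laurent_polys"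
    and f: "f \<in> laurent_polys" "nonconst f"
  shows "linked f (ps @ [p]) (qs @ [q])"
proof -
  have L: "to_fract N \<in> laurent_polys" for N
    using laurentI[of N 0] by (simp add: Fract_conv_to_fract to_fract_monom)
  consider "q \<in> comp_field p \<or> exchangeable f p q" | k where "prime k" "f \<in> comp_field (ratX ^ k)"
    using exchangeable_or_power[OF ps(3) qs(3) _ ps(4) qs(4) f ps(2) qs(2)] by blast
  then show ?thesis
  proof cases
    case 1
    then show ?thesis by (intro linked_exchangeable[OF ps(1) L ps(2,3) qs(1) L qs(2,3)])
  next
    case (2 k)
    then obtain H where H: "f = H \<circ>\<^sub>R ratX ^ k" by (auto elim: comp_fieldE)
    have ind: "indecomposable (ratX ^ k)"
      using 2(1) by (intro prime_degree_indecomposable) (simp add: rat_degree_power_X)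
    have "rat_degree H \<noteq> 1"
    proof
      assume "rat_degree H = 1"
      then have "indecomposable f" unfolding H using ind by (rule indecomposable_left_unit[rotated])
      then have "rat_degree (to_fract M) = 1 \<or> rat_degree p = 1"
        using indecomposable_comp_cases ps(2) by blast
      moreover have "rat_degree (to_fract M) > 1"
        using ps(1) rat_degree_rat_comp_list_gt_1[of ps] by (simp add: complete_decomposition_def)
      ultimately show False using ps(3) by (simp add: indecomposable_def)
    qed
    moreover have "nonconst H" using f(2) unfolding H nonconst_comp_iff by simp
    ultimately have "rat_degree H > 1" by (simp add: nonconst_iff_degree)
    then obtain hs where hs: "complete_decomposition hs H" using complete_decomposition_exists by blast
    \<comment> \<open>Both given decompositions are linked to the one ending in \<open>x^k\<close>,
      each by the case of a power against a polynomial left part.\<close>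
    show ?thesis
      using linked_power_polynomial[OF ps hs H ind f] linked_power_polynomial[OF qs hs H ind f]
        linked_trans linked_sym by blast
  qed
qed

end

theorem linked_laurent:
  assumes "f \<in> laurent_polys" "complete_decomposition ps f" "complete_decomposition qs f"
  shows "linked f ps qs"
  using assms
proof (induction "rat_degree f" arbitrary: f ps qs rule: less_induct)
  case less
  note f = less.prems(1)
  have IH: "linked F as bs"
    if "rat_degree F < rat_degree f" "F \<in> laurent_polys" "complete_decomposition as F" "complete_decomposition bs F"
    for F as bs
    using less.hyps that by blast
  \<comment> \<open>With a single entry there is no neighbour into which a unit could be moved. Here
    \<open>f\<close> itself is indecomposable, so the other decomposition also has a single
    entry.\<close>
  have short: "linked f [p] bs"
    if p: "complete_decomposition [p] f" and bs: "complete_decomposition bs f" for p bs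
  proof -
    have ind: "indecomposable f" "p = f" using p by (simp_all add: complete_singleton)
    obtain cs b where cs: "bs = cs @ [b]" using bs by (metis complete_decomposition_def rev_exhaust)
    have "cs = []"
    proof (rule ccontr)
      assume ne: "cs \<noteq> []"
      then have c: "indecomposable b" "f = rat_comp_list cs \<circ>\<^sub>R b" "complete_decomposition cs (rat_comp_list cs)"
        using bs unfolding cs complete_snoc[OF ne] by blast+
      then have "rat_degree (rat_comp_list cs) > 1"
        using rat_degree_rat_comp_list_gt_1[OF ne] by (simp add: complete_decomposition_def)
      moreover have "rat_degree b > 1" using c(1) by (simp add: indecomposable_def)
      ultimately show False using indecomposable_comp_cases[OF ind(1) c(2)] by simp
    qed
    then have "bs = [p]" using bs ind by (simp add: cs complete_singleton)
    then show ?thesis by (simp add: linked_refl)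
  qed
  have ncf: "nonconst f"
    using less.prems(2) nonconst_rat_comp_list by (auto simp: complete_decomposition_def)
  \<comment> \<open>The Moebius map from \<open>laurent_normalise\<close> is inserted before the
    last function, so passing to normal form is itself part of the chain.\<close>
  have normal: "\<exists>as' a' F. linked f (as @ [a]) (as' @ [a']) \<and> complete_decomposition as' F \<and>
      f = F \<circ>\<^sub>R a' \<and> indecomposable a' \<and>
      ((\<exists>N. F = to_fract N) \<and> a' \<in> laurent_polys \<or> (\<exists>k. a' = ratX ^ k))"
    if c: "complete_decomposition (as @ [a]) f" and ne: "as \<noteq> []" for as a
  proof -
    have a: "indecomposable a" "f = rat_comp_list as \<circ>\<^sub>R a" "complete_decomposition as (rat_comp_list as)"
      using c unfolding complete_snoc[OF ne] by blast+
    have nc: "nonconst (rat_comp_list as)" "nonconst a"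
      using ncf unfolding a(2) nonconst_comp_iff by blast+
    obtain \<mu> F where \<mu>: "rat_degree \<mu> = 1" "rat_comp_list as = F \<circ>\<^sub>R \<mu>"
      "(\<exists>N. F = to_fract N) \<and> \<mu> \<circ>\<^sub>R a \<in> laurent_polys \<or> (\<exists>k\<ge>1. \<mu> \<circ>\<^sub>R a = ratX ^ k)"
      using laurent_normalise[OF f[unfolded a(2)] nc] by metis
    obtain as1 where "complete_decomposition as1 F" "indecomposable (\<mu> \<circ>\<^sub>R a)"
      "linked f (as @ [a]) (as1 @ [\<mu> \<circ>\<^sub>R a])"
      using linked_unit[OF ne c \<mu>(1,2)] by metis
    moreover have "f = F \<circ>\<^sub>R (\<mu> \<circ>\<^sub>R a)" unfolding a(2) \<mu>(2) by (rule rat_comp_assoc[OF nc(2)])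
    ultimately show ?thesis using \<mu>(3) by blast
  qed
  obtain as a where as: "ps = as @ [a]" using less.prems(2) by (metis complete_decomposition_def rev_exhaust)
  obtain bs b where bs: "qs = bs @ [b]" using less.prems(3) by (metis complete_decomposition_def rev_exhaust)
  consider "as = []" | "bs = []" | "as \<noteq> []" "bs \<noteq> []" by blast
  then show ?case
  proof cases
    case 1
    then show ?thesis using short less.prems as by simp
  next
    case 2
    then show ?thesis using short less.prems bs linked_sym by simp
  next
    case 3
    obtain as' a' F where A: "linked f ps (as' @ [a'])" "complete_decomposition as' F" "f = F \<circ>\<^sub>R a'"
      "indecomposable a'" "(\<exists>N. F = to_fract N) \<and> a' \<in> laurent_polys \<or> (\<exists>k. a' = ratX ^ k)"
      using normal[of as a] less.prems(2) as 3(1) by blast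
    obtain bs' b' G where B: "linked f qs (bs' @ [b'])" "complete_decomposition bs' G" "f = G \<circ>\<^sub>R b'"
      "indecomposable b'" "(\<exists>N. G = to_fract N) \<and> b' \<in> laurent_polys \<or> (\<exists>k. b' = ratX ^ k)"
      using normal[of bs b] less.prems(3) bs 3(2) by blast
    have "linked f (as' @ [a']) (bs' @ [b'])"
    proof -
      consider M N where "F = to_fract M" "a' \<in> laurent_polys" "G = to_fract N" "b' \<in> laurent_polys"
        | M l where "F = to_fract M" "a' \<in> laurent_polys" "b' = ratX ^ l"
        | k N where "a' = ratX ^ k" "G = to_fract N" "b' \<in> laurent_polys"
        | k l where "a' = ratX ^ k" "b' = ratX ^ l"
        using A(5) B(5) by blast
      then show ?thesis
      proof cases
        case (1 M N)
        show ?thesis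
          by (rule linked_polynomials[OF IH A(2-4)[unfolded 1(1)] 1(2) B(2-4)[unfolded 1(3)] 1(4) f ncf])
      next
        case (2 M l)
        show ?thesis unfolding 2(3)
          by (rule linked_power_polynomial[OF IH A(2-4)[unfolded 2(1)] 2(2) B(2-4)[unfolded 2(3)] f ncf])
      next
        case (3 k N)
        have "linked f (bs' @ [b']) (as' @ [a'])" unfolding 3(1)
          by (rule linked_power_polynomial[OF IH B(2-4)[unfolded 3(2)] 3(3) A(2-4)[unfolded 3(1)] f ncf])
        then show ?thesis by (rule linked_sym)
      next
        case (4 k l)
        have indk: "indecomposable (ratX ^ k)" "indecomposable (ratX ^ l)" using A(4) B(4) 4 by simp_all
        have kl1: "k \<ge> 1" "l \<ge> 1"
          using indecomposable_power_X_prime[OF indk(1)] indecomposable_power_X_prime[OF indk(2)] prime_ge_1_nat by blast+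
        have "F \<in> laurent_polys" "G \<in> laurent_polys"
          using laurent_left_of_power[of F k] laurent_left_of_power[of G l] f A(3) B(3) 4 kl1 by metis+
        moreover have "b' \<in> comp_field a' \<or> exchangeable f a' b'"
        proof (cases "k = l")
          case True
          then show ?thesis using 4 self_in_comp_field by simp
        next
          case False
          then show ?thesis
            using exchangeable_powers[OF indk False _ _ ncf] A(3) B(3) comp_fieldI unfolding 4 by metis
        qed
        ultimately show ?thesis
          by (intro linked_exchangeable[OF IH A(2) _ A(3,4) B(2) _ B(3,4)])
      qed
    qed
    then show ?thesis using A(1) B(1) linked_trans linked_sym by blast
  qed
qed

lemma rtranclp_chain:
  assumes "r\<^sup>*\<^sup>* x y"
  shows "\<exists>xs. xs \<noteq> [] \<and> hd xs = x \<and> last xs = y \<and> successively r xs"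
  using assms
proof (induction rule: rtranclp_induct)
  case base
  show ?case by (intro exI[of _ "[x]"]) simp
next
  case (step y z)
  then obtain xs where "xs \<noteq> []" "hd xs = x" "last xs = y" "successively r xs" by blast
  then show ?case
    using step.hyps by (intro exI[of _ "xs @ [z]"]) (auto simp: successively_append_iff)
qed

theorem theorem1p1:
  fixes f :: ratfun and ps qs :: "ratfun list"
  assumes "f \<in> laurent_polys"
    and "complete_decomposition ps f"
    and "complete_decomposition qs f"
  shows "mset (map rat_degree ps) = mset (map rat_degree qs) \<and>
    length ps = length qs \<and>
    (\<exists>Ds. Ds \<noteq> [] \<and> hd Ds = ps \<and> last Ds = qs \<and>
       (\<forall>D \<in> set Ds. complete_decomposition D f) \<and>
       successively ritt_step Ds)"
proof -
  have linked: "linked f ps qs" using assms by (rule linked_laurent)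
  then have m: "mset (map rat_degree ps) = mset (map rat_degree qs)" by (simp add: linked_def)
  obtain Ds where Ds: "Ds \<noteq> []" "hd Ds = ps" "last Ds = qs" "successively (complete_step f) Ds"
    using rtranclp_chain linked unfolding linked_def by metis
  \<comment> \<open>A chain with one entry has no step to supply this property, so the induction
    starts from the assumption on \<open>ps\<close>.\<close>
  have "\<forall>D \<in> set Ds. complete_decomposition D f"
  proof -
    have "complete_decomposition (hd Ds) f" using Ds(2) assms(2) by simp
    then show ?thesis
      using Ds(4)
    proof (induction Ds)
      case step: (Cons D Ds)
      show ?case
      proof (cases Ds)
        case Nil
        then show ?thesis using step.prems(1) by simp
      next
        case Ds': (Cons E Es)
        have "complete_step f D E" and succ: "successively (complete_step f) Ds"
          using step.prems(2) unfolding Ds' by simp_all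
        then have "complete_decomposition (hd Ds) f" by (simp add: Ds' complete_step_def)
        from step.IH[OF this succ] show ?thesis using step.prems(1) by simp
      qed
    qed simp
  qed
  moreover have "successively ritt_step Ds"
    using Ds(4) by (rule successively_mono) (simp add: complete_step_def)
  ultimately show ?thesis using m Ds(1-3) mset_eq_length[OF m] by auto
qed

end
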